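(* Let $K$ be an algebraically closed field of characteristic $0$ or of characteristic $>n$, and let $A$ be an $n\times n$ matrix with entries in $K$. There exists a nonzero diagonal matrix $D\in K^{n\times n}$ such that $A$ and $A+D$ have the same spectrum (i.e. the same multiset of eigenvalues, counted with algebraic multiplicity) if and only if there is some $k\in\{1,\dots,n\}$ such that the $k\times k$ principal minors of $A$ are not all equal.
   Context: For $N\subseteq[n]=\{1,\dots,n\}$, the principal submatrix $A_N$ consists of the rows and columns of $A$ indexed by $N$; the $k\times k$ principal minors of $A$ are the numbers $\det(A_N)$ with $|N|=k$. *)

theory Defs
  imports "Jordan_Normal_Form.Determinant" "Jordan_Normal_Form.Char_Poly" "Jordan_Normal_Form.DL_Submatrix"
    "HOL-Computational_Algebra.Polynomial"
begin

definition alg_mult :: "'a :: field mat \<Rightarrow> 'a \<Rightarrow> nat" where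
  "alg_mult A x = order x (char_poly A)"

definition same_spectrum :: "'a :: field mat \<Rightarrow> 'a mat \<Rightarrow> bool" where
  "same_spectrum A B \<longleftrightarrow> (\<forall>x. alg_mult A x = alg_mult B x)"

definition principal_minor :: "'a :: comm_ring_1 mat \<Rightarrow> nat set \<Rightarrow> 'a" where
  "principal_minor A N = det (submatrix A N N)"

end

theory Submission
  imports Defs "HOL-Library.Function_Algebras" "HOL-Computational_Algebra.Formal_Laurent_Series"
begin

text \<open>
  Put \<open>P(x) = \<Sum>\<^sub>M b\<^sub>M x\<^bsub>[n]-M\<^esub>\<close>, where \<open>b\<^sub>M\<close> is the principal minor of \<open>-A\<close> on \<open>M\<close>. Then
  \<open>A\<close> and \<open>A - diag d\<close> have the same spectrum iff \<open>P(t + d) = P(t)\<close> as polynomials in \<open>t\<close>;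
  below, \<open>marked_poly n b d\<close> is \<open>P(t + d)\<close>.
  This is a system of equations of degrees \<open>1, \<dots>, n\<close> whose leading forms are the elementary
  symmetric polynomials, so its coordinate ring has dimension \<open>n!\<close> with the staircase monomials as
  a basis, uniformly in the right-hand side.

  Let \<open>k\<close> be the least size on which the minors differ. Operators commuting with translations
  reduce to the case \<open>b\<^sub>M = 0\<close> for \<open>0 < |M| < k\<close>. The trace over the fibre of \<open>d\<^sub>L\<close>
  (\<open>|L| = k\<close>) does not change under a deformation of the right-hand side to one with \<open>n!\<close>
  distinct solutions given by power series near the permutations of \<open>n\<close> distinct scalars, and there
  it can be read off to first order: it is \<open>C - n! b\<^sub>L\<close> with \<open>C\<close> independent of \<open>L\<close>. So some
  \<open>d\<^sub>L\<close> has nonzero trace, hence a nonzero eigenvalue on the coordinate ring, and a common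
  eigenvector of the commuting multiplication matrices is a solution with \<open>d\<^sub>L \<noteq> 0\<close>.
\<close>

hide_const (open) Module.smult

section \<open>Determinants and principal minors\<close>

text \<open>The point \<open>d = 0\<close> is always a solution, possibly with multiplicity
  \<open>n!\<close>, and that is the case to exclude. A trace detects it: if 0 were the only
  solution, every product of coordinates would act nilpotently. Products over \<open>k\<close>-sets
  are used because the marks of size \<open>k\<close>, the first asymmetry, enter their traces
  linearly.

  The deformed right-hand side is \<open>(\<Prod>i<n. t + s * y i) + P(t) - t^n\<close> with a
  parameter \<open>s\<close> and distinct scalars \<open>y i\<close>. The trace is a polynomial in
  \<open>s\<close> whose constant term is wanted, while the solutions are visible only for large
  \<open>s\<close>. Setting \<open>s = 1/X\<close> and rescaling the unknowns by \<open>X\<close>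
  moves them to \<open>X = 0\<close>, where the system is a small perturbation of the product of the
  \<open>t + y i\<close>; the wanted constant term becomes the coefficient of \<open>X^k\<close> in
  a sum of products of power series. The staircase monomials work over the polynomial ring in
  \<open>s\<close>, so both ends are linked algebraically.

  Division by numbers up to \<open>n\<close> occurs in the normalisation, in the symmetrisation and
  in the factor \<open>n!\<close>, whence the condition on the characteristic.\<close>

definition permdet :: "'a::comm_ring_1 mat \<Rightarrow> nat set \<Rightarrow> 'a" where
  "permdet A M = (\<Sum>p | p permutes M. signof p * (\<Prod>i\<in>M. A $$ (i, p i)))"

text \<open>The Leibniz sum over permutations of \<open>M\<close> itself keeps all minors inside one
  matrix. Conjugation with the increasing enumeration \<open>pick M\<close> matches these with the
  permutations of an initial segment and preserves signs.\<close>

lemma principal_minor_eq_permdet: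
  assumes A: "A \<in> carrier_mat n n" and M: "M \<subseteq> {..<n}"
  shows "principal_minor A M = permdet A M"
proof -
  define m where "m = card M"
  have fin: "finite M" using M finite_subset by blast
  have S: "{i. i < n \<and> i \<in> M} = M" using M by auto
  have sub: "submatrix A M M \<in> carrier_mat m m"
    using A S by (intro carrier_matI) (simp_all add: m_def dim_submatrix)
  have bij: "bij_betw (pick M) {0..<m} M"
  proof (rule bij_betw_imageI)
    show inj: "inj_on (pick M) {0..<m}"
      by (rule linorder_inj_onI') (use pick_mono[of _ M] m_def in fastforce)
    have "pick M ` {0..<m} \<subseteq> M" using pick_in_set[of _ M] by (auto simp: m_def)
    then show "pick M ` {0..<m} = M"
      by (intro card_subset_eq[OF fin]) (simp_all add: card_image[OF inj], simp add: m_def)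
  qed
  let ?mp = "map_permutation {0..<m} (pick M)"
  have bijP: "bij_betw ?mp {p. p permutes {0..<m}} {p. p permutes M}"
  proof (rule bij_betwI')
    fix p q assume "p \<in> {p. p permutes {0..<m}}" "q \<in> {p. p permutes {0..<m}}"
    then have pq: "p permutes {0..<m}" "q permutes {0..<m}" by auto
    show "(?mp p = ?mp q) = (p = q)"
      using map_permutation_compose_inv[OF bij pq(1), of "inv_into {0..<m} (pick M)"]
        map_permutation_compose_inv[OF bij pq(2), of "inv_into {0..<m} (pick M)"] bij
      by (metis bij_betw_inv_into_left)
  next
    fix p assume "p \<in> {p. p permutes {0..<m}}"
    then show "?mp p \<in> {p. p permutes M}" using map_permutation_permutes[OF bij] by auto
  next
    fix q assume "q \<in> {p. p permutes M}"
    then have q: "q permutes M" by auto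
    let ?p = "map_permutation M (inv_into {0..<m} (pick M)) q"
    have "?p permutes {0..<m}" using map_permutation_permutes[OF bij_betw_inv_into[OF bij] q] .
    moreover have "?mp ?p = q"
      by (rule map_permutation_compose_inv[OF bij_betw_inv_into[OF bij] q])
        (use bij in \<open>auto simp: bij_betw_inv_into_right\<close>)
    ultimately show "\<exists>p\<in>{p. p permutes {0..<m}}. q = ?mp p" by auto
  qed
  have sgn: "signof (?mp p) = (signof p :: 'a)" if p: "p permutes {0..<m}" for p
    using sign_map_permutation[of "pick M" "{0..<m}" p] p bij by (simp add: bij_betw_def)
  have "principal_minor A M = (\<Sum>p | p permutes {0..<m}. signof p * (\<Prod>i = 0..<m. A $$ (pick M i, pick M (p i))))"
    unfolding principal_minor_def det_def'[OF sub]
  proof (intro sum.cong refl arg_cong2[where f = "(*)"] prod.cong)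
    fix p i assume "p \<in> {p. p permutes {0..<m}}" "i \<in> {0..<m}"
    then have "i < m" "p i < m" by (auto simp: permutes_in_image)
    then show "submatrix A M M $$ (i, p i) = A $$ (pick M i, pick M (p i))"
      using A S by (intro submatrix_index) (simp_all add: m_def)
  qed
  also have "\<dots> = (\<Sum>p | p permutes {0..<m}. signof (?mp p) * (\<Prod>i\<in>M. A $$ (i, ?mp p i)))"
  proof (intro sum.cong refl arg_cong2[where f = "(*)"])
    fix p assume "p \<in> {p. p permutes {0..<m}}"
    then have p: "p permutes {0..<m}" by auto
    show "signof p = (signof (?mp p) :: 'a)" using sgn[OF p] by simp
    show "(\<Prod>i = 0..<m. A $$ (pick M i, pick M (p i))) = (\<Prod>i\<in>M. A $$ (i, ?mp p i))"
      using bij by (subst prod.reindex_bij_betw[OF bij, symmetric])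
        (auto intro!: prod.cong simp: map_permutation_apply bij_betw_def)
  qed
  also have "\<dots> = permdet A M"
    unfolding permdet_def by (rule sum.reindex_bij_betw[OF bijP])
  finally show ?thesis .
qed

text \<open>Each factor of the Leibniz product is a sum; \<open>M\<close> collects the positions
  where the entry of \<open>A\<close> is chosen. The other positions force fixed points, so only
  permutations of \<open>M\<close> remain.\<close>

lemma det_add_diag:
  fixes A :: "'a::comm_ring_1 mat"
  assumes A: "A \<in> carrier_mat n n"
  shows "det (A + mat n n (\<lambda>(i,j). if i = j then x i else 0)) =
    (\<Sum>M\<in>Pow {..<n}. principal_minor A M * (\<Prod>i\<in>{..<n} - M. x i))"
proof -
  let ?I = "{..<n}"
  let ?X = "mat n n (\<lambda>(i,j). if i = j then x i else 0)"
  have AX: "A + ?X \<in> carrier_mat n n" using A by simp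
  have "det (A + ?X) = (\<Sum>p | p permutes ?I. signof p * (\<Prod>i<n. A $$ (i, p i) + (if i = p i then x i else 0)))"
    unfolding det_def'[OF AX] atLeast0LessThan
  proof (intro sum.cong refl arg_cong2[where f = "(*)"] prod.cong)
    fix p i assume "p \<in> {p. p permutes ?I}" "i \<in> ?I"
    then have "i < n" "p i < n" using permutes_in_image[of p ?I i] by auto
    then show "(A + ?X) $$ (i, p i) = A $$ (i, p i) + (if i = p i then x i else 0)" using A by simp
  qed
  also have "\<dots> = (\<Sum>p | p permutes ?I. \<Sum>M\<in>Pow ?I. signof p * ((\<Prod>i\<in>M. A $$ (i, p i)) * (\<Prod>i\<in>?I-M. if i = p i then x i else 0)))"
    by (simp add: prod_add sum_distrib_left)
  also have "\<dots> = (\<Sum>M\<in>Pow ?I. \<Sum>p | p permutes ?I. signof p * ((\<Prod>i\<in>M. A $$ (i, p i)) * (\<Prod>i\<in>?I-M. if i = p i then x i else 0)))"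
    by (rule sum.swap)
  also have "\<dots> = (\<Sum>M\<in>Pow ?I. principal_minor A M * (\<Prod>i\<in>?I - M. x i))"
  proof (rule sum.cong[OF refl])
    fix M assume "M \<in> Pow ?I"
    then have M: "M \<subseteq> ?I" by auto
    have fin: "finite {p. p permutes ?I}" by (simp add: finite_permutations)
    have "(\<Sum>p | p permutes ?I. signof p * ((\<Prod>i\<in>M. A $$ (i, p i)) * (\<Prod>i\<in>?I-M. if i = p i then x i else 0)))
      = (\<Sum>p | p permutes M. signof p * ((\<Prod>i\<in>M. A $$ (i, p i)) * (\<Prod>i\<in>?I-M. if i = p i then x i else 0)))"
    proof (rule sum.mono_neutral_right[OF fin])
      show "{p. p permutes M} \<subseteq> {p. p permutes ?I}" using M permutes_subset by auto
      show "\<forall>p\<in>{p. p permutes ?I} - {p. p permutes M}. signof p * ((\<Prod>i\<in>M. A $$ (i, p i)) * (\<Prod>i\<in>?I-M. if i = p i then x i else 0)) = 0"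
      proof
        fix p assume p: "p \<in> {p. p permutes ?I} - {p. p permutes M}"
        have "\<exists>i\<in>?I - M. p i \<noteq> i"
        proof (rule ccontr)
          assume "\<not> ?thesis"
          then have "p permutes M" using p permutes_superset[of p ?I M] by auto
          then show False using p by auto
        qed
        then have "(\<Prod>i\<in>?I-M. if i = p i then x i else 0) = 0"
          by (intro prod_zero) (auto intro!: bexI)
        then show "signof p * ((\<Prod>i\<in>M. A $$ (i, p i)) * (\<Prod>i\<in>?I-M. if i = p i then x i else 0)) = 0" by simp
      qed
    qed
    also have "\<dots> = (\<Sum>p | p permutes M. signof p * (\<Prod>i\<in>M. A $$ (i, p i)) * (\<Prod>i\<in>?I-M. x i))"
      by (intro sum.cong refl) (auto simp: permutes_not_in mult.assoc intro!: arg_cong2[where f="(*)"] prod.cong)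
    also have "\<dots> = principal_minor A M * (\<Prod>i\<in>?I - M. x i)"
      unfolding principal_minor_eq_permdet[OF A M] permdet_def by (simp add: sum_distrib_right)
    finally show "(\<Sum>p | p permutes ?I. signof p * ((\<Prod>i\<in>M. A $$ (i, p i)) * (\<Prod>i\<in>?I-M. if i = p i then x i else 0)))
      = principal_minor A M * (\<Prod>i\<in>?I - M. x i)" .
  qed
  finally show ?thesis .
qed

section \<open>Multiaffine polynomials marked by subsets\<close>

definition marked_poly :: "nat \<Rightarrow> (nat set \<Rightarrow> 'a) \<Rightarrow> (nat \<Rightarrow> 'a) \<Rightarrow> 'a::comm_ring_1 poly" where
  "marked_poly n c x = (\<Sum>M\<in>Pow {..<n}. smult (c M) (\<Prod>i\<in>{..<n} - M. [:x i, 1:]))"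

lemma poly_marked_poly:
  "poly (marked_poly n c x) t = (\<Sum>M\<in>Pow {..<n}. c M * (\<Prod>i\<in>{..<n} - M. x i + t))"
  by (simp add: marked_poly_def poly_sum poly_prod)

text \<open>Over a ring with zero divisors the degree of a product may drop, so degree and leading
  coefficient go through one induction.\<close>

lemma degree_prod_linear:
  fixes x :: "'b \<Rightarrow> 'a::comm_ring_1"
  assumes "finite J"
  shows "degree (\<Prod>i\<in>J. [:x i, 1:]) = card J" "coeff (\<Prod>i\<in>J. [:x i, 1:]) (card J) = 1"
proof -
  have "degree (\<Prod>i\<in>J. [:x i, 1:]) = card J \<and> coeff (\<Prod>i\<in>J. [:x i, 1:]) (card J) = 1"
    using assms
  proof (induction J)
    case (insert a J)
    let ?p = "\<Prod>i\<in>J. [:x i, 1:]"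
    let ?q = "[:x a, 1:] * ?p"
    have lc: "coeff ?q (Suc (card J)) = 1"
      using insert.IH by (simp add: mult_pCons_left coeff_eq_0)
    have "degree ?q \<le> degree [:x a, 1:] + degree ?p" by (rule degree_mult_le)
    then have "degree ?q \<le> Suc (card J)" using insert.IH by simp
    moreover have "Suc (card J) \<le> degree ?q" by (rule le_degree) (simp only: lc, simp)
    ultimately show ?case using insert lc by simp
  qed simp
  then show "degree (\<Prod>i\<in>J. [:x i, 1:]) = card J" "coeff (\<Prod>i\<in>J. [:x i, 1:]) (card J) = 1" by auto
qed

lemma degree_marked_poly_le: "degree (marked_poly n c x) \<le> n"
  unfolding marked_poly_def
proof (rule degree_sum_le)
  fix M assume "M \<in> Pow {..<n}"
  have "degree (smult (c M) (\<Prod>i\<in>{..<n} - M. [:x i, 1:])) \<le> degree (\<Prod>i\<in>{..<n} - M. [:x i, 1:])"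
    by (rule degree_smult_le)
  also have "\<dots> = card ({..<n} - M)" by (rule degree_prod_linear) simp
  also have "\<dots> \<le> n" using card_mono[of "{..<n}" "{..<n} - M"] by simp
  finally show "degree (smult (c M) (\<Prod>i\<in>{..<n} - M. [:x i, 1:])) \<le> n" .
qed simp

lemma coeff_marked_poly_top: "coeff (marked_poly n c x) n = c {}"
proof -
  have "coeff (\<Prod>i\<in>{..<n} - M. [:x i, 1:]) n = (if M = {} then 1 else 0)" if "M \<subseteq> {..<n}" for M
  proof (cases "M = {}")
    case True
    then show ?thesis using degree_prod_linear(2)[of "{..<n}" x] by simp
  next
    case False
    then have "card ({..<n} - M) < card {..<n}" using that by (intro psubset_card_mono) auto
    then show ?thesis using False degree_prod_linear(1)[of "{..<n} - M" x] by (simp add: coeff_eq_0)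
  qed
  then have "coeff (marked_poly n c x) n = (\<Sum>M\<in>Pow {..<n}. if M = {} then c M else 0)"
    unfolding marked_poly_def coeff_sum coeff_smult by (intro sum.cong refl) auto
  then show ?thesis by (simp add: sum.delta')
qed

text \<open>The effect of \<open>d/dt\<close> on the marks: one factor is lost, so its index joins
  the marked set. The shifts \<open>x\<close> do not enter, which is why such operators commute with
  translations.\<close>

definition mark_deriv :: "(nat set \<Rightarrow> 'a::comm_ring_1) \<Rightarrow> nat set \<Rightarrow> 'a" where
  "mark_deriv b M = (\<Sum>i\<in>M. b (M - {i}))"

text \<open>The product rule yields pairs of a set and a deleted index outside it; moving the index
  into the set regroups them.\<close>

lemma pderiv_marked_poly: "pderiv (marked_poly n b x) = marked_poly n (mark_deriv b) x"
proof -
  let ?I = "{..<n}"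
  have dprod: "pderiv (\<Prod>i\<in>J. [:x i, 1:]) = (\<Sum>i\<in>J. \<Prod>j\<in>J - {i}. [:x j, 1:])" if "finite J" for J :: "nat set"
    using that by (simp add: pderiv_prod pderiv_pCons)
  have "pderiv (marked_poly n b x) = (\<Sum>M\<in>Pow ?I. \<Sum>i\<in>?I - M. smult (b M) (\<Prod>j\<in>?I - M - {i}. [:x j, 1:]))"
    by (simp add: marked_poly_def pderiv_sum pderiv_smult dprod smult_sum2)
  also have "\<dots> = (\<Sum>(M, i)\<in>Sigma (Pow ?I) (\<lambda>M. ?I - M). smult (b M) (\<Prod>j\<in>?I - M - {i}. [:x j, 1:]))"
    by (rule sum.Sigma) (auto simp: finite_subset)
  also have "\<dots> = (\<Sum>(M, i)\<in>Sigma (Pow ?I) (\<lambda>M. M). smult (b (M - {i})) (\<Prod>j\<in>?I - M. [:x j, 1:]))"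
    by (rule sum.reindex_bij_witness[where i = "\<lambda>(M, i). (M - {i}, i)" and j = "\<lambda>(M, i). (insert i M, i)"])
      (auto simp: insert_absorb Diff_insert2[symmetric] Diff_insert[symmetric])
  also have "\<dots> = (\<Sum>M\<in>Pow ?I. \<Sum>i\<in>M. smult (b (M - {i})) (\<Prod>j\<in>?I - M. [:x j, 1:]))"
    by (rule sum.Sigma[symmetric]) (auto simp: finite_subset)
  also have "\<dots> = marked_poly n (mark_deriv b) x"
    by (simp add: marked_poly_def mark_deriv_def smult_sum)
  finally show ?thesis .
qed

lemma pderiv_funpow_marked_poly:
  "(pderiv ^^ m) (marked_poly n b x) = marked_poly n ((mark_deriv ^^ m) b) x"
  by (induction m) (simp_all add: pderiv_marked_poly)

lemma mark_deriv_funpow_small: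
  assumes "finite M" "card M < m"
  shows "(mark_deriv ^^ m) b M = 0"
  using assms
proof (induction m arbitrary: M)
  case (Suc m)
  have "(mark_deriv ^^ m) b (M - {i}) = 0" if "i \<in> M" for i
    using Suc.prems that card_gt_0_iff[of M] by (intro Suc.IH) auto
  then show ?case
    unfolding funpow.simps comp_def by (subst mark_deriv_def) simp
qed simp

text \<open>The factorial counts the orders in which the elements of \<open>M\<close> can be
  removed.\<close>

lemma mark_deriv_funpow_same_card:
  assumes "finite M" "card M = m"
  shows "(mark_deriv ^^ m) b M = of_nat (fact m) * b {}"
  using assms
proof (induction m arbitrary: M)
  case (Suc m)
  have "(mark_deriv ^^ m) b (M - {i}) = of_nat (fact m) * b {}" if "i \<in> M" for i
    using Suc.prems that by (intro Suc.IH) auto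
  then have "(mark_deriv ^^ Suc m) b M = (\<Sum>i\<in>M. of_nat (fact m) * b {})"
    unfolding funpow.simps comp_def by (subst mark_deriv_def) (rule sum.cong[OF refl])
  then show ?case using Suc.prems by (simp add: algebra_simps)
qed simp

text \<open>The value at \<open>M\<close> of the \<open>m\<close>-th derivative only involves sets of size \<open>card M - m\<close>.\<close>

lemma mark_deriv_funpow_cong_card:
  assumes "\<And>M N. M \<subseteq> {..<n} \<Longrightarrow> N \<subseteq> {..<n} \<Longrightarrow> card M = card N \<Longrightarrow> card M < k \<Longrightarrow> b M = b N"
    and "M \<subseteq> {..<n}" "N \<subseteq> {..<n}" "card M = card N" "card M < k + m"
  shows "(mark_deriv ^^ m) b M = (mark_deriv ^^ m) b N"
  using assms(2-)
proof (induction m arbitrary: M N)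
  case 0
  then have "b M = b N" by (intro assms(1)) simp_all
  then show ?case by simp
next
  case (Suc m)
  have fin: "finite M" "finite N" using Suc.prems finite_subset by blast+
  obtain f where f: "bij_betw f M N"
    using finite_same_card_bij[OF fin] Suc.prems by auto
  have "(\<Sum>i\<in>M. (mark_deriv ^^ m) b (M - {i})) = (\<Sum>i\<in>M. (mark_deriv ^^ m) b (N - {f i}))"
  proof (intro sum.cong refl)
    fix i assume i: "i \<in> M"
    then have fi: "f i \<in> N" using f bij_betwE by blast
    have "card M > 0" using i fin card_gt_0_iff by blast
    then show "(mark_deriv ^^ m) b (M - {i}) = (mark_deriv ^^ m) b (N - {f i})"
      using Suc.prems i fi fin by (intro Suc.IH) auto
  qed
  also have "\<dots> = (\<Sum>i\<in>N. (mark_deriv ^^ m) b (N - {i}))"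
    by (rule sum.reindex_bij_betw[OF f])
  finally show ?case
    unfolding funpow.simps comp_def by (subst (1 2) mark_deriv_def)
qed

lemma marked_poly_diff_smult:
  "marked_poly n (\<lambda>M. b M - c * b' M) x = marked_poly n b x - smult c (marked_poly n b' x)"
  by (simp add: marked_poly_def smult_diff_left sum_subtractf smult_sum2)

text \<open>Injectivity of \<open>1 - c (d/dt)^m\<close>: differentiation lowers a positive degree
  and kills constants.\<close>

lemma eq_smult_higher_pderiv_imp_0:
  fixes p :: "'a::field poly"
  assumes "p = smult c ((pderiv ^^ m) p)" "m > 0"
  shows "p = 0"
proof (rule ccontr)
  assume p: "p \<noteq> 0"
  have le: "degree ((pderiv ^^ m) p) \<le> degree p - m" for m
    by (induction m) (auto intro: order_trans[OF degree_pderiv_le])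
  show False
  proof (cases "degree p = 0")
    case True
    then obtain a where "p = [:a:]" by (auto elim: degree_eq_zeroE)
    moreover have "(pderiv ^^ m) [:a:] = 0"
    proof -
      have "(pderiv ^^ l) 0 = (0 :: 'a poly)" for l by (induction l) simp_all
      then show ?thesis using \<open>m > 0\<close>
        by (cases m) (simp_all add: funpow_Suc_right pderiv_pCons del: funpow.simps)
    qed
    ultimately show False using assms p by simp
  next
    case False
    have "degree p \<le> degree ((pderiv ^^ m) p)" by (metis assms(1) degree_smult_le)
    then show False using le[of m] False assms(2) by simp
  qed
qed

text \<open>Operators of the form \<open>1 - c \<cdot> (d/dt)^m\<close> commute with translations and are invertible on
  polynomials, so they preserve the solution set of \<open>P(t + d) = P(t)\<close> while clearing the
  symmetric terms one size at a time.\<close>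

lemma marked_poly_normalise:
  fixes b :: "nat set \<Rightarrow> 'a::field"
  assumes b0: "b {} = 1"
    and const: "\<And>M N. M \<subseteq> {..<n} \<Longrightarrow> N \<subseteq> {..<n} \<Longrightarrow> card M = card N \<Longrightarrow> card M < k \<Longrightarrow> b M = b N"
    and char: "\<And>m. m \<le> n \<Longrightarrow> of_nat (fact m) \<noteq> (0::'a)"
  obtains b' where "b' {} = 1"
    "\<And>M. M \<subseteq> {..<n} \<Longrightarrow> M \<noteq> {} \<Longrightarrow> card M < k \<Longrightarrow> b' M = 0"
    "\<And>M N. M \<subseteq> {..<n} \<Longrightarrow> N \<subseteq> {..<n} \<Longrightarrow> card M = k \<Longrightarrow> card N = k \<Longrightarrow> b' M - b' N = b M - b N"
    "\<And>d e. marked_poly n b' d = marked_poly n b' e \<longleftrightarrow> marked_poly n b d = marked_poly n b e"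
proof -
  define normal where "normal m b' \<longleftrightarrow> b' {} = 1 \<and>
    (\<forall>M. M \<subseteq> {..<n} \<longrightarrow> M \<noteq> {} \<longrightarrow> card M < k \<longrightarrow> card M \<le> m \<longrightarrow> b' M = 0) \<and>
    (\<forall>M N. M \<subseteq> {..<n} \<longrightarrow> N \<subseteq> {..<n} \<longrightarrow> card M = card N \<longrightarrow> card M < k \<longrightarrow> b' M = b' N) \<and>
    (\<forall>M N. M \<subseteq> {..<n} \<longrightarrow> N \<subseteq> {..<n} \<longrightarrow> card M = k \<longrightarrow> card N = k \<longrightarrow> b' M - b' N = b M - b N) \<and>
    (\<forall>d e. marked_poly n b' d = marked_poly n b' e \<longleftrightarrow> marked_poly n b d = marked_poly n b e)"
    for m and b' :: "nat set \<Rightarrow> 'a"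
  have normalI: "normal m b'"
    if "b' {} = 1"
      "\<And>M. M \<subseteq> {..<n} \<Longrightarrow> M \<noteq> {} \<Longrightarrow> card M < k \<Longrightarrow> card M \<le> m \<Longrightarrow> b' M = 0"
      "\<And>M N. M \<subseteq> {..<n} \<Longrightarrow> N \<subseteq> {..<n} \<Longrightarrow> card M = card N \<Longrightarrow> card M < k \<Longrightarrow> b' M = b' N"
      "\<And>M N. M \<subseteq> {..<n} \<Longrightarrow> N \<subseteq> {..<n} \<Longrightarrow> card M = k \<Longrightarrow> card N = k \<Longrightarrow> b' M - b' N = b M - b N"
      "\<And>d e. marked_poly n b' d = marked_poly n b' e \<longleftrightarrow> marked_poly n b d = marked_poly n b e"
    for m b'
    unfolding normal_def by (intro conjI allI impI) (rule that; assumption)+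
  have "\<exists>b'. normal m b'" if "m \<le> n" for m
    using that
  proof (induction m)
    case 0
    have "normal 0 b"
    proof (rule normalI)
      show "b M = 0" if "M \<subseteq> {..<n}" "M \<noteq> {}" "card M \<le> 0" for M
        using that finite_subset[of M "{..<n}"] by auto
    qed (fact b0 | rule const refl; assumption)+
    then show ?case by blast
  next
    case (Suc m)
    then obtain b' where b': "normal m b'" by (meson Suc_leD)
    have b'0: "b' {} = 1" using b' unfolding normal_def by blast
    have b'z: "b' M = 0" if "M \<subseteq> {..<n}" "M \<noteq> {}" "card M < k" "card M \<le> m" for M
      using b' that unfolding normal_def by blast
    have b'c: "b' M = b' N" if "M \<subseteq> {..<n}" "N \<subseteq> {..<n}" "card M = card N" "card M < k" for M N
      using b' that unfolding normal_def by blast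
    have b'd: "b' M - b' N = b M - b N" if "M \<subseteq> {..<n}" "N \<subseteq> {..<n}" "card M = k" "card N = k" for M N
      using b' that unfolding normal_def by blast
    have b'e: "marked_poly n b' d = marked_poly n b' e \<longleftrightarrow> marked_poly n b d = marked_poly n b e" for d e
      using b' unfolding normal_def by blast
    \<comment> \<open>On sets of size \<open>Suc m\<close> the iterated \<open>mark_deriv\<close>
      gives \<open>fact (Suc m)\<close>, because \<open>b' {} = 1\<close>. For
      \<open>Suc m < k\<close> this \<open>c\<close> therefore cancels their common mark; on smaller
      sets the iterate vanishes and changes nothing.\<close>
    define c where "c = b' {..<Suc m} / of_nat (fact (Suc m))"
    define b'' where "b'' M = b' M - c * (mark_deriv ^^ Suc m) b' M" for M
    have subs: "{..<Suc m} \<subseteq> {..<n}" using Suc.prems by auto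
    have fin: "finite M" if "M \<subseteq> {..<n}" for M using that finite_subset by blast
    have "b'' M = 0" if M: "M \<subseteq> {..<n}" "M \<noteq> {}" "card M < k" "card M \<le> Suc m" for M
    proof (cases "card M = Suc m")
      case True
      then have "b' M = b' {..<Suc m}" using M subs by (intro b'c) simp_all
      moreover have "(mark_deriv ^^ Suc m) b' M = of_nat (fact (Suc m))"
        using mark_deriv_funpow_same_card[OF fin[OF M(1)] True, of b'] by (simp only: b'0 mult_1_right)
      ultimately show ?thesis using char[OF Suc.prems] by (simp add: b''_def c_def del: fact_Suc funpow.simps)
    next
      case False
      then show ?thesis using b'z[OF M(1-3)] M mark_deriv_funpow_small[OF fin[OF M(1)], of "Suc m" b']
        by (simp add: b''_def del: funpow.simps)
    qed
    moreover have "b'' {} = 1"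
      using b'0 mark_deriv_funpow_small[of "{}" "Suc m" b'] by (simp add: b''_def del: funpow.simps)
    \<comment> \<open>At size \<open>k\<close> the derivative sees only sizes below
      \<open>k\<close>, where \<open>b'\<close> is symmetric; so differences between marks of size
      \<open>k\<close> survive.\<close>
    moreover have D: "(mark_deriv ^^ Suc m) b' M = (mark_deriv ^^ Suc m) b' N"
      if "M \<subseteq> {..<n}" "N \<subseteq> {..<n}" "card M = card N" "card M \<le> k" for M N
    proof (rule mark_deriv_funpow_cong_card[of n k])
      show "card M < k + Suc m" using that by simp
    qed (fact that | rule b'c; assumption)+
    have "b'' M = b'' N" if "M \<subseteq> {..<n}" "N \<subseteq> {..<n}" "card M = card N" "card M < k" for M N
      using b'c[OF that] D[OF that(1-3)] that(4) unfolding b''_def by (metis less_imp_le)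
    moreover have "b'' M - b'' N = b M - b N" if "M \<subseteq> {..<n}" "N \<subseteq> {..<n}" "card M = k" "card N = k" for M N
    proof -
      have "b'' M - b'' N = b' M - b' N" using D[OF that(1,2)] that(3,4) by (simp add: b''_def del: funpow.simps)
      then show ?thesis using b'd[OF that] by simp
    qed
    moreover have "marked_poly n b'' d = marked_poly n b'' e \<longleftrightarrow> marked_poly n b d = marked_poly n b e" for d e
    proof -
      have mp: "marked_poly n b'' x = marked_poly n b' x - smult c ((pderiv ^^ Suc m) (marked_poly n b' x))" for x
        unfolding b''_def marked_poly_diff_smult pderiv_funpow_marked_poly ..
      have lin: "(pderiv ^^ l) (p - q) = (pderiv ^^ l) p - (pderiv ^^ l) q" for l and p q :: "'a poly"
        by (induction l) (simp_all add: pderiv_diff)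
      have "marked_poly n b'' d = marked_poly n b'' e \<longleftrightarrow> marked_poly n b' d = marked_poly n b' e"
      proof
        assume "marked_poly n b'' d = marked_poly n b'' e"
        then have "marked_poly n b' d - marked_poly n b' e =
            smult c ((pderiv ^^ Suc m) (marked_poly n b' d - marked_poly n b' e))"
          unfolding mp lin smult_diff_right by (simp add: algebra_simps del: funpow.simps)
        then show "marked_poly n b' d = marked_poly n b' e"
          using eq_smult_higher_pderiv_imp_0 by (metis right_minus_eq zero_less_Suc)
      qed (simp add: mp)
      then show ?thesis using b'e by simp
    qed
    ultimately have "normal (Suc m) b''" by (intro normalI)
    then show ?case by blast
  qed
  then obtain b' where b': "normal n b'" by blast
  show ?thesis
  proof (rule that)
    show "b' {} = 1" using b' unfolding normal_def by blast
    show "b' M = 0" if "M \<subseteq> {..<n}" "M \<noteq> {}" "card M < k" for M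
    proof -
      have "card M \<le> n" using card_mono[OF _ that(1)] by simp
      then show ?thesis using b' that unfolding normal_def by blast
    qed
    show "b' M - b' N = b M - b N" if "M \<subseteq> {..<n}" "N \<subseteq> {..<n}" "card M = k" "card N = k" for M N
      using b' that unfolding normal_def by blast
    show "marked_poly n b' d = marked_poly n b' e \<longleftrightarrow> marked_poly n b d = marked_poly n b e" for d e
      using b' unfolding normal_def by blast
  qed
qed

section \<open>Staircase monomials span the coordinate ring\<close>

definition esym :: "'b set \<Rightarrow> nat \<Rightarrow> ('b \<Rightarrow> 'a) \<Rightarrow> 'a::comm_ring_1" where
  "esym J m x = (\<Sum>L | L \<subseteq> J \<and> card L = m. \<Prod>i\<in>L. x i)"

lemma esym_0 [simp]: "finite J \<Longrightarrow> esym J 0 x = 1"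
proof -
  assume J: "finite J"
  have "L = {}" if "L \<subseteq> J" "card L = 0" for L
    using that finite_subset[OF _ J, of L] by simp
  then have "{L. L \<subseteq> J \<and> card L = 0} = {{}}" by auto
  then show ?thesis by (simp add: esym_def)
qed

lemma esym_insert:
  assumes "finite J" "a \<notin> J"
  shows "esym (insert a J) (Suc m) x = esym J (Suc m) x + x a * esym J m x"
proof -
  have fin: "finite L" if "L \<subseteq> J" for L using that assms finite_subset by blast
  have "{L. L \<subseteq> insert a J \<and> card L = Suc m} =
      {L. L \<subseteq> J \<and> card L = Suc m} \<union> insert a ` {L. L \<subseteq> J \<and> card L = m}" (is "?A = ?B \<union> ?C")
  proof (intro equalityI subsetI)
    fix L assume L: "L \<in> ?A"
    show "L \<in> ?B \<union> ?C"
    proof (cases "a \<in> L")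
      case True
      then have "L = insert a (L - {a})" "L - {a} \<in> {L. L \<subseteq> J \<and> card L = m}"
        using L by auto
      then show ?thesis by blast
    qed (use L in auto)
  next
    fix L assume "L \<in> ?B \<union> ?C"
    then show "L \<in> ?A"
    proof
      assume "L \<in> ?C"
      then obtain L' where L': "L = insert a L'" "L' \<subseteq> J" "card L' = m" by auto
      then have "a \<notin> L'" using assms by auto
      then show ?thesis using L' fin by auto
    qed auto
  qed
  moreover have "?B \<inter> ?C = {}" using assms by auto
  moreover have "finite ?B" "finite ?C" using assms by auto
  moreover have "(\<Sum>L\<in>?C. \<Prod>i\<in>L. x i) = x a * esym J m x"
  proof -
    have inj: "inj_on (insert a) {L. L \<subseteq> J \<and> card L = m}"
      using assms by (intro inj_onI) (metis (no_types, lifting) insert_ident mem_Collect_eq subsetD)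
    have "(\<Prod>i\<in>insert a L. x i) = x a * (\<Prod>i\<in>L. x i)" if "L \<subseteq> J" for L
      using assms that fin by (subst prod.insert) auto
    then show ?thesis
      unfolding esym_def by (subst sum.reindex[OF inj]) (auto simp: sum_distrib_left intro!: sum.cong)
  qed
  ultimately show ?thesis by (simp add: esym_def sum.union_disjoint)
qed

lemma prod_add_const_esym:
  assumes "finite J"
  shows "(\<Prod>i\<in>J. x i + t) = (\<Sum>m\<le>card J. esym J m x * t ^ (card J - m))"
proof -
  have "(\<Prod>i\<in>J. x i + t) = (\<Sum>L\<in>Pow J. (\<Prod>i\<in>L. x i) * t ^ (card J - card L))"
    using assms by (subst prod_add)
      (auto intro!: sum.cong simp: card_Diff_subset finite_subset)
  also have "\<dots> = (\<Sum>m\<le>card J. \<Sum>L | L \<in> Pow J \<and> card L = m. (\<Prod>i\<in>L. x i) * t ^ (card J - card L))"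
    using assms by (intro sum.group[symmetric]) (auto intro: card_mono)
  also have "\<dots> = (\<Sum>m\<le>card J. esym J m x * t ^ (card J - m))"
    by (simp add: esym_def sum_distrib_right)
  finally show ?thesis .
qed

lemma coeff_prod_linear:
  assumes "finite J"
  shows "coeff (\<Prod>i\<in>J. [:x i, 1:]) m = (if m \<le> card J then esym J (card J - m) x else 0)"
  using assms
proof (induction J arbitrary: m)
  case empty
  then show ?case by (cases m) simp_all
next
  case (insert a J)
  have c: "coeff ([:x a, 1:] * p) m = x a * coeff p m + (if m = 0 then 0 else coeff p (m - 1))" for p
    by (cases m) (simp_all add: mult_pCons_left)
  have z: "esym J (Suc (card J)) x = 0"
  proof -
    have "card L \<noteq> Suc (card J)" if "L \<subseteq> J" for L using card_mono[OF insert.hyps(1) that] by simp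
    then have "{L. L \<subseteq> J \<and> card L = Suc (card J)} = {}" by blast
    then show ?thesis by (simp only: esym_def sum.empty)
  qed
  show ?case
  proof (cases m)
    case 0
    then show ?thesis using insert by (simp add: c esym_insert z)
  next
    case (Suc k)
    show ?thesis
    proof (cases "k < card J")
      case True
      then obtain l where "card J - k = Suc l" "card J - Suc k = l" by (metis Suc_diff_Suc)
      then show ?thesis using insert Suc True by (simp add: c esym_insert)
    next
      case False
      then show ?thesis using insert Suc by (auto simp: c)
    qed
  qed
qed

lemma coeff_marked_poly:
  "coeff (marked_poly n c x) m =
    (\<Sum>M\<in>Pow {..<n}. c M * (if m + card M \<le> n then esym ({..<n} - M) (n - card M - m) x else 0))"
  unfolding marked_poly_def coeff_sum coeff_smult
proof (intro sum.cong refl arg_cong2[where f = "(*)"])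
  fix M assume "M \<in> Pow {..<n}"
  then have "card ({..<n} - M) = n - card M" "card M \<le> n"
    using card_mono[of "{..<n}" M] by (auto simp: card_Diff_subset finite_subset)
  then show "coeff (\<Prod>i\<in>{..<n} - M. [:x i, 1:]) m =
      (if m + card M \<le> n then esym ({..<n} - M) (n - card M - m) x else 0)"
    by (subst coeff_prod_linear) auto
qed

section \<open>Weighted monomials and reduction to the staircase\<close>

definition monom_val :: "nat \<Rightarrow> (nat \<Rightarrow> 'r::comm_ring_1) \<Rightarrow> (nat \<Rightarrow> nat) \<Rightarrow> 'r" where
  "monom_val n x g = (\<Prod>i<n. x i ^ g i)"

text \<open>These weights break ties between monomials of the same degree in favour of the variables with
  large index, while a drop of the degree by one outweighs any such gain for degrees up to \<open>n\<close>.\<close>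

definition weight :: "nat \<Rightarrow> (nat \<Rightarrow> nat) \<Rightarrow> nat" where
  "weight n g = (\<Sum>i<n. g i * (n * n + n - i))"

text \<open>Exponents of Artin's basis of the coinvariant algebra, \<open>n!\<close> in number.
  \<open>PiE\<close> fixes the values outside \<open>{..<n}\<close>, so that no monomial is listed
  twice.\<close>

definition staircase :: "nat \<Rightarrow> (nat \<Rightarrow> nat) set" where
  "staircase n = PiE {..<n} (\<lambda>i. {..i})"

lemma finite_staircase [simp]: "finite (staircase n)"
  by (simp add: staircase_def finite_PiE)

lemma card_staircase: "card (staircase n) = fact n"
  by (simp add: staircase_def card_PiE fact_prod_Suc atLeast0LessThan)

lemma monom_val_mult: "monom_val n x g * monom_val n x h = monom_val n x (\<lambda>i. g i + h i)"
  by (simp add: monom_val_def prod.distrib power_add)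

lemma weight_add: "weight n (\<lambda>i. g i + h i) = weight n g + weight n h"
  by (simp add: weight_def sum.distrib distrib_right)

lemma monom_val_single: "i < n \<Longrightarrow> monom_val n x (\<lambda>j. if j = i then m else 0) = x i ^ m"
  unfolding monom_val_def by (subst prod.remove[of _ i]) (auto intro!: prod.neutral)

lemma weight_single: "i < n \<Longrightarrow> weight n (\<lambda>j. if j = i then m else 0) = m * (n * n + n - i)"
  unfolding weight_def by (subst sum.remove[of _ i]) (auto intro!: sum.neutral)

text \<open>A ring seen as an algebra through an explicit structure map, which permits two base
  rings for the same ring of functions.\<close>

locale algebra_map = comm_ring_hom hom for hom :: "'k::comm_ring_1 \<Rightarrow> 'r::comm_ring_1"
begin

sublocale alg: Modules.module "\<lambda>c g. hom c * g"
  by unfold_locales (simp_all add: algebra_simps hom_add hom_mult)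

text \<open>A filtration on values, not on formal polynomials: any representation of low weight
  counts, so relations between the \<open>x i\<close> can lower the weight.\<close>

definition fil :: "nat \<Rightarrow> (nat \<Rightarrow> 'r) \<Rightarrow> nat \<Rightarrow> 'r set" where
  "fil n x q = alg.span {monom_val n x g | g. weight n g \<le> q}"

lemma fil_mono: "p \<le> q \<Longrightarrow> a \<in> fil n x p \<Longrightarrow> a \<in> fil n x q"
  unfolding fil_def by (rule subsetD[OF alg.span_mono]) auto

lemma monom_val_in_fil: "weight n g \<le> q \<Longrightarrow> monom_val n x g \<in> fil n x q"
  unfolding fil_def by (intro alg.span_base) auto

lemma fil_mult:
  assumes "a \<in> fil n x p" "b \<in> fil n x q"
  shows "a * b \<in> fil n x (p + q)"
proof -
  let ?F = "fil n x (p + q)"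
  have sub: "alg.subspace {b. a * b \<in> ?F}" for a
    unfolding fil_def
    by (rule alg.subspaceI)
      (auto simp: distrib_left alg.span_zero alg.span_add mult.left_commute[of a] intro!: alg.span_scale)
  have 1: "monom_val n x g * b \<in> ?F" if "weight n g \<le> p" "b \<in> fil n x q" for g b
  proof -
    have "fil n x q \<subseteq> {b. monom_val n x g * b \<in> ?F}"
      unfolding fil_def[of n x q]
      by (rule alg.span_minimal[OF _ sub])
        (use that in \<open>auto simp: monom_val_mult weight_add intro!: monom_val_in_fil add_mono\<close>)
    then show ?thesis using that by blast
  qed
  have "fil n x p \<subseteq> {a. b * a \<in> ?F}"
    unfolding fil_def[of n x p]
    by (rule alg.span_minimal[OF _ sub]) (use 1 assms(2) in \<open>auto simp: mult.commute[of b]\<close>)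
  then show ?thesis using assms by (auto simp: mult.commute)
qed

lemma one_in_fil: "1 \<in> fil n x q"
  using monom_val_in_fil[of n "\<lambda>_. 0" q x] by (simp add: monom_val_def weight_def)

lemma hom_in_fil: "hom c \<in> fil n x q"
  using alg.span_scale[OF one_in_fil[unfolded fil_def], of c n x q] by (simp add: fil_def)

lemma var_in_fil: "i < n \<Longrightarrow> x i \<in> fil n x (n * n + n - i)"
  using monom_val_in_fil[of n "\<lambda>j. if j = i then 1 else 0" _ x] weight_single[of i n 1]
  by (simp add: monom_val_single)

lemma fil_power: "a \<in> fil n x p \<Longrightarrow> a ^ m \<in> fil n x (m * p)"
  by (induction m) (auto simp: one_in_fil intro: fil_mult)

lemma fil_uminus: "a \<in> fil n x p \<Longrightarrow> - a \<in> fil n x p"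
  unfolding fil_def by (rule alg.span_neg)

lemma fil_sum: "(\<And>i. i \<in> J \<Longrightarrow> f i \<in> fil n x p) \<Longrightarrow> (\<Sum>i\<in>J. f i) \<in> fil n x p"
  unfolding fil_def by (rule alg.span_sum)

lemma esym_in_fil:
  assumes "J \<subseteq> {..<n}"
  shows "esym J m x \<in> fil n x (m * (n * n + n))"
  unfolding esym_def
proof (rule fil_sum)
  fix L assume L: "L \<in> {L. L \<subseteq> J \<and> card L = m}"
  then have sub: "L \<subseteq> {..<n}" using assms by auto
  then have "finite L" using finite_subset by blast
  from this sub have "(\<Prod>i\<in>L. x i) \<in> fil n x (card L * (n * n + n))"
  proof (induction L)
    case (insert i L)
    then have "x i \<in> fil n x (n * n + n)"
      by (intro fil_mono[OF _ var_in_fil[of i n x]]) auto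
    then show ?case using insert fil_mult by auto
  qed (simp add: one_in_fil)
  then show "(\<Prod>i\<in>L. x i) \<in> fil n x (m * (n * n + n))" using L by simp
qed

context
  fixes n and x :: "nat \<Rightarrow> 'r"
  assumes esym_low: "\<And>j. 1 \<le> j \<Longrightarrow> j \<le> n \<Longrightarrow> esym {..<n} j x \<in> fil n x (j * (n * n))"
begin

text \<open>Downward induction on the number of variables by Pascal's recursion. Modulo lower terms
  the result involves only variables of index at least \<open>i\<close>, each of weight at most
  \<open>n * n + n - i\<close>. The base case is the hypothesis, whose bound
  \<open>j * (n * n)\<close> lies below the weight of every monomial of degree
  \<open>j\<close>.\<close>

lemma esym_initial_in_fil:
  assumes "i \<le> n" "j \<le> n"
  shows "esym {..<i} j x \<in> fil n x (j * (n * n + n - i))"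
  using assms(1) assms(2)
proof (induction i arbitrary: j rule: inc_induct)
  case base
  then show ?case using esym_low[of j] by (cases j) (auto simp: one_in_fil)
next
  case (step i)
  show ?case using step.prems
  proof (induction j)
    case 0
    then show ?case by (simp add: one_in_fil)
  next
    case (Suc j)
    have "esym {..<Suc i} (Suc j) x \<in> fil n x (Suc j * (n * n + n - i))"
      by (rule fil_mono[OF _ step.IH[OF Suc.prems]]) (intro mult_le_mono diff_le_mono2; simp)
    moreover have "x i * esym {..<i} j x \<in> fil n x ((n * n + n - i) + j * (n * n + n - i))"
      using step Suc by (intro fil_mult var_in_fil Suc.IH) auto
    moreover have "esym {..<i} (Suc j) x = esym {..<Suc i} (Suc j) x - x i * esym {..<i} j x"
      by (simp add: lessThan_Suc esym_insert)
    ultimately show ?case unfolding fil_def by (simp add: alg.span_diff)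
  qed
qed

text \<open>\<open>x i\<close> is a root of the polynomial with factors \<open>x j - T\<close> for
  \<open>j \<le> i\<close>. Expanding expresses \<open>x i ^ Suc i\<close> by lower powers times
  elementary symmetric polynomials of \<open>x 0, ..., x i\<close>, which cost
  \<open>n * n + n - Suc i\<close> per degree, one less than \<open>x i\<close>.\<close>

lemma var_power_in_fil:
  assumes i: "i < n"
  shows "x i ^ Suc i \<in> fil n x (Suc i * (n * n + n - i) - 1)"
proof -
  let ?u = "n * n + n - i"
  have u: "?u \<ge> 1" using i by simp
  have "0 = (\<Prod>j<Suc i. x j + (- x i))" by (rule sym, rule prod_zero) auto
  also have "\<dots> = (\<Sum>m\<le>Suc i. esym {..<Suc i} m x * (- x i) ^ (Suc i - m))"
    by (subst prod_add_const_esym) auto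
  also have "\<dots> = (- x i) ^ Suc i + (\<Sum>m=1..Suc i. esym {..<Suc i} m x * (- x i) ^ (Suc i - m))"
    by (subst atMost_atLeast0, subst sum.atLeast_Suc_atMost) auto
  finally have eq: "(- x i) ^ Suc i = - (\<Sum>m=1..Suc i. esym {..<Suc i} m x * (- x i) ^ (Suc i - m))"
    by (simp add: eq_neg_iff_add_eq_0)
  have "(- x i) ^ Suc i \<in> fil n x (Suc i * ?u - 1)"
    unfolding eq
  proof (intro fil_uminus fil_sum)
    fix m assume m: "m \<in> {1..Suc i}"
    have "esym {..<Suc i} m x \<in> fil n x (m * (n * n + n - Suc i))"
      using i m by (intro esym_initial_in_fil) auto
    moreover have "(- x i) ^ (Suc i - m) \<in> fil n x ((Suc i - m) * ?u)"
      by (intro fil_power fil_uminus var_in_fil i)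
    ultimately have "esym {..<Suc i} m x * (- x i) ^ (Suc i - m) \<in>
        fil n x (m * (n * n + n - Suc i) + (Suc i - m) * ?u)" by (rule fil_mult)
    \<comment> \<open>The saving is \<open>m\<close>, and \<open>m \<ge> 1\<close> pays for the
      subtracted 1.\<close>
    moreover have "m * (n * n + n - Suc i) + (Suc i - m) * ?u \<le> Suc i * ?u - 1"
    proof -
      obtain v where v: "?u = Suc v" "n * n + n - Suc i = v" using u i by (metis Suc_diff_Suc diff_Suc_1 Suc_pred' One_nat_def Suc_le_eq diff_Suc_eq_diff_pred diff_commute)
      obtain l where l: "Suc i = m + l" using m le_Suc_ex by auto
      obtain k where k: "m = Suc k" using m by (cases m) auto
      show ?thesis unfolding v unfolding l k by (simp add: algebra_simps)
    qed
    ultimately show "esym {..<Suc i} m x * (- x i) ^ (Suc i - m) \<in> fil n x (Suc i * ?u - 1)"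
      by (rule fil_mono[rotated])
  qed
  moreover have "x i ^ Suc i = (- x i) ^ Suc i \<or> x i ^ Suc i = - ((- x i) ^ Suc i)"
    by (cases "even (Suc i)") (simp_all only: power_minus_even power_minus_odd minus_minus simp_thms)
  ultimately show ?thesis using fil_uminus by metis
qed

text \<open>An exponent \<open>g i > i\<close> allows a factor \<open>x i ^ Suc i\<close> to be
  traded for something lighter; the weight is the induction measure.\<close>

lemma monom_val_in_span_staircase:
  "monom_val n x g \<in> alg.span (monom_val n x ` staircase n)"
proof (induction "weight n g" arbitrary: g rule: less_induct)
  case less
  show ?case
  proof (cases "\<forall>i<n. g i \<le> i")
    case True
    \<comment> \<open>Elements of \<open>staircase n\<close> are \<open>undefined\<close> outside
      \<open>{..<n}\<close>; restricting the exponent does not change its monomial.\<close>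
    have "monom_val n x g = monom_val n x (restrict g {..<n})" by (simp add: monom_val_def)
    moreover have "restrict g {..<n} \<in> staircase n" using True by (auto simp: staircase_def)
    ultimately show ?thesis by (auto intro: alg.span_base)
  next
    case False
    then obtain i where i: "i < n" "g i > i" by (auto simp: not_le)
    let ?s = "\<lambda>j. if j = i then Suc i else 0"
    define h where "h = g(i := g i - Suc i)"
    have g: "g = (\<lambda>j. h j + ?s j)" using i by (auto simp: h_def)
    have w: "weight n g = weight n h + Suc i * (n * n + n - i)"
      by (subst g, subst weight_add) (simp only: weight_single[OF i(1)])
    have pos: "weight n g > 0" using w i by simp
    have "monom_val n x g = monom_val n x h * x i ^ Suc i"
      by (subst g, subst monom_val_mult[symmetric]) (simp only: monom_val_single[OF i(1)])
    also have "\<dots> \<in> fil n x (weight n h + (Suc i * (n * n + n - i) - 1))"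
      by (intro fil_mult monom_val_in_fil var_power_in_fil i order_refl)
    also have "weight n h + (Suc i * (n * n + n - i) - 1) = weight n g - 1"
      using w i by simp
    also have "fil n x (weight n g - 1) \<subseteq> alg.span (monom_val n x ` staircase n)"
      unfolding fil_def
    proof (rule alg.span_minimal[OF _ alg.subspace_span], safe)
      fix h assume "weight n h \<le> weight n g - 1"
      then show "monom_val n x h \<in> alg.span (monom_val n x ` staircase n)"
        using pos by (intro less) auto
    qed
    finally show ?thesis .
  qed
qed

end

end

section \<open>Characteristic polynomials and common eigenvectors\<close>

lemma principal_minor_uminus:
  assumes A: "A \<in> carrier_mat n n" and M: "M \<subseteq> {..<n}"
  shows "principal_minor (- A) M = (-1) ^ card M * principal_minor A M"
proof -
  have fin: "finite M" using M finite_subset by blast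
  have "(\<Prod>i\<in>M. (- A) $$ (i, p i)) = (-1) ^ card M * (\<Prod>i\<in>M. A $$ (i, p i))" if p: "p permutes M" for p
  proof -
    have "(\<Prod>i\<in>M. (- A) $$ (i, p i)) = (\<Prod>i\<in>M. (-1) * A $$ (i, p i))"
    proof (rule prod.cong[OF refl])
      fix i assume i: "i \<in> M"
      then have "p i \<in> M" using p by (simp add: permutes_in_image)
      then have "i < n" "p i < n" using i M by auto
      then show "(- A) $$ (i, p i) = - 1 * A $$ (i, p i)" using A by simp
    qed
    then show ?thesis by (simp only: prod.distrib prod_constant)
  qed
  then have "permdet (- A) M = (-1) ^ card M * permdet A M"
    unfolding permdet_def sum_distrib_left by (intro sum.cong refl) (simp add: mult.left_commute)
  moreover have "- A \<in> carrier_mat n n" using A by simp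
  ultimately show ?thesis using principal_minor_eq_permdet[OF _ M] A by metis
qed

lemma principal_minor_const_poly:
  assumes A: "A \<in> carrier_mat n n" and M: "M \<subseteq> {..<n}"
  shows "principal_minor (map_mat (\<lambda>a. [:a:]) A) M = [:principal_minor A M:]"
proof -
  have M': "i < n" if "i \<in> M" for i using that M by auto
  interpret comm_ring_hom "\<lambda>a. [:a:] :: 'a poly" by unfold_locales (simp_all add: one_pCons)
  have "(\<Prod>i\<in>M. map_mat (\<lambda>a. [:a:]) A $$ (i, p i)) = [:\<Prod>i\<in>M. A $$ (i, p i):]" if p: "p permutes M" for p
    unfolding hom_prod
  proof (rule prod.cong[OF refl])
    fix i assume i: "i \<in> M"
    then have "p i \<in> M" using p by (simp add: permutes_in_image)
    then show "map_mat (\<lambda>a. [:a:]) A $$ (i, p i) = [:A $$ (i, p i):]" using i M' A by auto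
  qed
  then have "permdet (map_mat (\<lambda>a. [:a:]) A) M = [:permdet A M:]"
    unfolding permdet_def hom_sum
    by (intro sum.cong refl) (simp only: mem_Collect_eq hom_mult hom_signof)
  moreover have "map_mat (\<lambda>a. [:a:]) A \<in> carrier_mat n n" using A by simp
  ultimately show ?thesis using principal_minor_eq_permdet[OF _ M] A by metis
qed

text \<open>\<open>det_add_diag\<close> over the polynomial ring: the constant matrix
  \<open>- A\<close> plus the diagonal entries \<open>t - d i\<close>. Hence the minors of
  \<open>- A\<close> as marks and the shift by \<open>- d\<close>.\<close>

lemma char_poly_add_diag:
  fixes A :: "'a::comm_ring_1 mat"
  assumes A: "A \<in> carrier_mat n n"
  shows "char_poly (A + mat n n (\<lambda>(i,j). if i = j then d i else 0)) =
    marked_poly n (principal_minor (- A)) (\<lambda>i. - d i)"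
proof -
  have A': "map_mat (\<lambda>a. [:a:]) (- A) \<in> carrier_mat n n" using A by simp
  have "char_poly_matrix (A + mat n n (\<lambda>(i,j). if i = j then d i else 0)) =
      map_mat (\<lambda>a. [:a:]) (- A) + mat n n (\<lambda>(i,j). if i = j then [:- d i, 1:] else 0)"
    using A by (intro eq_matI) (auto simp: char_poly_matrix_def)
  then have "char_poly (A + mat n n (\<lambda>(i,j). if i = j then d i else 0)) =
      (\<Sum>M\<in>Pow {..<n}. principal_minor (map_mat (\<lambda>a. [:a:]) (- A)) M * (\<Prod>i\<in>{..<n} - M. [:- d i, 1:]))"
    unfolding char_poly_def by (simp only: det_add_diag[OF A'])
  also have "\<dots> = marked_poly n (principal_minor (- A)) (\<lambda>i. - d i)"
    unfolding marked_poly_def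
    by (intro sum.cong refl) (use A in \<open>auto simp: principal_minor_const_poly[of "- A" n]\<close>)
  finally show ?thesis .
qed

lemma char_poly_eq_marked_poly:
  assumes A: "A \<in> carrier_mat n n"
  shows "char_poly A = marked_poly n (principal_minor (- A)) (\<lambda>_. 0)"
proof -
  have "A + mat n n (\<lambda>(i,j). if i = j then 0 else 0) = A"
    using A by (intro eq_matI) auto
  then show ?thesis using char_poly_add_diag[OF A, of "\<lambda>_. 0"] by simp
qed

lemma principal_minor_singleton:
  assumes A: "A \<in> carrier_mat n n" and i: "i < n"
  shows "principal_minor A {i} = A $$ (i, i)"
proof -
  have "{p. p permutes {i}} = {id}" by (auto simp: permutes_sing)
  then show ?thesis
    using i by (subst principal_minor_eq_permdet[OF A]) (auto simp: permdet_def)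
qed

lemma principal_minor_empty: "principal_minor A {} = 1"
  by (simp add: principal_minor_def submatrix_def det_def)

text \<open>With zero shifts a mark \<open>M\<close> multiplies the power with exponent
  \<open>Suc n - card M\<close>, so only singletons reach exponent \<open>n\<close>.\<close>

lemma coeff_char_poly_trace:
  assumes A: "A \<in> carrier_mat (Suc n) (Suc n)"
  shows "coeff (char_poly A) n = - (\<Sum>i<Suc n. A $$ (i, i))"
proof -
  have "coeff (char_poly A) n =
      (\<Sum>M\<in>Pow {..<Suc n}. if card M = 1 then principal_minor (- A) M else 0)"
    unfolding char_poly_eq_marked_poly[OF A] marked_poly_def coeff_sum coeff_smult
  proof (intro sum.cong refl)
    fix M assume "M \<in> Pow {..<Suc n}"
    then have M: "card ({..<Suc n} - M) = Suc n - card M" "card M \<le> Suc n"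
      using card_mono[of "{..<Suc n}" M] by (auto simp: card_Diff_subset finite_subset)
    have "(\<Prod>i\<in>{..<Suc n} - M. [:0, 1 :: 'a:]) = monom 1 (Suc n - card M)"
      unfolding prod_constant M(1) by (simp add: monom_altdef)
    then show "principal_minor (- A) M * coeff (\<Prod>i\<in>{..<Suc n} - M. [:0, 1:]) n =
        (if card M = 1 then principal_minor (- A) M else 0)"
      using M(2) by auto
  qed
  also have "\<dots> = (\<Sum>M\<in>(\<lambda>i. {i}) ` {..<Suc n}. principal_minor (- A) M)"
    by (subst sum.inter_filter[symmetric]) (auto intro!: sum.cong simp: card_1_singleton_iff simp del: lessThan_Suc)
  also have "\<dots> = (\<Sum>i<Suc n. principal_minor (- A) {i})"
    by (subst sum.reindex) (auto simp: inj_on_def)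
  also have "\<dots> = (\<Sum>i<Suc n. - A $$ (i, i))"
    using A by (intro sum.cong refl) (subst principal_minor_singleton[of _ "Suc n"], auto)
  finally show ?thesis by (simp add: sum_negf)
qed

text \<open>If all eigenvalues were 0, the characteristic polynomial would be a pure power, and its
  second coefficient, minus the trace, would vanish.\<close>

lemma trace_nonzero_imp_eigenvalue:
  fixes A :: "'a::alg_closed_field mat"
  assumes A: "A \<in> carrier_mat n n" and tr: "(\<Sum>i<n. A $$ (i, i)) \<noteq> 0"
  obtains e v where "e \<noteq> 0" "v \<in> carrier_vec n" "v \<noteq> 0\<^sub>v n" "A *\<^sub>v v = e \<cdot>\<^sub>v v"
proof -
  have "n \<noteq> 0" using tr by (intro notI) simp
  then obtain m where m: "n = Suc m" using not0_implies_Suc by blast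
  note deg = degree_monic_char_poly[OF A]
  then have "char_poly A \<noteq> 0" using m by auto
  then obtain R where R: "size R = n" "char_poly A = (\<Prod>x\<in>#R. [:-x, 1:])"
    using alg_closed_imp_factorization[of "char_poly A"] deg by auto
  have "\<exists>e\<in>#R. e \<noteq> 0"
  proof (rule ccontr)
    assume "\<not> ?thesis"
    then have "R = replicate_mset n 0"
      using R(1) by (intro multiset_eqI) (metis count_replicate_mset set_mset_subset_singletonD singletonI subsetI size_replicate_mset)
    then have "char_poly A = monom 1 n" using R(2) by (simp add: monom_altdef)
    then have "coeff (char_poly A) m = 0" using m by simp
    then show False using coeff_char_poly_trace[of A m] A tr m by (simp del: sum.lessThan_Suc)
  qed
  then obtain e where e: "e \<in># R" "e \<noteq> 0" by auto
  then have "poly (char_poly A) e = 0"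
    unfolding R(2) by (auto simp: poly_prod_mset prod_mset_zero_iff)
  then have "eigenvalue A e" using eigenvalue_root_char_poly[OF A] by simp
  then show ?thesis using that e A unfolding eigenvalue_def eigenvector_def by auto
qed

text \<open>If \<open>s k\<close> is the \<open>r\<close>-th coordinate of \<open>A^k w\<close>,
  this is the \<open>r\<close>-th coordinate of \<open>p(A) w\<close>, without forming
  \<open>p(A)\<close>.\<close>

definition poly_action :: "(nat \<Rightarrow> 'a) \<Rightarrow> 'a::comm_ring_1 poly \<Rightarrow> 'a" where
  "poly_action s p = (\<Sum>k\<le>degree p. coeff p k * s k)"

lemma poly_action_bound: "degree p \<le> m \<Longrightarrow> poly_action s p = (\<Sum>k\<le>m. coeff p k * s k)"
  unfolding poly_action_def by (intro sum.mono_neutral_left) (auto simp: coeff_eq_0)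

lemma poly_action_linear_factor:
  "poly_action s ([:- e, 1:] * q) = poly_action (\<lambda>k. s (Suc k) - e * s k) q"
proof -
  let ?m = "degree q"
  have "degree ([:- e, 1:] * q) \<le> Suc ?m"
    using degree_mult_le[of "[:- e, 1:]" q] by simp
  then have "poly_action s ([:- e, 1:] * q) = (\<Sum>k\<le>Suc ?m. coeff (pCons 0 q - smult e q) k * s k)"
    by (simp add: poly_action_bound mult_pCons_left)
  also have "\<dots> = (\<Sum>k\<le>Suc ?m. coeff (pCons 0 q) k * s k) - e * (\<Sum>k\<le>Suc ?m. coeff q k * s k)"
    by (simp only: coeff_diff coeff_smult left_diff_distrib sum_subtractf sum_distrib_left mult.assoc)
  also have "(\<Sum>k\<le>Suc ?m. coeff (pCons 0 q) k * s k) = (\<Sum>k\<le>?m. coeff q k * s (Suc k))"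
    by (subst sum.atMost_Suc_shift) simp
  also have "(\<Sum>k\<le>Suc ?m. coeff q k * s k) = (\<Sum>k\<le>?m. coeff q k * s k)"
    by (simp add: coeff_eq_0)
  finally show ?thesis
    by (simp add: poly_action_def sum_distrib_left sum_subtractf algebra_simps)
qed

text \<open>The \<open>n + 1\<close> vectors \<open>w, A w, ..., A^n w\<close> are linearly
  dependent.\<close>

lemma krylov_annihilator:
  fixes A :: "'a::field mat"
  assumes A: "A \<in> carrier_mat n n" and w: "w \<in> carrier_vec n"
  obtains p where "p \<noteq> 0" "\<And>r. r < n \<Longrightarrow> poly_action (\<lambda>k. (((*\<^sub>v) A) ^^ k) w $ r) p = 0"
proof -
  \<comment> \<open>A zero row makes the matrix of these vectors square, so that its determinant
    vanishes and supplies a kernel vector.\<close>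
  define K where "K = mat (Suc n) (Suc n) (\<lambda>(r, k). if r < n then (((*\<^sub>v) A) ^^ k) w $ r else 0)"
  have K: "K \<in> carrier_mat (Suc n) (Suc n)" by (simp add: K_def)
  have "row K n = 0\<^sub>v (Suc n)" by (intro eq_vecI) (simp_all add: K_def)
  then have "det K = 0"
    using laplace_expansion_row[OF K, of n] by (simp add: K_def)
  then obtain c where c: "c \<in> carrier_vec (Suc n)" "c \<noteq> 0\<^sub>v (Suc n)" "K *\<^sub>v c = 0\<^sub>v (Suc n)"
    using det_0_iff_vec_prod_zero[OF K] by auto
  define p where "p = (\<Sum>k\<le>n. monom (c $ k) k)"
  have cp: "coeff p k = (if k \<le> n then c $ k else 0)" for k
    by (simp add: p_def coeff_sum)
  have deg: "degree p \<le> n" by (rule degree_le) (simp add: cp)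
  have "p \<noteq> 0"
  proof
    assume "p = 0"
    then have "c $ k = 0" if "k < Suc n" for k using cp[of k] that by simp
    then have "c = 0\<^sub>v (Suc n)" using c(1) by (intro eq_vecI) auto
    then show False using c(2) by simp
  qed
  moreover have "poly_action (\<lambda>k. (((*\<^sub>v) A) ^^ k) w $ r) p = 0" if r: "r < n" for r
  proof -
    have "(K *\<^sub>v c) $ r = 0" using c(3) r by simp
    then have "(\<Sum>k<Suc n. (((*\<^sub>v) A) ^^ k) w $ r * c $ k) = 0"
      using r c(1) K by (simp add: scalar_prod_def K_def atLeast0LessThan)
    moreover have "poly_action (\<lambda>k. (((*\<^sub>v) A) ^^ k) w $ r) p = (\<Sum>k\<le>n. c $ k * (((*\<^sub>v) A) ^^ k) w $ r)"
      unfolding poly_action_bound[OF deg] by (intro sum.cong) (simp_all add: cp)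
    ultimately show ?thesis by (simp add: lessThan_Suc_atMost mult.commute)
  qed
  ultimately show ?thesis using that by blast
qed

text \<open>Descent on an annihilating polynomial. Split off a root \<open>e\<close>: either
  \<open>w\<close> is an eigenvector, or \<open>A *\<^sub>v w - e \<cdot>\<^sub>v w\<close> is a
  nonzero element of \<open>W\<close> annihilated by the cofactor.\<close>

lemma eigenvector_in_invariant_set:
  fixes A :: "'a::alg_closed_field mat"
  assumes A: "A \<in> carrier_mat n n" and W: "W \<subseteq> carrier_vec n"
    and inv: "\<And>v e. v \<in> W \<Longrightarrow> A *\<^sub>v v - e \<cdot>\<^sub>v v \<in> W"
    and w: "w \<in> W" "w \<noteq> 0\<^sub>v n"
  obtains u e where "u \<in> W" "u \<noteq> 0\<^sub>v n" "A *\<^sub>v u = e \<cdot>\<^sub>v u"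
proof -
  have fc: "(((*\<^sub>v) A) ^^ k) v \<in> carrier_vec n" if "v \<in> carrier_vec n" for k v
    using that A by (induction k) auto
  have lin: "(((*\<^sub>v) A) ^^ k) (A *\<^sub>v v - e \<cdot>\<^sub>v v) = (((*\<^sub>v) A) ^^ Suc k) v - e \<cdot>\<^sub>v (((*\<^sub>v) A) ^^ k) v"
    if v: "v \<in> carrier_vec n" for k v e
  proof (induction k)
    case (Suc k)
    have "(((*\<^sub>v) A) ^^ Suc k) (A *\<^sub>v v - e \<cdot>\<^sub>v v) = A *\<^sub>v ((((*\<^sub>v) A) ^^ Suc k) v - e \<cdot>\<^sub>v (((*\<^sub>v) A) ^^ k) v)"
      using Suc.IH by simp
    also have "\<dots> = A *\<^sub>v (((*\<^sub>v) A) ^^ Suc k) v - A *\<^sub>v (e \<cdot>\<^sub>v (((*\<^sub>v) A) ^^ k) v)"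
      using A fc[OF v, of "Suc k"] fc[OF v, of k] by (intro mult_minus_distrib_mat_vec) auto
    finally show ?case using A fc[OF v, of k] by (simp add: mult_mat_vec)
  qed simp
  have "\<exists>u\<in>W. \<exists>e. u \<noteq> 0\<^sub>v n \<and> A *\<^sub>v u = e \<cdot>\<^sub>v u"
    if "p \<noteq> 0" "\<And>r. r < n \<Longrightarrow> poly_action (\<lambda>k. (((*\<^sub>v) A) ^^ k) w $ r) p = 0" "w \<in> W" "w \<noteq> 0\<^sub>v n" for p w
    using that
  proof (induction "degree p" arbitrary: p w)
    case 0
    then obtain a where a: "p = [:a:]" "a \<noteq> 0" by (metis degree_eq_zeroE pCons_0_0)
    have wc: "w \<in> carrier_vec n" using 0 W by auto
    have "w = 0\<^sub>v n" using wc 0(3) a by (intro eq_vecI) (auto simp: poly_action_def)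
    then show ?case using 0 by simp
  next
    case (Suc m)
    then obtain e where "poly p e = 0" using alg_closed_imp_poly_has_root[of p] by auto
    then obtain q where q: "p = [:- e, 1:] * q" by (metis poly_eq_0_iff_dvd dvdE)
    then have "q \<noteq> 0" using Suc.prems by auto
    then have dq: "m = degree q" using Suc.hyps(2) unfolding q by (subst (asm) degree_mult_eq) auto
    have wc: "w \<in> carrier_vec n" using Suc W by auto
    let ?w = "A *\<^sub>v w - e \<cdot>\<^sub>v w"
    show ?case
    proof (cases "?w = 0\<^sub>v n")
      case True
      have "A *\<^sub>v w = e \<cdot>\<^sub>v w"
      proof (rule eq_vecI)
        fix i assume "i < dim_vec (e \<cdot>\<^sub>v w)"
        then have "i < n" using wc by simp
        have "?w $ i = (A *\<^sub>v w) $ i - (e \<cdot>\<^sub>v w) $ i" using wc \<open>i < n\<close> by (intro index_minus_vec) simp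
        moreover have "?w $ i = 0" using True \<open>i < n\<close> by simp
        ultimately show "(A *\<^sub>v w) $ i = (e \<cdot>\<^sub>v w) $ i" by (metis right_minus_eq)
      qed (use A wc in auto)
      then show ?thesis using Suc.prems by blast
    next
      case False
      have "poly_action (\<lambda>k. (((*\<^sub>v) A) ^^ k) ?w $ r) q = 0" if r: "r < n" for r
      proof -
        have "(((*\<^sub>v) A) ^^ k) ?w $ r = (((*\<^sub>v) A) ^^ Suc k) w $ r - e * (((*\<^sub>v) A) ^^ k) w $ r" for k
          unfolding lin[OF wc] using fc[OF wc, of k] fc[OF wc, of "Suc k"] r by (simp del: funpow.simps)
        then show ?thesis using Suc.prems(2)[OF r] unfolding q poly_action_linear_factor by (simp del: funpow.simps)
      qed
      then show ?thesis using Suc.hyps(1)[OF dq \<open>q \<noteq> 0\<close> _ inv[OF Suc.prems(3)] False] by blast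
    qed
  qed
  moreover obtain p where "p \<noteq> 0" "\<And>r. r < n \<Longrightarrow> poly_action (\<lambda>k. (((*\<^sub>v) A) ^^ k) w $ r) p = 0"
    using krylov_annihilator[OF A] w W by blast
  ultimately show ?thesis using that w by blast
qed

text \<open>By commutation the simultaneous eigenspace found so far is stable under the next matrix.
  \<open>B\<close> comes first because its eigenvalue \<open>e\<close> is prescribed and has to
  survive.\<close>

lemma commuting_common_eigenvector:
  fixes A :: "nat \<Rightarrow> 'a::alg_closed_field mat"
  assumes A: "\<And>i. i < m \<Longrightarrow> A i \<in> carrier_mat n n" and B: "B \<in> carrier_mat n n"
    and comm: "\<And>i j. i < m \<Longrightarrow> j < m \<Longrightarrow> A i * A j = A j * A i" "\<And>i. i < m \<Longrightarrow> A i * B = B * A i"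
    and w: "w \<in> carrier_vec n" "w \<noteq> 0\<^sub>v n" "B *\<^sub>v w = e \<cdot>\<^sub>v w"
  shows "\<exists>u \<mu>. u \<in> carrier_vec n \<and> u \<noteq> 0\<^sub>v n \<and> B *\<^sub>v u = e \<cdot>\<^sub>v u \<and> (\<forall>i<m. A i *\<^sub>v u = \<mu> i \<cdot>\<^sub>v u)"
  using A comm
proof (induction m)
  case 0
  then show ?case using w by auto
next
  case (Suc m)
  obtain u \<mu> where u: "u \<in> carrier_vec n" "u \<noteq> 0\<^sub>v n" "B *\<^sub>v u = e \<cdot>\<^sub>v u" "\<forall>i<m. A i *\<^sub>v u = \<mu> i \<cdot>\<^sub>v u"
    using Suc.IH Suc.prems by (metis less_SucI)
  define W where "W = {v \<in> carrier_vec n. B *\<^sub>v v = e \<cdot>\<^sub>v v \<and> (\<forall>i<m. A i *\<^sub>v v = \<mu> i \<cdot>\<^sub>v v)}"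
  have Am: "A m \<in> carrier_mat n n" using Suc.prems by simp
  have key: "C *\<^sub>v (A m *\<^sub>v v - f \<cdot>\<^sub>v v) = c \<cdot>\<^sub>v (A m *\<^sub>v v - f \<cdot>\<^sub>v v)"
    if "C \<in> carrier_mat n n" "A m * C = C * A m" "v \<in> carrier_vec n" "C *\<^sub>v v = c \<cdot>\<^sub>v v" for C c v f
  proof -
    have "C *\<^sub>v (A m *\<^sub>v v) = A m *\<^sub>v (C *\<^sub>v v)"
      using that Am by (metis assoc_mult_mat_vec)
    also have "\<dots> = c \<cdot>\<^sub>v (A m *\<^sub>v v)" using that Am by (simp add: mult_mat_vec)
    finally have 1: "C *\<^sub>v (A m *\<^sub>v v) = c \<cdot>\<^sub>v (A m *\<^sub>v v)" .
    have 2: "C *\<^sub>v (f \<cdot>\<^sub>v v) = c \<cdot>\<^sub>v (f \<cdot>\<^sub>v v)"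
      using that by (simp add: mult_mat_vec smult_smult_assoc mult.commute)
    have "C *\<^sub>v (A m *\<^sub>v v - f \<cdot>\<^sub>v v) = c \<cdot>\<^sub>v (A m *\<^sub>v v) - c \<cdot>\<^sub>v (f \<cdot>\<^sub>v v)"
      using that Am by (subst mult_minus_distrib_mat_vec[of _ n n]) (auto simp: 1 2)
    also have "\<dots> = c \<cdot>\<^sub>v (A m *\<^sub>v v - f \<cdot>\<^sub>v v)"
      using that Am by (intro eq_vecI) (auto simp: right_diff_distrib)
    finally show ?thesis .
  qed
  have inv: "A m *\<^sub>v v - f \<cdot>\<^sub>v v \<in> W" if v: "v \<in> W" for v f
  proof -
    have vc: "v \<in> carrier_vec n" using v by (simp add: W_def)
    have "A i *\<^sub>v (A m *\<^sub>v v - f \<cdot>\<^sub>v v) = \<mu> i \<cdot>\<^sub>v (A m *\<^sub>v v - f \<cdot>\<^sub>v v)" if "i < m" for i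
      using Suc.prems that v by (intro key) (auto simp: W_def)
    moreover have "B *\<^sub>v (A m *\<^sub>v v - f \<cdot>\<^sub>v v) = e \<cdot>\<^sub>v (A m *\<^sub>v v - f \<cdot>\<^sub>v v)"
      using Suc.prems B v by (intro key) (auto simp: W_def)
    ultimately show ?thesis using vc Am by (simp add: W_def)
  qed
  obtain v f where v: "v \<in> W" "v \<noteq> 0\<^sub>v n" "A m *\<^sub>v v = f \<cdot>\<^sub>v v"
    using eigenvector_in_invariant_set[OF Am _ inv, where w = u] u unfolding W_def by blast
  show ?case
    by (rule exI[of _ v], rule exI[of _ "\<mu>(m := f)"])
      (use v in \<open>auto simp: W_def less_Suc_eq\<close>)
qed

section \<open>Specialisation of solutions\<close>

lemma fun_sum_apply: "(\<Sum>i\<in>J. f i) s = (\<Sum>i\<in>J. f i s)" for f :: "'b \<Rightarrow> 's \<Rightarrow> 'r::comm_ring_1"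
  by (induction J rule: infinite_finite_induct) auto

lemma fun_prod_apply: "(\<Prod>i\<in>J. f i) s = (\<Prod>i\<in>J. f i s)" for f :: "'b \<Rightarrow> 's \<Rightarrow> 'r::comm_ring_1"
  by (induction J rule: infinite_finite_induct) auto

lemma fun_power_apply: "(f ^ k) s = f s ^ k" for f :: "'s \<Rightarrow> 'r::comm_ring_1"
  by (induction k) auto

context algebra_map
begin

text \<open>In the coefficient at exponent \<open>n - j\<close> the empty mark contributes
  \<open>esym {..<n} j x\<close>, every other mark a form of degree at most \<open>j - 1\<close>,
  and the right-hand side a constant.\<close>

lemma esym_low_of_relation:
  assumes c0: "c {} = 1"
    and rel: "\<And>m. (\<Sum>M\<in>Pow {..<n}. hom (c M) *
        (if m + card M \<le> n then esym ({..<n} - M) (n - card M - m) x else 0)) = hom (q m)"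
    and j: "1 \<le> j" "j \<le> n"
  shows "esym {..<n} j x \<in> fil n x (j * (n * n))"
proof -
  define t where "t M = hom (c M) * (if n - j + card M \<le> n then esym ({..<n} - M) (n - card M - (n - j)) x else 0)" for M
  have "hom (q (n - j)) = t {} + (\<Sum>M\<in>Pow {..<n} - {{}}. t M)"
    unfolding rel[symmetric] t_def by (subst sum.remove[of _ "{}"]) auto
  moreover have "t {} = esym {..<n} j x" using j by (simp add: t_def c0)
  ultimately have eq: "esym {..<n} j x = hom (q (n - j)) - (\<Sum>M\<in>Pow {..<n} - {{}}. t M)" by simp
  have "t M \<in> fil n x (j * (n * n))" if M: "M \<in> Pow {..<n} - {{}}" for M
  proof (cases "n - j + card M \<le> n")
    case True
    have "finite M" using M finite_subset by auto
    then have "card M \<ge> 1" using M by (simp add: Suc_leI card_gt_0_iff)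
    then have le: "n - card M - (n - j) \<le> j - 1" using True j by simp
    have "(n - card M - (n - j)) * (n * n + n) \<le> (j - 1) * (n * n + n)"
      using le by (rule mult_le_mono1)
    \<comment> \<open>This fixes the constant in \<open>weight\<close>: the surcharge of
      \<open>n\<close> per variable, in total \<open>(j - 1) * n\<close>, is covered by the
      \<open>n * n\<close> of the missing degree, as \<open>j \<le> n\<close>.\<close>
    also have "\<dots> \<le> j * (n * n)"
    proof -
      obtain l where l: "j = Suc l" using j by (cases j) auto
      have "l * n \<le> n * n" using l j by simp
      then show ?thesis unfolding l by (simp add: algebra_simps)
    qed
    finally have "esym ({..<n} - M) (n - card M - (n - j)) x \<in> fil n x (j * (n * n))"
      by (rule fil_mono[OF _ esym_in_fil]) auto
    then have "hom (c M) * esym ({..<n} - M) (n - card M - (n - j)) x \<in> fil n x (j * (n * n))"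
      unfolding fil_def by (rule alg.span_scale)
    then show ?thesis using True by (simp add: t_def)
  next
    case False
    then have "t M = 0" by (simp add: t_def)
    then show ?thesis by (simp add: fil_def alg.span_zero)
  qed
  then have "(\<Sum>M\<in>Pow {..<n} - {{}}. t M) \<in> fil n x (j * (n * n))" by (rule fil_sum)
  then show ?thesis unfolding eq using hom_in_fil[of "q (n - j)" n x "j * (n * n)"]
    by (simp add: fil_def alg.span_diff)
qed

lemma fil_coords:
  assumes "\<And>j. 1 \<le> j \<Longrightarrow> j \<le> n \<Longrightarrow> esym {..<n} j x \<in> fil n x (j * (n * n))"
    and "G \<in> fil n x q"
  obtains co where "G = (\<Sum>g\<in>staircase n. hom (co g) * monom_val n x g)"
proof -
  let ?C = "{G. \<exists>co. G = (\<Sum>g\<in>staircase n. hom (co g) * monom_val n x g)}"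
  have sub: "alg.subspace ?C"
  proof (rule alg.subspaceI)
    show "0 \<in> ?C" by (intro CollectI exI[of _ "\<lambda>_. 0"]) simp
  next
    fix a b assume "a \<in> ?C" "b \<in> ?C"
    then obtain u v where "a = (\<Sum>g\<in>staircase n. hom (u g) * monom_val n x g)"
      "b = (\<Sum>g\<in>staircase n. hom (v g) * monom_val n x g)" unfolding mem_Collect_eq by (elim exE)
    then have "a + b = (\<Sum>g\<in>staircase n. hom (u g + v g) * monom_val n x g)"
      by (simp add: hom_add distrib_right sum.distrib)
    then show "a + b \<in> ?C" by (intro CollectI exI[of _ "\<lambda>g. u g + v g"])
  next
    fix c a assume "a \<in> ?C"
    then obtain u where a: "a = (\<Sum>g\<in>staircase n. hom (u g) * monom_val n x g)"
      unfolding mem_Collect_eq by (elim exE)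
    have "hom c * a = (\<Sum>g\<in>staircase n. hom (c * u g) * monom_val n x g)"
      unfolding a sum_distrib_left by (simp only: hom_mult mult.assoc)
    then show "hom c * a \<in> ?C" by (intro CollectI exI[of _ "\<lambda>g. c * u g"])
  qed
  have "monom_val n x g \<in> ?C" if g: "g \<in> staircase n" for g
  proof -
    have "(\<Sum>h\<in>staircase n. hom (if h = g then 1 else 0) * monom_val n x h) =
        (\<Sum>h\<in>staircase n. if h = g then monom_val n x h else 0)"
      by (intro sum.cong refl) auto
    then have "monom_val n x g = (\<Sum>h\<in>staircase n. hom (if h = g then 1 else 0) * monom_val n x h)"
      using g by simp
    then show ?thesis by (intro CollectI exI[of _ "\<lambda>h. if h = g then 1 else 0"])
  qed
  then have "alg.span (monom_val n x ` staircase n) \<subseteq> ?C"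
    by (intro alg.span_minimal[OF _ sub]) auto
  moreover have "fil n x q \<subseteq> alg.span (monom_val n x ` staircase n)"
    unfolding fil_def[of n x q]
    by (rule alg.span_minimal[OF _ alg.subspace_span])
      (use monom_val_in_span_staircase[OF assms(1)] in auto)
  ultimately have "G \<in> ?C" using assms(2) by (meson subsetD)
  then show ?thesis unfolding mem_Collect_eq by (elim exE) (rule that)
qed

end

text \<open>Here \<open>\<iota>\<close> embeds the coefficient ring into a field over which there are \<open>n!\<close> distinct solutions
  (the generic fibre), and \<open>\<epsilon>\<close> specialises it. Having \<open>n!\<close> separated points makes the staircase
  monomials linearly independent, so the multiplication matrices over \<open>'k\<close> commute and can be
  specialised; their traces over the generic fibre are the sums over \<open>S\<close>.\<close>

lemma specialise_solutions:
  fixes \<iota> :: "'k::comm_ring_1 \<Rightarrow> 'f::field" and \<epsilon> :: "'k \<Rightarrow> 'a::alg_closed_field"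
    and x :: "'s \<Rightarrow> nat \<Rightarrow> 'f"
  assumes \<iota>: "comm_ring_hom \<iota>" "inj \<iota>" and \<epsilon>: "comm_ring_hom \<epsilon>"
    and S: "finite S" "card S = fact n"
    and sep: "\<And>\<sigma> \<tau>. \<sigma> \<in> S \<Longrightarrow> \<tau> \<in> S \<Longrightarrow> \<sigma> \<noteq> \<tau> \<Longrightarrow> \<exists>i<n. x \<sigma> i \<noteq> x \<tau> i"
    and c0: "c {} = 1"
    and rel: "\<And>\<sigma>. marked_poly n (\<lambda>M. \<iota> (c M)) (x \<sigma>) = map_poly \<iota> Q"
    and L: "L \<subseteq> {..<n}"
  obtains T where "\<iota> T = (\<Sum>\<sigma>\<in>S. \<Prod>i\<in>L. x \<sigma> i)"
    "\<epsilon> T \<noteq> 0 \<Longrightarrow> \<exists>d. marked_poly n (\<lambda>M. \<epsilon> (c M)) d = map_poly \<epsilon> Q \<and> (\<Prod>i\<in>L. d i) \<noteq> 0"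
proof -
  interpret \<iota>: comm_ring_hom \<iota> by fact
  interpret \<epsilon>: comm_ring_hom \<epsilon> by fact
  \<comment> \<open>The generic fibre is modelled by functions on the index type; \<open>X i\<close>
    is a coordinate function.\<close>
  define X where "X i = (\<lambda>\<sigma>. x \<sigma> i)" for i
  define H where "H a = (\<lambda>\<sigma>::'s. \<iota> a)" for a
  \<comment> \<open>Two kinds of constants: spans over \<open>H\<close> give matrix entries in the
    base ring, spans over \<open>F\<close> allow the divisions of interpolation.\<close>
  define F where "F a = (\<lambda>\<sigma>::'s. a)" for a :: 'f
  interpret h: algebra_map H
    by unfold_locales (auto simp: H_def \<iota>.hom_add \<iota>.hom_mult fun_eq_iff)
  interpret f: algebra_map F
    by unfold_locales (auto simp: F_def fun_eq_iff)
  have mon: "monom_val n X g \<sigma> = monom_val n (x \<sigma>) g" for g \<sigma>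
    by (simp add: monom_val_def fun_prod_apply fun_power_apply X_def)
  have esymX: "esym J m X \<sigma> = esym J m (x \<sigma>)" for J m \<sigma>
    by (simp add: esym_def fun_sum_apply fun_prod_apply X_def)
  have relH: "(\<Sum>M\<in>Pow {..<n}. H (c M) *
        (if m + card M \<le> n then esym ({..<n} - M) (n - card M - m) X else 0)) = H (coeff Q m)" for m
  proof
    fix \<sigma>
    have "coeff (marked_poly n (\<lambda>M. \<iota> (c M)) (x \<sigma>)) m = \<iota> (coeff Q m)"
      unfolding rel by (simp add: coeff_map_poly)
    then show "(\<Sum>M\<in>Pow {..<n}. H (c M) *
        (if m + card M \<le> n then esym ({..<n} - M) (n - card M - m) X else 0)) \<sigma> = H (coeff Q m) \<sigma>"
      unfolding coeff_marked_poly fun_sum_apply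
      by (auto simp: H_def esymX intro!: sum.cong elim!: trans[rotated])
  qed
  have low_h: "esym {..<n} j X \<in> h.fil n X (j * (n * n))" if "1 \<le> j" "j \<le> n" for j
    by (rule h.esym_low_of_relation[where c = c and q = "coeff Q"]) (fact c0 relH that)+
  have HF: "H a = F (\<iota> a)" for a by (simp add: H_def F_def)
  have low_f: "esym {..<n} j X \<in> f.fil n X (j * (n * n))" if "1 \<le> j" "j \<le> n" for j
  proof (rule f.esym_low_of_relation[where c = "\<lambda>M. \<iota> (c M)" and q = "\<lambda>m. \<iota> (coeff Q m)"])
    show "\<iota> (c {}) = 1" by (simp add: c0)
  qed (fact relH[unfolded HF] that)+

  define AA where "AA = (\<Union>q. h.fil n X q)"
  have AA_mult: "G * G' \<in> AA" if G: "G \<in> AA" "G' \<in> AA" for G G'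
  proof -
    obtain p q where "G \<in> h.fil n X p" "G' \<in> h.fil n X q" using G by (auto simp: AA_def)
    then have "G * G' \<in> h.fil n X (p + q)" by (rule h.fil_mult)
    then show ?thesis by (auto simp: AA_def)
  qed
  have AA_add: "G + G' \<in> AA" if G: "G \<in> AA" "G' \<in> AA" for G G'
  proof -
    obtain p q where "G \<in> h.fil n X p" "G' \<in> h.fil n X q" using G by (auto simp: AA_def)
    then have "G \<in> h.fil n X (p + q)" "G' \<in> h.fil n X (p + q)"
      by (auto intro: h.fil_mono[rotated])
    then have "G + G' \<in> h.fil n X (p + q)" unfolding h.fil_def by (rule h.alg.span_add)
    then show ?thesis by (auto simp: AA_def)
  qed
  have AA_H: "H a \<in> AA" for a using h.hom_in_fil by (auto simp: AA_def)
  have AA_X: "X i \<in> AA" if "i < n" for i using h.var_in_fil[OF that] by (auto simp: AA_def)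
  have AA_mon: "monom_val n X g \<in> AA" for g using h.monom_val_in_fil[of n g _ X] by (auto simp: AA_def)

  \<comment> \<open>Interpolation: a product of linear factors separating \<sigma> from the other
    points is 1 at \<sigma> and 0 elsewhere on \<open>S\<close>; over the field it is a combination
    of staircase monomials.\<close>
  have "\<exists>u. \<forall>\<tau>\<in>S. (\<Sum>g\<in>staircase n. u g * monom_val n (x \<tau>) g) = (if \<tau> = \<sigma> then 1 else 0)"
    if \<sigma>: "\<sigma> \<in> S" for \<sigma>
  proof -
    have "\<forall>\<tau>\<in>S - {\<sigma>}. \<exists>i. i < n \<and> x \<sigma> i \<noteq> x \<tau> i" using sep \<sigma> by blast
    then obtain sp where sp: "\<forall>\<tau>\<in>S - {\<sigma>}. sp \<tau> < n \<and> x \<sigma> (sp \<tau>) \<noteq> x \<tau> (sp \<tau>)"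
      by (rule bchoice[THEN exE])
    define factor where "factor \<tau> = F (1 / (x \<sigma> (sp \<tau>) - x \<tau> (sp \<tau>))) * (X (sp \<tau>) - F (x \<tau> (sp \<tau>)))" for \<tau>
    have "\<exists>q. factor \<tau> \<in> f.fil n X q" if "\<tau> \<in> S - {\<sigma>}" for \<tau>
    proof -
      have "X (sp \<tau>) \<in> f.fil n X (n * n + n - sp \<tau>)" using sp that by (intro f.var_in_fil) auto
      moreover have "F (x \<tau> (sp \<tau>)) \<in> f.fil n X (n * n + n - sp \<tau>)" by (rule f.hom_in_fil)
      ultimately have "factor \<tau> \<in> f.fil n X (n * n + n - sp \<tau>)"
        unfolding factor_def f.fil_def by (intro f.alg.span_scale f.alg.span_diff)
      then show ?thesis by blast
    qed
    then have "\<exists>q. (\<Prod>\<tau>\<in>R. factor \<tau>) \<in> f.fil n X q" if "R \<subseteq> S - {\<sigma>}" for R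
    proof -
      have "finite R" using that S(1) finite_subset by blast
      then show ?thesis using that \<open>\<And>\<tau>. \<tau> \<in> S - {\<sigma>} \<Longrightarrow> \<exists>q. factor \<tau> \<in> f.fil n X q\<close>
      proof (induction R)
        case empty
        have "(1::'s \<Rightarrow> 'f) \<in> f.fil n X 0" by (rule f.one_in_fil)
        then show ?case unfolding prod.empty by (rule exI)
      next
        case (insert r R)
        then obtain p q where "(\<Prod>\<tau>\<in>R. factor \<tau>) \<in> f.fil n X q" "factor r \<in> f.fil n X p" by blast
        then have "factor r * (\<Prod>\<tau>\<in>R. factor \<tau>) \<in> f.fil n X (p + q)" by (intro f.fil_mult)
        then show ?case unfolding prod.insert[OF insert.hyps] by (rule exI)
      qed
    qed
    then obtain q where "(\<Prod>\<tau>\<in>S - {\<sigma>}. factor \<tau>) \<in> f.fil n X q" by blast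
    then obtain u where u: "(\<Prod>\<tau>\<in>S - {\<sigma>}. factor \<tau>) = (\<Sum>g\<in>staircase n. F (u g) * monom_val n X g)"
      using f.fil_coords[OF low_f] by metis
    have "(\<Sum>g\<in>staircase n. u g * monom_val n (x \<tau>) g) = (if \<tau> = \<sigma> then 1 else 0)" if \<tau>: "\<tau> \<in> S" for \<tau>
    proof -
      have "(\<Sum>g\<in>staircase n. u g * monom_val n (x \<tau>) g) = (\<Sum>g\<in>staircase n. F (u g) * monom_val n X g) \<tau>"
        by (simp add: fun_sum_apply mon F_def)
      also have "\<dots> = (\<Prod>\<rho>\<in>S - {\<sigma>}. factor \<rho> \<tau>)" unfolding u[symmetric] fun_prod_apply ..
      also have "\<dots> = (if \<tau> = \<sigma> then 1 else 0)"
      proof (cases "\<tau> = \<sigma>")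
        case True
        have "factor \<rho> \<sigma> = 1" if "\<rho> \<in> S - {\<sigma>}" for \<rho>
          using sp that by (auto simp: factor_def F_def X_def)
        then show ?thesis using True by simp
      next
        case False
        have "factor \<tau> \<tau> = 0" by (simp add: factor_def F_def X_def)
        then have "(\<Prod>\<rho>\<in>S - {\<sigma>}. factor \<rho> \<tau>) = 0"
          using False \<tau> S by (intro prod_zero) auto
        then show ?thesis using False by simp
      qed
      finally show ?thesis .
    qed
    then show ?thesis by blast
  qed
  then obtain u where u: "\<And>\<sigma> \<tau>. \<sigma> \<in> S \<Longrightarrow> \<tau> \<in> S \<Longrightarrow>
      (\<Sum>g\<in>staircase n. u \<sigma> g * monom_val n (x \<tau>) g) = (if \<tau> = \<sigma> then 1 else 0)"
    by metis

  define N :: nat where "N = fact n"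
  obtain bs where bs: "bij_betw bs {0..<N} (staircase n)"
    using ex_bij_betw_nat_finite[of "staircase n"] by (auto simp: card_staircase N_def)
  obtain ss where ss: "bij_betw ss {0..<N} S"
    using ex_bij_betw_nat_finite[of S] S by (auto simp: N_def)
  have ssS: "ss s \<in> S" if "s < N" for s using bij_betwE[OF ss] that by auto
  have ss_eq: "ss s = ss t \<longleftrightarrow> s = t" if "s < N" "t < N" for s t
    using ss that by (auto simp: bij_betw_def inj_on_def)
  have sum_bs: "(\<Sum>a = 0..<N. f (bs a)) = (\<Sum>g\<in>staircase n. f g)" for f :: "_ \<Rightarrow> 'f"
    by (rule sum.reindex_bij_betw[OF bs])
  have sum_ss: "(\<Sum>s = 0..<N. f (ss s)) = (\<Sum>\<sigma>\<in>S. f \<sigma>)" for f :: "_ \<Rightarrow> 'f"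
    by (rule sum.reindex_bij_betw[OF ss])
  define V where "V = mat N N (\<lambda>(a, s). monom_val n (x (ss s)) (bs a))"
  define U where "U = mat N N (\<lambda>(s, a). u (ss s) (bs a))"
  define D where "D G = mat N N (\<lambda>(s, t). if s = t then G (ss s) else 0)" for G :: "'s \<Rightarrow> 'f"
  have V: "V \<in> carrier_mat N N" and U: "U \<in> carrier_mat N N" and D: "D G \<in> carrier_mat N N" for G
    by (simp_all add: V_def U_def D_def)
  have UV: "U * V = 1\<^sub>m N"
  proof (rule eq_matI)
    fix s t assume "s < dim_row (1\<^sub>m N)" "t < dim_col (1\<^sub>m N)"
    then have st: "s < N" "t < N" by auto
    have "(U * V) $$ (s, t) = (\<Sum>a = 0..<N. u (ss s) (bs a) * monom_val n (x (ss t)) (bs a))"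
      using st by (simp add: U_def V_def scalar_prod_def)
    also have "\<dots> = (\<Sum>g\<in>staircase n. u (ss s) g * monom_val n (x (ss t)) g)"
      by (rule sum_bs)
    also have "\<dots> = (if s = t then 1 else 0)" using st ssS by (auto simp: u ss_eq)
    finally show "(U * V) $$ (s, t) = 1\<^sub>m N $$ (s, t)" using st by simp
  qed (simp_all add: U_def V_def)
  \<comment> \<open>There are as many points as staircase monomials, so \<open>V\<close> is square
    and the left inverse from interpolation is two-sided.\<close>
  have VU: "V * U = 1\<^sub>m N" by (rule mat_mult_left_right_inverse[OF U V UV])
  have VD: "(V * D G) $$ (a, s) = V $$ (a, s) * G (ss s)" if "a < N" "s < N" for G a s
  proof -
    have "(V * D G) $$ (a, s) = (\<Sum>t = 0..<N. V $$ (a, t) * (if t = s then G (ss t) else 0))"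
      using that V by (simp add: scalar_prod_def D_def)
    also have "\<dots> = (\<Sum>t = 0..<N. if t = s then V $$ (a, t) * G (ss t) else 0)"
      by (intro sum.cong refl) auto
    finally show ?thesis using that by simp
  qed
  \<comment> \<open>Multiplication by \<open>G\<close> on functions on \<open>S\<close>, written in
    the staircase monomials; as a conjugate of \<open>D G\<close> it is multiplicative in
    \<open>G\<close>.\<close>
  define E where "E G = V * D G * U" for G
  have mc: "A * B \<in> carrier_mat N N" if "A \<in> carrier_mat N N" "B \<in> carrier_mat N N" for A B :: "'f mat"
    using that by (rule mult_carrier_mat)
  have assoc: "A * B * C = A * (B * C)" if "A \<in> carrier_mat N N" "B \<in> carrier_mat N N" "C \<in> carrier_mat N N"
    for A B C :: "'f mat"
    using that by (rule assoc_mult_mat)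
  have E: "E G \<in> carrier_mat N N" for G unfolding E_def by (intro mc U V D)
  have Emult: "E G * E G' = E (G * G')" for G G'
  proof -
    have "E G * E G' = V * D G * (U * V) * D G' * U"
      unfolding E_def by (simp only: assoc mc U V D)
    also have "\<dots> = V * (D G * D G') * U"
      unfolding UV by (simp only: right_mult_one_mat[OF mc[OF V D]] assoc mc U V D)
    also have "D G * D G' = D (G * G')"
    proof (rule eq_matI)
      fix s t assume "s < dim_row (D (G * G'))" "t < dim_col (D (G * G'))"
      then have st: "s < N" "t < N" by (auto simp: D_def)
      have "(D G * D G') $$ (s, t) = (\<Sum>r = 0..<N. (if s = r then G (ss s) else 0) * (if r = t then G' (ss r) else 0))"
        using st by (simp add: D_def scalar_prod_def)
      also have "\<dots> = (\<Sum>r = 0..<N. if r = s then (if s = t then G (ss s) * G' (ss s) else 0) else 0)"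
        by (intro sum.cong refl) auto
      finally show "(D G * D G') $$ (s, t) = D (G * G') $$ (s, t)" using st by (simp add: D_def)
    qed (simp_all add: D_def)
    finally show ?thesis by (simp add: E_def)
  qed
  have E_entry: "E G $$ (a, b) = (\<Sum>s = 0..<N. V $$ (a, s) * G (ss s) * U $$ (s, b))" if "a < N" "b < N" for G a b
  proof -
    have entry: "(A * B) $$ (a, b) = (\<Sum>s = 0..<N. A $$ (a, s) * B $$ (s, b))"
      if "A \<in> carrier_mat N N" "B \<in> carrier_mat N N" for A B :: "'f mat"
      using that \<open>a < N\<close> \<open>b < N\<close> by (simp add: scalar_prod_def)
    have "E G $$ (a, b) = (\<Sum>s = 0..<N. (V * D G) $$ (a, s) * U $$ (s, b))"
      unfolding E_def by (intro entry mc U V D)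
    then show ?thesis using that by (simp add: VD)
  qed
  have VU_entry: "(\<Sum>s = 0..<N. V $$ (a, s) * U $$ (s, b)) = (if a = b then 1 else 0)" if "a < N" "b < N" for a b
  proof -
    have "(V * U) $$ (a, b) = (\<Sum>s = 0..<N. V $$ (a, s) * U $$ (s, b))"
      using that U V by (simp add: scalar_prod_def)
    then show ?thesis using that by (simp add: VU)
  qed
  have UV_entry: "(\<Sum>a = 0..<N. U $$ (s, a) * V $$ (a, t)) = (if s = t then 1 else 0)" if "s < N" "t < N" for s t
  proof -
    have "(U * V) $$ (s, t) = (\<Sum>a = 0..<N. U $$ (s, a) * V $$ (a, t))"
      using that U V by (simp add: scalar_prod_def)
    then show ?thesis using that by (simp add: UV)
  qed

  \<comment> \<open>For \<open>G\<close> in \<open>AA\<close>, products with staircase monomials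
    have staircase coordinates in the base ring; invertibility of \<open>V\<close> identifies these
    coordinates with the entries of \<open>E G\<close>.\<close>
  have "\<exists>M. M \<in> carrier_mat N N \<and> map_mat \<iota> M = E G" if G: "G \<in> AA" for G
  proof -
    have "\<exists>co. G * monom_val n X g = (\<Sum>k\<in>staircase n. H (co k) * monom_val n X k)" for g
      using AA_mult[OF G AA_mon[of g]] h.fil_coords[OF low_h] unfolding AA_def by (metis UN_E)
    then obtain co where co: "\<And>g. G * monom_val n X g = (\<Sum>k\<in>staircase n. H (co g k) * monom_val n X k)"
      by metis
    define M where "M = mat N N (\<lambda>(a, b). co (bs a) (bs b))"
    have M: "M \<in> carrier_mat N N" by (simp add: M_def)
    have MV: "map_mat \<iota> M * V = V * D G"
    proof (rule eq_matI)
      fix a s assume "a < dim_row (V * D G)" "s < dim_col (V * D G)"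
      then have as: "a < N" "s < N" using V by (auto simp: D_def)
      have "(map_mat \<iota> M * V) $$ (a, s) = (\<Sum>b = 0..<N. \<iota> (co (bs a) (bs b)) * monom_val n (x (ss s)) (bs b))"
        using as by (simp add: M_def V_def scalar_prod_def)
      also have "\<dots> = (\<Sum>k\<in>staircase n. \<iota> (co (bs a) k) * monom_val n (x (ss s)) k)" by (rule sum_bs)
      also have "\<dots> = (\<Sum>k\<in>staircase n. H (co (bs a) k) * monom_val n X k) (ss s)"
        by (simp add: fun_sum_apply H_def mon)
      also have "\<dots> = V $$ (a, s) * G (ss s)"
        unfolding co[symmetric] using as by (simp add: V_def mon)
      finally show "(map_mat \<iota> M * V) $$ (a, s) = (V * D G) $$ (a, s)" using VD[OF as] by simp
    qed (use M V in \<open>auto simp: D_def\<close>)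
    have "map_mat \<iota> M = map_mat \<iota> M * (V * U)" using M by (simp add: VU)
    also have "\<dots> = map_mat \<iota> M * V * U" using M by (intro assoc[symmetric] V U) simp
    finally show ?thesis using M by (auto simp: MV E_def)
  qed
  then obtain Mx where Mx: "\<And>G. G \<in> AA \<Longrightarrow> Mx G \<in> carrier_mat N N" "\<And>G. G \<in> AA \<Longrightarrow> map_mat \<iota> (Mx G) = E G"
    by metis
  \<comment> \<open>Injectivity of \<iota> turns identities between the \<open>E G\<close> into
    identities over the base ring, which \<epsilon> then preserves.\<close>
  have map_inj: "M = M'" if "M \<in> carrier_mat N N" "M' \<in> carrier_mat N N" "map_mat \<iota> M = map_mat \<iota> M'" for M M'
  proof (rule eq_matI)
    fix i j assume "i < dim_row M'" "j < dim_col M'"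
    then have "map_mat \<iota> M $$ (i, j) = \<iota> (M $$ (i, j))" "map_mat \<iota> M' $$ (i, j) = \<iota> (M' $$ (i, j))"
      using that(1,2) by auto
    then show "M $$ (i, j) = M' $$ (i, j)" using that(3) \<iota>(2) by (metis injD)
  qed (use that in auto)
  define Y where "Y G = map_mat \<epsilon> (Mx G)" for G
  have Y: "Y G \<in> carrier_mat N N" if "G \<in> AA" for G using Mx(1)[OF that] by (simp add: Y_def)
  have Ymult: "Y (G * G') = Y G * Y G'" if "G \<in> AA" "G' \<in> AA" for G G'
  proof -
    have "Mx (G * G') = Mx G * Mx G'"
    proof (rule map_inj)
      show "map_mat \<iota> (Mx (G * G')) = map_mat \<iota> (Mx G * Mx G')"
        using that AA_mult by (simp add: \<iota>.mat_hom_mult[OF Mx(1) Mx(1)] Mx(2) Emult)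
    qed (use Mx(1) that AA_mult in \<open>auto intro!: mult_carrier_mat\<close>)
    then show ?thesis using that by (simp add: Y_def \<epsilon>.mat_hom_mult[OF Mx(1) Mx(1)])
  qed
  have Yadd: "Y (G + G') = Y G + Y G'" if "G \<in> AA" "G' \<in> AA" for G G'
  proof -
    have "Mx (G + G') = Mx G + Mx G'"
    proof (rule map_inj)
      have "E (G + G') = E G + E G'"
      proof (rule eq_matI)
        fix a b assume "a < dim_row (E G + E G')" "b < dim_col (E G + E G')"
        then have "a < N" "b < N" using E[of G'] by auto
        then show "E (G + G') $$ (a, b) = (E G + E G') $$ (a, b)"
          using E[of G] E[of G'] by (simp add: E_entry sum.distrib algebra_simps)
      qed (use E[of "G + G'"] E[of G'] in auto)
      moreover have "map_mat \<iota> (Mx G + Mx G') = map_mat \<iota> (Mx G) + map_mat \<iota> (Mx G')"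
        using Mx(1)[OF that(1)] Mx(1)[OF that(2)] by (intro eq_matI) (auto simp: \<iota>.hom_add)
      ultimately show "map_mat \<iota> (Mx (G + G')) = map_mat \<iota> (Mx G + Mx G')"
        using that AA_add by (simp add: Mx(2))
    qed (use Mx(1) that AA_add in auto)
    then show ?thesis
      using Mx(1)[OF that(1)] Mx(1)[OF that(2)] by (auto simp: Y_def \<epsilon>.hom_add intro!: eq_matI)
  qed
  have YH: "Y (H a) = \<epsilon> a \<cdot>\<^sub>m 1\<^sub>m N" for a
  proof -
    have "Mx (H a) = a \<cdot>\<^sub>m 1\<^sub>m N"
    proof (rule map_inj)
      have "E (H a) = map_mat \<iota> (a \<cdot>\<^sub>m 1\<^sub>m N)"
      proof (rule eq_matI)
        fix i j assume "i < dim_row (map_mat \<iota> (a \<cdot>\<^sub>m 1\<^sub>m N))" "j < dim_col (map_mat \<iota> (a \<cdot>\<^sub>m 1\<^sub>m N))"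
        then have ij: "i < N" "j < N" by auto
        have "E (H a) $$ (i, j) = \<iota> a * (\<Sum>s = 0..<N. V $$ (i, s) * U $$ (s, j))"
          unfolding E_entry[OF ij] sum_distrib_left by (intro sum.cong refl) (simp add: H_def)
        then show "E (H a) $$ (i, j) = map_mat \<iota> (a \<cdot>\<^sub>m 1\<^sub>m N) $$ (i, j)"
          using ij by (simp add: VU_entry)
      qed (use E[of "H a"] in auto)
      then show "map_mat \<iota> (Mx (H a)) = map_mat \<iota> (a \<cdot>\<^sub>m 1\<^sub>m N)" by (simp add: Mx(2)[OF AA_H])
    qed (use Mx(1)[OF AA_H] in auto)
    then show ?thesis by (auto simp: Y_def intro!: eq_matI)
  qed

  define P where "P = (\<Prod>i\<in>L. X i)"
  have AA_prod: "(\<Prod>i\<in>J. X i) \<in> AA" if "J \<subseteq> {..<n}" for J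
  proof -
    have "finite J" using that finite_subset by blast
    then show ?thesis using that
    proof (induction J)
      case empty
      show ?case using AA_H[of 1] unfolding h.hom_one prod.empty .
    next
      case (insert i J)
      then have "i < n" "(\<Prod>i\<in>J. X i) \<in> AA" by auto
      then show ?case unfolding prod.insert[OF insert.hyps] by (intro AA_mult AA_X)
    qed
  qed
  have PA: "P \<in> AA" unfolding P_def using L by (rule AA_prod)
  \<comment> \<open>The trace of multiplication by \<open>P\<close>; over the field it equals the
    trace of \<open>D P\<close>, the sum over the points.\<close>
  define T where "T = (\<Sum>a = 0..<N. Mx P $$ (a, a))"
  show ?thesis
  proof (rule that[of T])
    have "\<iota> T = (\<Sum>a = 0..<N. E P $$ (a, a))"
      unfolding T_def \<iota>.hom_sum Mx(2)[OF PA, symmetric] using Mx(1)[OF PA] by (intro sum.cong refl) auto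
    also have "\<dots> = (\<Sum>a = 0..<N. \<Sum>s = 0..<N. P (ss s) * (U $$ (s, a) * V $$ (a, s)))"
      by (intro sum.cong refl) (simp add: E_entry mult_ac)
    also have "\<dots> = (\<Sum>s = 0..<N. P (ss s) * (\<Sum>a = 0..<N. U $$ (s, a) * V $$ (a, s)))"
      by (subst sum.swap) (simp add: sum_distrib_left)
    also have "\<dots> = (\<Sum>s = 0..<N. P (ss s))"
      by (intro sum.cong refl) (simp add: UV_entry)
    also have "\<dots> = (\<Sum>\<sigma>\<in>S. P \<sigma>)" by (rule sum_ss)
    finally show "\<iota> T = (\<Sum>\<sigma>\<in>S. \<Prod>i\<in>L. x \<sigma> i)" by (simp add: P_def fun_prod_apply X_def)
  next
    assume T0: "\<epsilon> T \<noteq> 0"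
    have "\<epsilon> T = (\<Sum>a<N. Y P $$ (a, a))"
      unfolding T_def \<epsilon>.hom_sum Y_def atLeast0LessThan using Mx(1)[OF PA] by (intro sum.cong refl) auto
    then obtain e w where e: "e \<noteq> 0" and w: "w \<in> carrier_vec N" "w \<noteq> 0\<^sub>v N" "Y P *\<^sub>v w = e \<cdot>\<^sub>v w"
      using trace_nonzero_imp_eigenvalue[OF Y[OF PA]] T0 by metis
    have comm: "Y G * Y G' = Y G' * Y G" if "G \<in> AA" "G' \<in> AA" for G G'
      using Ymult[OF that] Ymult[OF that(2,1)] by (simp add: mult.commute)
    obtain v d where v: "v \<in> carrier_vec N" "v \<noteq> 0\<^sub>v N" "Y P *\<^sub>v v = e \<cdot>\<^sub>v v"
      and d: "\<forall>i<n. Y (X i) *\<^sub>v v = d i \<cdot>\<^sub>v v"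
      using commuting_common_eigenvector[of n "\<lambda>i. Y (X i)" N "Y P" w e] w comm Y PA AA_X by blast
    \<comment> \<open>Evaluation at the new solution: eigenvalues on \<open>v\<close> respect sums,
      products and, on constants, \<epsilon>. Hence the \<open>d i\<close> inherit the relations
      between the \<open>X i\<close>.\<close>
    define ev where "ev G a \<longleftrightarrow> G \<in> AA \<and> Y G *\<^sub>v v = a \<cdot>\<^sub>v v" for G a
    have ev_unique: "a = b" if "ev G a" "ev G b" for G a b
    proof -
      obtain i where i: "i < N" "v $ i \<noteq> 0"
        using v by (metis carrier_vecD dim_vec eq_vecI index_zero_vec(1) zero_carrier_vec)
      have "(a \<cdot>\<^sub>v v) $ i = (b \<cdot>\<^sub>v v) $ i" using that by (simp add: ev_def)
      then show ?thesis using i v by simp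
    qed
    have ev_mult: "ev (G * G') (a * b)" if "ev G a" "ev G' b" for G G' a b
    proof -
      have "Y (G * G') *\<^sub>v v = Y G *\<^sub>v (Y G' *\<^sub>v v)"
        using that v Y by (simp add: ev_def Ymult assoc_mult_mat_vec[of _ N N _ N])
      also have "\<dots> = b \<cdot>\<^sub>v (Y G *\<^sub>v v)" using that v Y by (simp add: ev_def mult_mat_vec[of _ N N])
      finally show ?thesis using that AA_mult by (simp add: ev_def smult_smult_assoc mult.commute)
    qed
    have ev_add: "ev (G + G') (a + b)" if "ev G a" "ev G' b" for G G' a b
    proof -
      have "Y (G + G') *\<^sub>v v = Y G *\<^sub>v v + Y G' *\<^sub>v v"
        using that v Y by (simp add: ev_def Yadd add_mult_distrib_mat_vec[of _ N N])
      also have "\<dots> = (a + b) \<cdot>\<^sub>v v" using that by (simp add: ev_def add_smult_distrib_vec)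
      finally show ?thesis using that AA_add by (simp add: ev_def)
    qed
    have ev_H: "ev (H a) (\<epsilon> a)" for a
      using v AA_H by (auto simp: ev_def YH intro!: eq_vecI)
    have ev_sum: "ev (\<Sum>i\<in>J. f i) (\<Sum>i\<in>J. g i)" if "finite J" "\<And>i. i \<in> J \<Longrightarrow> ev (f i) (g i)"
      for J :: "'i set" and f g using that
    proof (induction J)
      case empty
      show ?case using ev_H[of 0] unfolding h.hom_zero \<epsilon>.hom_zero sum.empty .
    next
      case (insert i J)
      then have "ev (f i) (g i)" "ev (\<Sum>i\<in>J. f i) (\<Sum>i\<in>J. g i)" by auto
      then show ?case unfolding sum.insert[OF insert.hyps] by (rule ev_add)
    qed
    have ev_prod: "ev (\<Prod>i\<in>J. X i) (\<Prod>i\<in>J. d i)" if "finite J" "J \<subseteq> {..<n}" for J using that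
    proof (induction J)
      case empty
      show ?case using ev_H[of 1] unfolding h.hom_one \<epsilon>.hom_one prod.empty .
    next
      case (insert i J)
      then have "i < n" "ev (\<Prod>i\<in>J. X i) (\<Prod>i\<in>J. d i)" by auto
      moreover from \<open>i < n\<close> have "ev (X i) (d i)" using d AA_X by (simp add: ev_def)
      ultimately show ?case unfolding prod.insert[OF insert.hyps] by (intro ev_mult)
    qed
    have ev_esym: "ev (esym J m X) (esym J m d)" if "J \<subseteq> {..<n}" for J m
      unfolding esym_def
    proof (rule ev_sum)
      have "finite J" using that finite_subset by blast
      then show "finite {L. L \<subseteq> J \<and> card L = m}" by simp
      fix L assume "L \<in> {L. L \<subseteq> J \<and> card L = m}"
      then have "L \<subseteq> {..<n}" using that by auto
      then show "ev (\<Prod>i\<in>L. X i) (\<Prod>i\<in>L. d i)" using ev_prod finite_subset by blast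
    qed
    have "marked_poly n (\<lambda>M. \<epsilon> (c M)) d = map_poly \<epsilon> Q"
    proof (rule poly_eqI)
      fix m
      have "ev (\<Sum>M\<in>Pow {..<n}. H (c M) *
            (if m + card M \<le> n then esym ({..<n} - M) (n - card M - m) X else 0))
          (\<Sum>M\<in>Pow {..<n}. \<epsilon> (c M) *
            (if m + card M \<le> n then esym ({..<n} - M) (n - card M - m) d else 0))"
        using ev_H[of 0] by (intro ev_sum ev_mult ev_H) (auto intro: ev_esym)
      then have "(\<Sum>M\<in>Pow {..<n}. \<epsilon> (c M) *
            (if m + card M \<le> n then esym ({..<n} - M) (n - card M - m) d else 0)) = \<epsilon> (coeff Q m)"
        unfolding relH using ev_H ev_unique by blast
      then show "coeff (marked_poly n (\<lambda>M. \<epsilon> (c M)) d) m = coeff (map_poly \<epsilon> Q) m"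
        unfolding coeff_marked_poly by (simp add: coeff_map_poly)
    qed
    moreover have "(\<Prod>i\<in>L. d i) = e"
    proof (rule ev_unique)
      show "ev P (\<Prod>i\<in>L. d i)" unfolding P_def using L finite_subset by (intro ev_prod) auto
      show "ev P e" using PA v by (simp add: ev_def)
    qed
    ultimately show "\<exists>d. marked_poly n (\<lambda>M. \<epsilon> (c M)) d = map_poly \<epsilon> Q \<and> (\<Prod>i\<in>L. d i) \<noteq> 0"
      using e by blast
  qed
qed

section \<open>Power series solutions\<close>

lemma fps_X_power_dvd_iff:
  fixes f :: "'a::comm_ring_1 fps"
  shows "fps_X ^ m dvd f \<longleftrightarrow> (\<forall>j<m. fps_nth f j = 0)"
proof
  assume "fps_X ^ m dvd f"
  then show "\<forall>j<m. fps_nth f j = 0" by (auto simp: dvd_def fps_X_power_mult_nth)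
next
  assume "\<forall>j<m. fps_nth f j = 0"
  then have "f = fps_X ^ m * fps_shift m f"
    by (intro fps_ext) (auto simp: fps_X_power_mult_nth)
  then show "fps_X ^ m dvd f" by (metis dvd_triv_left)
qed

lemma prod_fps_const: "(\<Prod>i\<in>J. fps_const (f i)) = fps_const (\<Prod>i\<in>J. f i)" for f :: "'b \<Rightarrow> 'a::comm_ring_1"
  by (induction J rule: infinite_finite_induct) auto

lemma dvd_prod_diff:
  fixes f g :: "'b \<Rightarrow> 'r::comm_ring_1"
  assumes "\<And>i. i \<in> J \<Longrightarrow> p dvd f i - g i"
  shows "p dvd (\<Prod>i\<in>J. f i) - (\<Prod>i\<in>J. g i)"
  using assms
proof (induction J rule: infinite_finite_induct)
  case (insert i J)
  have "f i * prod f J - g i * prod g J = (f i - g i) * prod f J + g i * (prod f J - prod g J)"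
    by (simp add: algebra_simps)
  then show ?case using insert by simp
qed simp_all

lemma dvd_poly_marked_poly_diff:
  assumes "\<And>i. i < n \<Longrightarrow> p dvd d i - e i"
  shows "p dvd poly (marked_poly n c d) t - poly (marked_poly n c e) t"
  unfolding poly_marked_poly sum_subtractf[symmetric] right_diff_distrib[symmetric]
  using assms by (intro dvd_sum dvd_mult dvd_prod_diff) auto

lemma poly_marked_poly_remove:
  "poly (marked_poly n c d) t = c {} * (\<Prod>i<n. d i + t) + (\<Sum>M\<in>Pow {..<n} - {{}}. c M * (\<Prod>i\<in>{..<n} - M. d i + t))"
  unfolding poly_marked_poly by (subst sum.remove[of _ "{}"]) auto

text \<open>At \<open>t = - y l\<close> only the partial derivative with respect to the \<open>l\<close>-th variable survives to
  first order, so the Jacobian of the system is diagonal.\<close>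

lemma hensel_step:
  fixes y :: "nat \<Rightarrow> 'a::field"
  assumes y: "inj_on y {..<n}" and c0: "c {} = 1"
    and cX: "\<And>M. M \<subseteq> {..<n} \<Longrightarrow> M \<noteq> {} \<Longrightarrow> fps_X dvd c M"
    and m: "m \<ge> 1"
    and d: "\<And>i. i < n \<Longrightarrow> fps_X dvd d i - fps_const (y i)"
    and E: "\<And>l. l < n \<Longrightarrow> fps_X ^ m dvd poly (marked_poly n c d) (fps_const (- y l)) - r l"
  obtains v where "\<And>l. l < n \<Longrightarrow>
    fps_X ^ Suc m dvd poly (marked_poly n c (\<lambda>i. d i + fps_X ^ m * fps_const (v i))) (fps_const (- y l)) - r l"
proof -
  define D where "D l = (\<Prod>i\<in>{..<n} - {l}. y i - y l)" for l
  have D: "D l \<noteq> 0" if "l < n" for l using y that by (auto simp: D_def inj_on_def)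
  define err where "err l = poly (marked_poly n c d) (fps_const (- y l)) - r l" for l
  \<comment> \<open>Newton's correction: it cancels the coefficient of \<open>fps_X ^ m\<close> in
    the error. The nonempty marks are divisible by \<open>fps_X\<close> and react only from order
    \<open>Suc m\<close> on.\<close>
  define v where "v l = - fps_nth (err l) m / D l" for l
  let ?d = "\<lambda>i. d i + fps_X ^ m * fps_const (v i)"
  have "fps_X ^ Suc m dvd poly (marked_poly n c ?d) (fps_const (- y l)) - r l" if l: "l < n" for l
  proof -
    define a where "a i = d i + fps_const (- y l)" for i
    define P where "P e = (\<Prod>i\<in>{..<n} - {l}. e i + fps_const (- y l))" for e :: "nat \<Rightarrow> 'a fps"
    have rem: "(\<Prod>i<n. e i + fps_const (- y l)) = (e l + fps_const (- y l)) * P e" for e :: "nat \<Rightarrow> 'a fps"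
      unfolding P_def using l by (subst prod.remove[of _ l]) auto
    have dd: "fps_X ^ m dvd ?d i - d i" for i by simp
    have PP: "fps_X ^ m dvd P ?d - P d"
      unfolding P_def by (rule dvd_prod_diff) simp
    have PD: "fps_X dvd P ?d - fps_const (D l)"
    proof -
      have "fps_X dvd fps_X ^ m * fps_const (v i)" for i
        using m by (intro dvd_mult2) (auto simp: dvd_power)
      then have h: "fps_X dvd (d i - fps_const (y i)) + fps_X ^ m * fps_const (v i)" if "i < n" for i
        using d[OF that] by (intro dvd_add) auto
      then have "fps_X dvd P ?d - (\<Prod>i\<in>{..<n} - {l}. fps_const (y i - y l))"
        unfolding P_def
      proof (intro dvd_prod_diff)
        fix i assume "i \<in> {..<n} - {l}"
        then have i: "i < n" by simp
        have eq: "?d i + fps_const (- y l) - fps_const (y i - y l) =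
            (d i - fps_const (y i)) + fps_X ^ m * fps_const (v i)"
          by (intro fps_ext) simp
        show "fps_X dvd ?d i + fps_const (- y l) - fps_const (y i - y l)"
          unfolding eq by (rule h[OF i])
      qed
      moreover have "(\<Prod>i\<in>{..<n} - {l}. fps_const (y i - y l)) = fps_const (D l)"
        unfolding D_def by (rule prod_fps_const)
      ultimately show ?thesis by simp
    qed
    have main: "fps_X ^ Suc m dvd (?d l + fps_const (- y l)) * P ?d - (a l * P d + fps_X ^ m * fps_const (v l * D l))"
    proof -
      have al: "fps_X dvd a l" using d[OF l] by (simp add: a_def fps_const_neg[symmetric] del: fps_const_neg)
      have "(?d l + fps_const (- y l)) * P ?d - (a l * P d + fps_X ^ m * fps_const (v l * D l)) =
          a l * (P ?d - P d) + fps_X ^ m * fps_const (v l) * (P ?d - fps_const (D l))"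
        by (simp add: a_def algebra_simps fps_const_mult[symmetric] del: fps_const_mult)
      moreover have "fps_X ^ Suc m dvd a l * (P ?d - P d)"
        using mult_dvd_mono[OF al PP] by simp
      moreover have "fps_X ^ Suc m dvd fps_X ^ m * fps_const (v l) * (P ?d - fps_const (D l))"
        using mult_dvd_mono[OF dvd_triv_left[of "fps_X ^ m" "fps_const (v l)"] PD] by (simp add: mult.commute)
      ultimately show ?thesis by (simp only: dvd_add)
    qed
    have rest: "fps_X ^ Suc m dvd c M * (\<Prod>i\<in>{..<n} - M. ?d i + fps_const (- y l)) - c M * (\<Prod>i\<in>{..<n} - M. d i + fps_const (- y l))"
      if "M \<in> Pow {..<n} - {{}}" for M
    proof -
      have "fps_X ^ m dvd (\<Prod>i\<in>{..<n} - M. ?d i + fps_const (- y l)) - (\<Prod>i\<in>{..<n} - M. d i + fps_const (- y l))"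
        by (rule dvd_prod_diff) simp
      moreover have "fps_X dvd c M" using cX that by auto
      ultimately show ?thesis
        unfolding right_diff_distrib[symmetric] power_Suc by (intro mult_dvd_mono)
    qed
    have "fps_X ^ Suc m dvd (\<Sum>M\<in>Pow {..<n} - {{}}. c M * (\<Prod>i\<in>{..<n} - M. ?d i + fps_const (- y l)) - c M * (\<Prod>i\<in>{..<n} - M. d i + fps_const (- y l)))"
      using rest by (rule dvd_sum)
    then have "fps_X ^ Suc m dvd ((?d l + fps_const (- y l)) * P ?d - (a l * P d + fps_X ^ m * fps_const (v l * D l))) +
       (\<Sum>M\<in>Pow {..<n} - {{}}. c M * (\<Prod>i\<in>{..<n} - M. ?d i + fps_const (- y l)) - c M * (\<Prod>i\<in>{..<n} - M. d i + fps_const (- y l)))"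
      by (rule dvd_add[OF main])
    moreover have "poly (marked_poly n c ?d) (fps_const (- y l)) - r l =
       (((?d l + fps_const (- y l)) * P ?d - (a l * P d + fps_X ^ m * fps_const (v l * D l))) +
       (\<Sum>M\<in>Pow {..<n} - {{}}. c M * (\<Prod>i\<in>{..<n} - M. ?d i + fps_const (- y l)) - c M * (\<Prod>i\<in>{..<n} - M. d i + fps_const (- y l))))
       + (err l + fps_X ^ m * fps_const (v l * D l))"
      unfolding err_def poly_marked_poly_remove rem c0 sum_subtractf a_def by simp
    moreover have "fps_X ^ Suc m dvd err l + fps_X ^ m * fps_const (v l * D l)"
    proof -
      have "\<forall>j<m. fps_nth (err l) j = 0" using E[OF l] by (simp add: err_def fps_X_power_dvd_iff)
      then show ?thesis using D[OF l]
        by (auto simp: fps_X_power_dvd_iff fps_X_power_mult_nth v_def less_Suc_eq simp del: power_Suc)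
    qed
    ultimately show ?thesis by (simp only: dvd_add)
  qed
  then show ?thesis using that by blast
qed

text \<open>Corrections touch ever higher coefficients, so the approximations stabilise. Starting
  with an error of order \<open>k\<close> keeps the solution congruent to the constants modulo
  \<open>fps_X ^ k\<close>.\<close>

lemma hensel_solution:
  fixes y :: "nat \<Rightarrow> 'a::field"
  assumes y: "inj_on y {..<n}" and c0: "c {} = 1"
    and cX: "\<And>M. M \<subseteq> {..<n} \<Longrightarrow> M \<noteq> {} \<Longrightarrow> fps_X dvd c M"
    and k: "k \<ge> 1"
    and E: "\<And>l. l < n \<Longrightarrow> fps_X ^ k dvd poly (marked_poly n c (\<lambda>i. fps_const (y i))) (fps_const (- y l)) - r l"
  obtains d where "\<And>i. i < n \<Longrightarrow> fps_X ^ k dvd d i - fps_const (y i)"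
    "\<And>l. l < n \<Longrightarrow> poly (marked_poly n c d) (fps_const (- y l)) = r l"
proof -
  define P where "P p d \<longleftrightarrow> (\<forall>i<n. fps_X ^ k dvd d i - fps_const (y i)) \<and>
    (\<forall>l<n. fps_X ^ (k + p) dvd poly (marked_poly n c d) (fps_const (- y l)) - r l)" for p d
  have "\<exists>D. \<forall>p. P p (D p) \<and> (\<forall>i. fps_X ^ (k + p) dvd D (Suc p) i - D p i)"
  proof (rule dependent_nat_choice)
    show "\<exists>d. P 0 d" using E by (intro exI[of _ "\<lambda>i. fps_const (y i)"]) (simp add: P_def)
  next
    fix d p assume P: "P p d"
    have X: "fps_X dvd (fps_X ^ k :: 'a fps)" using k by (simp add: dvd_power)
    obtain v where v: "\<And>l. l < n \<Longrightarrow> fps_X ^ Suc (k + p) dvd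
        poly (marked_poly n c (\<lambda>i. d i + fps_X ^ (k + p) * fps_const (v i))) (fps_const (- y l)) - r l"
    proof (rule hensel_step[where c = c and m = "k + p" and d = d and r = r])
      show "fps_X dvd d i - fps_const (y i)" if "i < n" for i
        using P that dvd_trans[OF X] by (auto simp: P_def)
      show "fps_X ^ (k + p) dvd poly (marked_poly n c d) (fps_const (- y l)) - r l" if "l < n" for l
        using P that by (auto simp: P_def)
    qed (use k in \<open>auto intro: y c0 cX\<close>)
    have "fps_X ^ k dvd (d i - fps_const (y i)) + fps_X ^ (k + p) * fps_const (v i)" if "i < n" for i
      using P that by (intro dvd_add) (auto simp: P_def power_add mult.assoc)
    then have "P (Suc p) (\<lambda>i. d i + fps_X ^ (k + p) * fps_const (v i))"
      using v by (auto simp: P_def algebra_simps simp del: power_Suc)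
    then show "\<exists>d'. P (Suc p) d' \<and> (\<forall>i. fps_X ^ (k + p) dvd d' i - d i)" by force
  qed
  then obtain D where D: "\<And>p. P p (D p)" "\<And>p i. fps_X ^ (k + p) dvd D (Suc p) i - D p i" by blast
  have stable: "fps_nth (D q i) j = fps_nth (D p i) j" if "p \<le> q" "j < k + p" for p q i j
    using that
  proof (induction q rule: dec_induct)
    case (step q)
    then have "fps_nth (D (Suc q) i - D q i) j = 0"
      using D(2)[of q i] unfolding fps_X_power_dvd_iff by auto
    then show ?case using step by simp
  qed simp
  \<comment> \<open>Stage \<open>j\<close> is final below order \<open>k + j\<close>, and
    \<open>k \<ge> 1\<close> makes this include the coefficient \<open>j\<close>.\<close>
  define d where "d i = Abs_fps (\<lambda>j. fps_nth (D j i) j)" for i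
  have dD: "fps_X ^ (k + p) dvd d i - D p i" for p i
    unfolding fps_X_power_dvd_iff
  proof (intro allI impI)
    fix j assume j: "j < k + p"
    have "fps_nth (D j i) j = fps_nth (D p i) j"
      using stable[of "min j p" j j i] stable[of "min j p" p j i] j k by (auto simp: min_def split: if_splits)
    then show "fps_nth (d i - D p i) j = 0" by (simp add: d_def)
  qed
  show ?thesis
  proof (rule that)
    fix i assume "i < n"
    then have "fps_X ^ k dvd (d i - D 0 i) + (D 0 i - fps_const (y i))"
      using D(1)[of 0] dD[of 0 i] by (intro dvd_add) (auto simp: P_def)
    moreover have "(a - b) + (b - c) = a - c" for a b c :: "'a fps" by simp
    ultimately show "fps_X ^ k dvd d i - fps_const (y i)" by metis
  next
    fix l assume l: "l < n"
    let ?f = "poly (marked_poly n c d) (fps_const (- y l)) - r l"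
    have "fps_nth ?f j = 0" for j
    proof -
      have "fps_X ^ (k + j) dvd (poly (marked_poly n c d) (fps_const (- y l)) - poly (marked_poly n c (D j)) (fps_const (- y l)))
          + (poly (marked_poly n c (D j)) (fps_const (- y l)) - r l)"
        using D(1)[of j] l dD by (intro dvd_add dvd_poly_marked_poly_diff) (auto simp: P_def)
      then have "fps_X ^ (k + j) dvd ?f" by simp
      then show ?thesis using k by (auto simp: fps_X_power_dvd_iff)
    qed
    then have "?f = 0" by (intro fps_ext) simp
    then show "poly (marked_poly n c d) (fps_const (- y l)) = r l" by simp
  qed
qed

section \<open>Symmetrised partial fractions\<close>

text \<open>The nodes are \<open>- z i\<close>, so that the basis polynomials are products of
  factors \<open>t + z j\<close>.\<close>

lemma lagrange_interpolation:
  fixes z :: "'b \<Rightarrow> 'a::field"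
  assumes Z: "finite Z" "inj_on z Z" and q: "degree q < card Z"
  shows "q = (\<Sum>i\<in>Z. smult (poly q (- z i) / (\<Prod>j\<in>Z - {i}. z j - z i)) (\<Prod>j\<in>Z - {i}. [:z j, 1:]))"
    (is "q = ?r")
proof (rule poly_eqI_degree[where A = "(\<lambda>i. - z i) ` Z"])
  have "card ((\<lambda>i. - z i) ` Z) = card Z"
    using Z by (intro card_image) (auto simp: inj_on_def)
  moreover have "degree ?r \<le> card Z - 1"
  proof (rule degree_sum_le[OF Z(1)])
    fix i assume i: "i \<in> Z"
    let ?p = "\<Prod>j\<in>Z - {i}. [:z j, 1:]"
    have "degree ?p = card (Z - {i})" using Z by (intro degree_prod_linear) auto
    then show "degree (smult (poly q (- z i) / (\<Prod>j\<in>Z - {i}. z j - z i)) ?p) \<le> card Z - 1"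
      using Z i degree_smult_le[of _ ?p] by simp
  qed
  ultimately show "degree q < card ((\<lambda>i. - z i) ` Z)" "degree ?r < card ((\<lambda>i. - z i) ` Z)"
    using q by auto
next
  fix t assume "t \<in> (\<lambda>i. - z i) ` Z"
  then obtain l where l: "l \<in> Z" "t = - z l" by auto
  have nz: "(\<Prod>j\<in>Z - {l}. z j - z l) \<noteq> 0" using Z l by (auto simp: inj_on_def)
  have "poly ?r t = (\<Sum>i\<in>Z. if i = l then poly q t else 0)"
    unfolding poly_sum poly_smult poly_prod
  proof (intro sum.cong refl)
    fix i assume i: "i \<in> Z"
    show "poly q (- z i) / (\<Prod>j\<in>Z - {i}. z j - z i) * (\<Prod>j\<in>Z - {i}. poly [:z j, 1:] t) =
        (if i = l then poly q t else 0)"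
    proof (cases "i = l")
      case True
      then show ?thesis using nz l by simp
    next
      case False
      then have "(\<Prod>j\<in>Z - {i}. poly [:z j, 1:] t) = 0"
        using Z l by (intro prod_zero bexI[of _ l]) auto
      then show ?thesis using False by simp
    qed
  qed
  then show "poly q t = poly ?r t" using l Z by simp
qed

text \<open>Lagrange's formula for \<open>(-t)^c\<close>, read at the coefficient with exponent
  \<open>card Z - 1\<close>, which exceeds \<open>c\<close>.\<close>

lemma sum_power_over_differences:
  fixes z :: "'b \<Rightarrow> 'a::field"
  assumes Z: "finite Z" "inj_on z Z" and c: "Suc c < card Z"
  shows "(\<Sum>i\<in>Z. z i ^ c / (\<Prod>j\<in>Z - {i}. z j - z i)) = 0"
proof -
  let ?q = "monom ((-1) ^ c) c :: 'a poly"
  have deg: "degree ?q = c" by (simp add: degree_monom_eq)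
  have val: "poly ?q (- z i) = z i ^ c" for i
    by (simp add: poly_monom power_mult_distrib[symmetric])
  have "coeff ?q (card Z - 1) = 0" using c deg by (intro coeff_eq_0) auto
  moreover have "coeff ?q (card Z - 1) = (\<Sum>i\<in>Z. z i ^ c / (\<Prod>j\<in>Z - {i}. z j - z i))"
  proof -
    have "coeff (\<Prod>j\<in>Z - {i}. [:z j, 1:]) (card Z - 1) = 1" if "i \<in> Z" for i
      using degree_prod_linear(2)[of "Z - {i}" z] Z that by simp
    then show ?thesis
      using deg c by (subst lagrange_interpolation[OF Z, of ?q]) (simp_all add: coeff_sum val)
  qed
  ultimately show ?thesis by simp
qed

text \<open>Lagrange's formula for the constant 1, evaluated at 0.\<close>

lemma sum_prod_over_differences:
  fixes z :: "'b \<Rightarrow> 'a::field"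
  assumes Z: "finite Z" "inj_on z Z" and ne: "Z \<noteq> {}"
  shows "(\<Sum>i\<in>Z. (\<Prod>j\<in>Z - {i}. z j) / (\<Prod>j\<in>Z - {i}. z j - z i)) = 1"
proof -
  have "degree (1 :: 'a poly) < card Z" using Z ne by (simp add: card_gt_0_iff)
  from arg_cong[OF lagrange_interpolation[OF Z this], of "\<lambda>p. poly p 0"]
  show ?thesis by (simp add: poly_sum poly_prod)
qed

text \<open>The factors of \<open>A\<close> are traded one by one against denominators or powers of \<open>y (\<sigma> i)\<close>,
  which reduces the claim to the vanishing of a symmetrised Lagrange sum.\<close>

lemma symmetrised_quotient_eq_0:
  fixes y :: "'b \<Rightarrow> 'a::field"
  assumes I: "finite I" "inj_on y I" and nz: "\<And>m. 1 \<le> m \<Longrightarrow> m \<le> card I \<Longrightarrow> of_nat m \<noteq> (0::'a)"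
    and "B \<subseteq> I" "i \<in> I - B" "A \<subseteq> B" "C \<subseteq> I - insert i B" "c + card A < card B"
  shows "(\<Sum>\<sigma> | \<sigma> permutes I. (\<Prod>j\<in>C. y (\<sigma> j)) * (\<Prod>j\<in>A. y (\<sigma> j)) * y (\<sigma> i) ^ c /
    (\<Prod>j\<in>B. y (\<sigma> j) - y (\<sigma> i))) = 0"
  using assms(4-)
proof (induction "card A" arbitrary: A B C c)
  case 0
  have fin: "finite B" "finite A" using 0 I finite_subset by (metis, metis (no_types) finite_subset)
  then have A: "A = {}" using 0 by simp
  define Z where "Z = insert i B"
  have Z: "finite Z" "Z \<subseteq> I" "card Z = Suc (card B)" "i \<in> Z" using fin 0 by (auto simp: Z_def)
  define G where "G l \<sigma> = (\<Prod>j\<in>C. y (\<sigma> j)) * y (\<sigma> l) ^ c / (\<Prod>j\<in>Z - {l}. y (\<sigma> j) - y (\<sigma> l))" for l \<sigma>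
  \<comment> \<open>Exchanging \<open>i\<close> and \<open>l\<close> fixes \<open>C\<close>, which
    is disjoint from \<open>Z\<close>, and maps \<open>Z - {i}\<close> to \<open>Z - {l}\<close>.
    Summing over all \<open>l\<close> then produces a Lagrange sum for each permutation.\<close>
  have eq: "(\<Sum>\<sigma> | \<sigma> permutes I. G l \<sigma>) = (\<Sum>\<sigma> | \<sigma> permutes I. G i \<sigma>)" if l: "l \<in> Z" for l
  proof -
    let ?t = "Transposition.transpose i l"
    have t: "?t permutes I" using Z l by (intro permutes_swap_id) auto
    have "G i (\<sigma> \<circ> ?t) = G l \<sigma>" for \<sigma>
    proof -
      have "(\<Prod>j\<in>C. y ((\<sigma> \<circ> ?t) j)) = (\<Prod>j\<in>C. y (\<sigma> j))"
        using 0 l by (intro prod.cong refl) (auto simp: Z_def Transposition.transpose_def)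
      moreover have "(\<Prod>j\<in>Z - {i}. y ((\<sigma> \<circ> ?t) j) - y ((\<sigma> \<circ> ?t) i)) = (\<Prod>j\<in>Z - {l}. y (\<sigma> j) - y (\<sigma> l))"
        by (rule prod.reindex_bij_witness[of _ ?t ?t])
          (use Z l in \<open>auto simp: Transposition.transpose_def\<close>)
      ultimately show ?thesis by (simp add: G_def)
    qed
    then show ?thesis using sum_permutations_compose_right[OF t, of "G i"] by simp
  qed
  have "of_nat (card Z) * (\<Sum>\<sigma> | \<sigma> permutes I. G i \<sigma>) = (\<Sum>l\<in>Z. \<Sum>\<sigma> | \<sigma> permutes I. G l \<sigma>)"
    by (simp add: eq)
  also have "\<dots> = (\<Sum>\<sigma> | \<sigma> permutes I. \<Sum>l\<in>Z. G l \<sigma>)" by (rule sum.swap)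
  also have "\<dots> = 0"
  proof (rule sum.neutral, safe)
    fix \<sigma> assume "\<sigma> permutes I"
    then have "inj_on (y \<circ> \<sigma>) I" using I by (simp add: comp_inj_on permutes_image permutes_inj_on)
    then have "inj_on (y \<circ> \<sigma>) Z" using Z(2) inj_on_subset by blast
    then have "(\<Sum>l\<in>Z. (y \<circ> \<sigma>) l ^ c / (\<Prod>j\<in>Z - {l}. (y \<circ> \<sigma>) j - (y \<circ> \<sigma>) l)) = 0"
    proof (rule sum_power_over_differences[OF Z(1)])
      show "Suc c < card Z" using Z 0 by simp
    qed
    then show "(\<Sum>l\<in>Z. G l \<sigma>) = 0"
      unfolding G_def times_divide_eq_right[symmetric] sum_distrib_left[symmetric] by simp
  qed
  finally have "(\<Sum>\<sigma> | \<sigma> permutes I. G i \<sigma>) = 0"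
    using nz[of "card Z"] Z card_mono[OF I(1) Z(2)] by simp
  moreover have "Z - {i} = B" using 0 by (auto simp: Z_def)
  ultimately show ?case by (simp add: G_def A)
next
  case (Suc m)
  have fin: "finite B" "finite A" "finite C"
    using Suc.prems I by (auto intro: finite_subset[of _ I] finite_subset[of _ B])
  obtain l where l: "l \<in> A" using Suc.hyps(2) by fastforce
  have lB: "l \<in> B" "l \<in> I" "l \<noteq> i" "l \<notin> C" using Suc.prems l by auto
  have cA: "card (A - {l}) = m" "card B = Suc (card (B - {l}))" using Suc.hyps(2) l fin
      card_Suc_Diff1[OF fin(1) lB(1)] by simp_all
  \<comment> \<open>With \<open>u = y (\<sigma> l)\<close> and \<open>w = y (\<sigma> i)\<close>
    this is \<open>u / (u - w) = 1 + w / (u - w)\<close>. Both terms keep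
    \<open>c + card A < card B\<close>: \<open>A\<close> loses an element, while \<open>B\<close>
    loses one or \<open>c\<close> grows by one.\<close>
  have "(\<Prod>j\<in>C. y (\<sigma> j)) * (\<Prod>j\<in>A. y (\<sigma> j)) * y (\<sigma> i) ^ c / (\<Prod>j\<in>B. y (\<sigma> j) - y (\<sigma> i)) =
      (\<Prod>j\<in>C. y (\<sigma> j)) * (\<Prod>j\<in>A - {l}. y (\<sigma> j)) * y (\<sigma> i) ^ c / (\<Prod>j\<in>B - {l}. y (\<sigma> j) - y (\<sigma> i)) +
      (\<Prod>j\<in>C. y (\<sigma> j)) * (\<Prod>j\<in>A - {l}. y (\<sigma> j)) * y (\<sigma> i) ^ Suc c / (\<Prod>j\<in>B. y (\<sigma> j) - y (\<sigma> i))"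
    if \<sigma>: "\<sigma> permutes I" for \<sigma>
  proof -
    have 1: "(\<Prod>j\<in>A. y (\<sigma> j)) = y (\<sigma> l) * (\<Prod>j\<in>A - {l}. y (\<sigma> j))"
      using fin l by (simp add: prod.remove)
    have 2: "(\<Prod>j\<in>B. y (\<sigma> j) - y (\<sigma> i)) = (y (\<sigma> l) - y (\<sigma> i)) * (\<Prod>j\<in>B - {l}. y (\<sigma> j) - y (\<sigma> i))"
      using fin lB by (simp add: prod.remove)
    have "\<sigma> l \<noteq> \<sigma> i" using \<sigma> lB by (metis permutes_inj injD)
    moreover have "\<sigma> l \<in> I" "\<sigma> i \<in> I" using \<sigma> lB Suc.prems by (auto simp: permutes_in_image)
    ultimately have "y (\<sigma> l) - y (\<sigma> i) \<noteq> 0" using I by (auto simp: inj_on_def)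
    then have "a * (y (\<sigma> l) * b) * p / ((y (\<sigma> l) - y (\<sigma> i)) * d) =
        a * b * p / d + a * b * (y (\<sigma> i) * p) / ((y (\<sigma> l) - y (\<sigma> i)) * d)" for a b p d
      by (cases "d = 0") (simp_all add: field_simps)
    then show ?thesis unfolding 1 2 power_Suc .
  qed
  then have split: "(\<Sum>\<sigma> | \<sigma> permutes I. (\<Prod>j\<in>C. y (\<sigma> j)) * (\<Prod>j\<in>A. y (\<sigma> j)) * y (\<sigma> i) ^ c / (\<Prod>j\<in>B. y (\<sigma> j) - y (\<sigma> i))) =
      (\<Sum>\<sigma> | \<sigma> permutes I. (\<Prod>j\<in>C. y (\<sigma> j)) * (\<Prod>j\<in>A - {l}. y (\<sigma> j)) * y (\<sigma> i) ^ c / (\<Prod>j\<in>B - {l}. y (\<sigma> j) - y (\<sigma> i))) +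
      (\<Sum>\<sigma> | \<sigma> permutes I. (\<Prod>j\<in>C. y (\<sigma> j)) * (\<Prod>j\<in>A - {l}. y (\<sigma> j)) * y (\<sigma> i) ^ Suc c / (\<Prod>j\<in>B. y (\<sigma> j) - y (\<sigma> i)))"
    unfolding sum.distrib[symmetric] by (intro sum.cong refl) auto
  have "(\<Sum>\<sigma> | \<sigma> permutes I. (\<Prod>j\<in>C. y (\<sigma> j)) * (\<Prod>j\<in>A - {l}. y (\<sigma> j)) * y (\<sigma> i) ^ c / (\<Prod>j\<in>B - {l}. y (\<sigma> j) - y (\<sigma> i))) = 0"
    using Suc.prems cA Suc.hyps(2) by (intro Suc.hyps(1)) auto
  moreover have "(\<Sum>\<sigma> | \<sigma> permutes I. (\<Prod>j\<in>C. y (\<sigma> j)) * (\<Prod>j\<in>A - {l}. y (\<sigma> j)) * y (\<sigma> i) ^ Suc c / (\<Prod>j\<in>B. y (\<sigma> j) - y (\<sigma> i))) = 0"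
    using Suc.prems cA Suc.hyps(2) by (intro Suc.hyps(1)) auto
  ultimately show ?case unfolding split by simp
qed

text \<open>An orthogonality relation that isolates the mark at \<open>L\<close>. For
  \<open>M = L\<close> each permutation contributes 1 by Lagrange. For \<open>M \<noteq> L\<close>
  equal sizes put an element of \<open>M\<close> outside \<open>L\<close>, so the denominators
  outnumber the matching numerators and each \<open>l\<close> sums to 0.\<close>

lemma symmetrised_partial_fractions:
  fixes y :: "'b \<Rightarrow> 'a::field"
  assumes I: "finite I" "inj_on y I" and nz: "\<And>m. 1 \<le> m \<Longrightarrow> m \<le> card I \<Longrightarrow> of_nat m \<noteq> (0::'a)"
    and L: "L \<subseteq> I" and M: "M \<subseteq> I" "card M = card L" "M \<noteq> {}"
  shows "(\<Sum>\<sigma> | \<sigma> permutes I. \<Sum>l\<in>L \<inter> M. (\<Prod>j\<in>L - {l}. y (\<sigma> j)) / (\<Prod>j\<in>M - {l}. y (\<sigma> j) - y (\<sigma> l))) =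
    (if M = L then of_nat (fact (card I)) else 0)"
proof (cases "M = L")
  case True
  have "(\<Sum>l\<in>L. (\<Prod>j\<in>L - {l}. y (\<sigma> j)) / (\<Prod>j\<in>L - {l}. y (\<sigma> j) - y (\<sigma> l))) = 1" if "\<sigma> permutes I" for \<sigma>
  proof -
    have "inj_on (y \<circ> \<sigma>) I" using I that by (simp add: comp_inj_on permutes_image permutes_inj_on)
    then have "inj_on (y \<circ> \<sigma>) L" using L inj_on_subset by blast
    then show ?thesis
      using sum_prod_over_differences[of L "y \<circ> \<sigma>"] True M(3) L finite_subset[OF L I(1)] by simp
  qed
  then show ?thesis using True by (simp add: card_permutations[OF refl I(1)])
next
  case False
  have fin: "finite L" "finite M" using L M I finite_subset by blast+
  have "(\<Sum>\<sigma> | \<sigma> permutes I. (\<Prod>j\<in>L - {l}. y (\<sigma> j)) / (\<Prod>j\<in>M - {l}. y (\<sigma> j) - y (\<sigma> l))) = 0"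
    if l: "l \<in> L \<inter> M" for l
  proof -
    have "\<not> M \<subseteq> L" using False M fin card_subset_eq by metis
    then obtain a where a: "a \<in> M" "a \<notin> L" by auto
    have "card (L \<inter> M - {l}) < card (M - {l})"
      using fin a l by (intro psubset_card_mono) auto
    moreover have "(\<Prod>j\<in>L - {l}. y (\<sigma> j)) = (\<Prod>j\<in>L - M. y (\<sigma> j)) * (\<Prod>j\<in>L \<inter> M - {l}. y (\<sigma> j)) * y (\<sigma> l) ^ 0" for \<sigma>
      using fin l by (simp, subst prod.union_disjoint[symmetric]) (auto intro!: prod.cong)
    moreover have "(\<Sum>\<sigma> | \<sigma> permutes I. (\<Prod>j\<in>L - M. y (\<sigma> j)) * (\<Prod>j\<in>L \<inter> M - {l}. y (\<sigma> j)) * y (\<sigma> l) ^ 0 /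
        (\<Prod>j\<in>M - {l}. y (\<sigma> j) - y (\<sigma> l))) = 0"
      by (rule symmetrised_quotient_eq_0[OF I nz]) (use L M l calculation(1) in auto)
    ultimately show ?thesis by simp
  qed
  then show ?thesis using False by (subst sum.swap) simp
qed

lemma permutes_mapping_subset:
  assumes I: "finite I" and "L \<subseteq> I" "L' \<subseteq> I" "card L = card L'"
  obtains \<pi> where "\<pi> permutes I" "\<pi> ` L = L'"
proof -
  have fin: "finite L" "finite L'" using assms finite_subset by blast+
  then obtain f where f: "bij_betw f L L'" using assms finite_same_card_bij by blast
  have "card (I - L) = card (I - L')" using assms fin by (simp add: card_Diff_subset)
  then obtain g where g: "bij_betw g (I - L) (I - L')" using I finite_same_card_bij by blast
  define \<pi> where "\<pi> x = (if x \<in> L then f x else if x \<in> I then g x else x)" for x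
  have L: "bij_betw \<pi> L L'" using f by (rule iffD1[OF bij_betw_cong, rotated]) (simp add: \<pi>_def)
  have "bij_betw \<pi> (I - L) (I - L')" using g by (rule iffD1[OF bij_betw_cong, rotated]) (simp add: \<pi>_def)
  then have "bij_betw \<pi> (L \<union> (I - L)) (L' \<union> (I - L'))" using L by (intro bij_betw_combine) auto
  moreover have "L \<union> (I - L) = I" "L' \<union> (I - L') = I" using assms by auto
  ultimately have "bij_betw \<pi> I I" by simp
  then have "\<pi> permutes I" using assms by (intro bij_imp_permutes) (auto simp: \<pi>_def)
  then show ?thesis using that L by (auto simp: bij_betw_def)
qed

section \<open>The trace over the deformed fibre\<close>

lemma fps_mult_nth_lowest:
  fixes f g :: "'a::comm_ring_1 fps"
  assumes "\<And>j. j < k \<Longrightarrow> fps_nth f j = 0"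
  shows "fps_nth (f * g) k = fps_nth f k * fps_nth g 0"
proof -
  have "fps_nth (f * g) k = (\<Sum>j=0..k. if j = k then fps_nth f k * fps_nth g 0 else 0)"
    unfolding fps_mult_nth using assms by (intro sum.cong refl) auto
  then show ?thesis by simp
qed

lemma fps_prod_nth_0: "fps_nth (\<Prod>i\<in>J. f i) 0 = (\<Prod>i\<in>J. fps_nth (f i) 0)"
  for f :: "'b \<Rightarrow> 'a::comm_ring_1 fps"
  by (induction J rule: infinite_finite_induct) auto

text \<open>The orders strictly between 0 and \<open>k\<close> are empty, so order \<open>k\<close>
  arises from one factor at order \<open>k\<close> and constant terms elsewhere.\<close>

lemma fps_prod_nth_first_order:
  fixes d :: "'b \<Rightarrow> 'a::comm_ring_1 fps"
  assumes "finite J" and k: "k \<ge> 1"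
    and d: "\<And>i j. i \<in> J \<Longrightarrow> 0 < j \<Longrightarrow> j < k \<Longrightarrow> fps_nth (d i) j = 0"
    and d0: "\<And>i. i \<in> J \<Longrightarrow> fps_nth (d i) 0 = y i"
  shows "fps_nth (\<Prod>i\<in>J. d i) k = (\<Sum>i\<in>J. fps_nth (d i) k * (\<Prod>j\<in>J - {i}. y j))"
  using assms(1) d d0
proof (induction J)
  case empty
  then show ?case using k by simp
next
  case (insert a J)
  let ?P = "\<Prod>i\<in>J. d i"
  have "fps_nth (d a * ?P) k = (\<Sum>j=0..k. fps_nth (d a) j * fps_nth ?P (k - j))"
    by (rule fps_mult_nth)
  also have "\<dots> = (\<Sum>j\<in>{0, k}. fps_nth (d a) j * fps_nth ?P (k - j))"
    using insert.prems(1)[of a] by (intro sum.mono_neutral_right) (auto simp: le_less)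
  also have "\<dots> = y a * fps_nth ?P k + fps_nth (d a) k * (\<Prod>j\<in>J. y j)"
    using k insert.prems(2) by (simp add: fps_prod_nth_0)
  also have "fps_nth ?P k = (\<Sum>i\<in>J. fps_nth (d i) k * (\<Prod>j\<in>J - {i}. y j))"
    using insert.prems by (intro insert.IH) auto
  also have "y a * \<dots> = (\<Sum>i\<in>J. fps_nth (d i) k * (\<Prod>j\<in>insert a J - {i}. y j))"
    unfolding sum_distrib_left
  proof (intro sum.cong refl)
    fix i assume i: "i \<in> J"
    then have "insert a J - {i} = insert a (J - {i})" using insert.hyps by auto
    then show "y a * (fps_nth (d i) k * (\<Prod>j\<in>J - {i}. y j)) = fps_nth (d i) k * (\<Prod>j\<in>insert a J - {i}. y j)"
      using insert.hyps by (simp add: mult_ac)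
  qed
  finally show ?case using insert.hyps by (simp add: add.commute)
qed

text \<open>Rescaling the unknowns by \<open>fps_X\<close> multiplies the mark at \<open>M\<close>
  by this power. At order 0 only the empty mark is left.\<close>

definition scaled_marks :: "(nat set \<Rightarrow> 'a::comm_ring_1) \<Rightarrow> nat set \<Rightarrow> 'a fps" where
  "scaled_marks b M = fps_X ^ card M * fps_const (b M)"

lemma fps_nth_scaled_marks_mult:
  assumes "M \<subseteq> {..<n}" "M \<noteq> {}" and bz: "\<And>M. M \<subseteq> {..<n} \<Longrightarrow> M \<noteq> {} \<Longrightarrow> card M < k \<Longrightarrow> b M = 0"
  shows "fps_nth (scaled_marks b M * z) k = (if card M = k then b M * fps_nth z 0 else 0)"
  using bz[OF assms(1,2)] by (auto simp: scaled_marks_def mult.assoc fps_X_power_mult_nth)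

text \<open>Order \<open>k\<close> of the equation at \<open>t = - y l\<close>. There
  \<open>d l + t\<close> has no terms below order \<open>k\<close>, so the full product contributes
  \<open>fps_nth (d l) k\<close> times a nonzero constant; marks of size \<open>k\<close> enter with
  constant terms, larger ones not yet.\<close>

lemma first_order_term:
  fixes y :: "nat \<Rightarrow> 'a::field"
  assumes y: "inj_on y {..<n}" and k: "k \<ge> 1" and b0: "b {} = 1"
    and bz: "\<And>M. M \<subseteq> {..<n} \<Longrightarrow> M \<noteq> {} \<Longrightarrow> card M < k \<Longrightarrow> b M = 0"
    and d: "\<And>i. i < n \<Longrightarrow> fps_X ^ k dvd d i - fps_const (y i)"
    and sol: "poly (marked_poly n (scaled_marks b) d) (fps_const (- y l)) =
      poly (marked_poly n (scaled_marks b) (\<lambda>_. 0)) (fps_const (- y l)) - fps_const (- y l) ^ n"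
    and l: "l < n"
  shows "fps_nth (d l) k =
    (\<Sum>M | M \<subseteq> {..<n} \<and> card M = k. b M) * (- y l) ^ (n - k) / (\<Prod>i\<in>{..<n} - {l}. y i - y l) -
    (\<Sum>M | M \<subseteq> {..<n} \<and> card M = k \<and> l \<in> M. b M / (\<Prod>j\<in>M - {l}. y j - y l))"
proof -
  let ?I = "{..<n}" and ?t = "fps_const (- y l)"
  let ?K = "{M. M \<subseteq> ?I \<and> card M = k}"
  define p where "p = (\<Prod>i\<in>?I - {l}. y i - y l)"
  have p: "p \<noteq> 0" using y l by (auto simp: p_def inj_on_def)
  have dn: "fps_nth (d i) j = (if j = 0 then y i else 0)" if "i < n" "j < k" for i j
    using d[OF that(1)] that(2) unfolding fps_X_power_dvd_iff by (auto split: if_splits)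
  have dn0: "fps_nth (d i) 0 = y i" if "i < n" for i using dn[OF that, of 0] k by simp
  have KP: "?K = {M \<in> Pow ?I - {{}}. card M = k}" using k by auto
  have finK: "finite (Pow ?I - {{}})" by simp
  have lead: "fps_nth (\<Prod>i<n. d i + ?t) k = fps_nth (d l) k * p"
  proof -
    have "(\<Prod>i<n. d i + ?t) = (d l + ?t) * (\<Prod>i\<in>?I - {l}. d i + ?t)"
      using l by (subst prod.remove[of _ l]) auto
    moreover have "fps_nth (d l + ?t) j = 0" if "j < k" for j using dn[OF l that] by simp
    ultimately have "fps_nth (\<Prod>i<n. d i + ?t) k = fps_nth (d l + ?t) k * fps_nth (\<Prod>i\<in>?I - {l}. d i + ?t) 0"
      using fps_mult_nth_lowest by metis
    also have "fps_nth (\<Prod>i\<in>?I - {l}. d i + ?t) 0 = p"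
      unfolding fps_prod_nth_0 p_def by (intro prod.cong) (auto simp: dn0)
    finally show ?thesis using k by simp
  qed
  have zero0: "(\<Prod>i\<in>?I - M. 0 + ?t) = fps_const ((- y l) ^ (n - card M))" if "M \<subseteq> ?I" for M
    using that by (simp add: card_Diff_subset finite_subset fps_const_power[symmetric] del: fps_const_power)
  have sum_nth: "(\<Sum>M\<in>Pow ?I - {{}}. fps_nth (scaled_marks b M * z M) k) =
      (\<Sum>M\<in>Pow ?I - {{}}. if card M = k then b M * fps_nth (z M) 0 else 0)" for z
  proof (intro sum.cong refl)
    fix M assume "M \<in> Pow ?I - {{}}"
    then have "M \<subseteq> ?I" "M \<noteq> {}" by auto
    then show "fps_nth (scaled_marks b M * z M) k = (if card M = k then b M * fps_nth (z M) 0 else 0)"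
      by (rule fps_nth_scaled_marks_mult) (rule bz)
  qed
  have "(\<Prod>i<n. d i + ?t) + (\<Sum>M\<in>Pow ?I - {{}}. scaled_marks b M * (\<Prod>i\<in>?I - M. d i + ?t)) =
      (\<Sum>M\<in>Pow ?I - {{}}. scaled_marks b M * (\<Prod>i\<in>?I - M. 0 + ?t))"
    using sol unfolding poly_marked_poly_remove by (simp add: scaled_marks_def b0)
  then have "fps_nth ((\<Prod>i<n. d i + ?t) + (\<Sum>M\<in>Pow ?I - {{}}. scaled_marks b M * (\<Prod>i\<in>?I - M. d i + ?t))) k =
      fps_nth (\<Sum>M\<in>Pow ?I - {{}}. scaled_marks b M * (\<Prod>i\<in>?I - M. 0 + ?t)) k" by (rule arg_cong)
  then have "fps_nth (d l) k * p + (\<Sum>M\<in>Pow ?I - {{}}. if card M = k then b M * fps_nth (\<Prod>i\<in>?I - M. d i + ?t) 0 else 0) =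
      (\<Sum>M\<in>Pow ?I - {{}}. if card M = k then b M * fps_nth (\<Prod>i\<in>?I - M. 0 + ?t) 0 else 0)"
    unfolding fps_add_nth lead fps_sum_nth sum_nth .
  also have "(\<Sum>M\<in>Pow ?I - {{}}. if card M = k then b M * fps_nth (\<Prod>i\<in>?I - M. d i + ?t) 0 else 0) =
      (\<Sum>M\<in>?K. b M * (\<Prod>i\<in>?I - M. y i - y l))"
    unfolding KP sum.inter_filter[OF finK] fps_prod_nth_0
    by (intro sum.cong refl if_cong arg_cong2[where f = "(*)"] prod.cong) (auto simp: dn0)
  also have "(\<Sum>M\<in>Pow ?I - {{}}. if card M = k then b M * fps_nth (\<Prod>i\<in>?I - M. 0 + ?t) 0 else 0) =
      (\<Sum>M\<in>?K. b M) * (- y l) ^ (n - k)"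
    unfolding KP sum.inter_filter[OF finK] sum_distrib_right
  proof (intro sum.cong refl)
    fix M assume "M \<in> Pow ?I - {{}}"
    then have "fps_nth (\<Prod>i\<in>?I - M. 0 + ?t) 0 = (- y l) ^ (n - card M)"
      by (subst zero0) auto
    then show "(if card M = k then b M * fps_nth (\<Prod>i\<in>?I - M. 0 + ?t) 0 else 0) =
        (if card M = k then b M else 0) * (- y l) ^ (n - k)"
      by (cases "card M = k") (simp_all only: if_True if_False simp_thms mult_zero_left)
  qed
  finally have eq: "fps_nth (d l) k * p + (\<Sum>M\<in>?K. b M * (\<Prod>i\<in>?I - M. y i - y l)) = (\<Sum>M\<in>?K. b M) * (- y l) ^ (n - k)" .
  \<comment> \<open>Sets without \<open>l\<close> drop out through the factor
    \<open>y l - y l\<close>; for the others division by \<open>p\<close> leaves the factors over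
    \<open>M - {l}\<close> in the denominator.\<close>
  have "(\<Sum>M\<in>?K. b M * (\<Prod>i\<in>?I - M. y i - y l)) / p =
      (\<Sum>M | M \<subseteq> ?I \<and> card M = k \<and> l \<in> M. b M / (\<Prod>j\<in>M - {l}. y j - y l))"
  proof -
    have fK: "finite ?K" unfolding KP using finK by simp
    have "(\<Sum>M\<in>?K. b M * (\<Prod>i\<in>?I - M. y i - y l)) / p =
        (\<Sum>M\<in>?K. if l \<in> M then b M / (\<Prod>j\<in>M - {l}. y j - y l) else 0)"
      unfolding sum_divide_distrib
    proof (intro sum.cong refl)
      fix M assume M: "M \<in> ?K"
      then have fM: "finite M" using finite_subset by auto
      show "b M * (\<Prod>i\<in>?I - M. y i - y l) / p = (if l \<in> M then b M / (\<Prod>j\<in>M - {l}. y j - y l) else 0)"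
      proof (cases "l \<in> M")
        case True
        then have "?I - {l} = (?I - M) \<union> (M - {l})" using M by auto
        then have "p = (\<Prod>i\<in>?I - M. y i - y l) * (\<Prod>j\<in>M - {l}. y j - y l)"
          unfolding p_def using fM by (simp, subst prod.union_disjoint) auto
        then show ?thesis using p True by simp
      next
        case False
        then have "(\<Prod>i\<in>?I - M. y i - y l) = 0" using l by (intro prod_zero) auto
        then show ?thesis using False by simp
      qed
    qed
    also have "\<dots> = (\<Sum>M | M \<subseteq> ?I \<and> card M = k \<and> l \<in> M. b M / (\<Prod>j\<in>M - {l}. y j - y l))"
      unfolding sum.inter_filter[OF fK, symmetric] by (rule sum.cong) auto
    finally show ?thesis .
  qed
  moreover have "fps_nth (d l) k = ((\<Sum>M\<in>?K. b M) * (- y l) ^ (n - k)) / p - (\<Sum>M\<in>?K. b M * (\<Prod>i\<in>?I - M. y i - y l)) / p"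
    using eq p by (simp add: field_simps)
  ultimately show ?thesis unfolding p_def by simp
qed

lemma trace_of_product_injective:
  fixes y :: "nat \<Rightarrow> 'a::field" and d :: "(nat \<Rightarrow> nat) \<Rightarrow> nat \<Rightarrow> 'a fps"
  assumes y: "inj_on y {..<n}" and k: "k \<ge> 1" and b0: "b {} = 1"
    and bz: "\<And>M. M \<subseteq> {..<n} \<Longrightarrow> M \<noteq> {} \<Longrightarrow> card M < k \<Longrightarrow> b M = 0"
    and nz: "\<And>m. 1 \<le> m \<Longrightarrow> m \<le> n \<Longrightarrow> of_nat m \<noteq> (0::'a)"
    and d: "\<And>\<sigma> i. \<sigma> permutes {..<n} \<Longrightarrow> i < n \<Longrightarrow> fps_X ^ k dvd d \<sigma> i - fps_const (y (\<sigma> i))"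
    and sol: "\<And>\<sigma> l. \<sigma> permutes {..<n} \<Longrightarrow> l < n \<Longrightarrow>
      poly (marked_poly n (scaled_marks b) (d \<sigma>)) (fps_const (- y (\<sigma> l))) =
      poly (marked_poly n (scaled_marks b) (\<lambda>_. 0)) (fps_const (- y (\<sigma> l))) - fps_const (- y (\<sigma> l)) ^ n"
    and L: "L \<subseteq> {..<n}" "card L = k" "L' \<subseteq> {..<n}" "card L' = k"
    and eq: "(\<Sum>\<sigma> | \<sigma> permutes {..<n}. fps_nth (\<Prod>i\<in>L. d \<sigma> i) k) = (\<Sum>\<sigma> | \<sigma> permutes {..<n}. fps_nth (\<Prod>i\<in>L'. d \<sigma> i) k)"
  shows "b L = b L'"
proof -
  let ?I = "{..<n}"
  let ?K = "{M. M \<subseteq> ?I \<and> card M = k}"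
  define \<beta> where "\<beta> = (\<Sum>M\<in>?K. b M)"
  define C where "C L \<sigma> = (\<Sum>l\<in>L. (- y (\<sigma> l)) ^ (n - k) / (\<Prod>i\<in>?I - {l}. y (\<sigma> i) - y (\<sigma> l)) * (\<Prod>j\<in>L - {l}. y (\<sigma> j)))"
    for L \<sigma>
  have finK: "finite ?K" by simp
  have trace: "(\<Sum>\<sigma> | \<sigma> permutes ?I. fps_nth (\<Prod>i\<in>L. d \<sigma> i) k) =
      \<beta> * (\<Sum>\<sigma> | \<sigma> permutes ?I. C L \<sigma>) - of_nat (fact n) * b L" if L: "L \<subseteq> ?I" "card L = k" for L
  proof -
    have fin: "finite L" using L finite_subset by blast
    have "fps_nth (\<Prod>i\<in>L. d \<sigma> i) k = \<beta> * C L \<sigma> -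
        (\<Sum>M\<in>?K. b M * (\<Sum>l\<in>L \<inter> M. (\<Prod>j\<in>L - {l}. y (\<sigma> j)) / (\<Prod>j\<in>M - {l}. y (\<sigma> j) - y (\<sigma> l))))"
      if \<sigma>: "\<sigma> permutes ?I" for \<sigma>
    proof -
      have inj: "inj_on (\<lambda>i. y (\<sigma> i)) ?I"
        using comp_inj_on[of \<sigma> ?I y] y \<sigma> by (simp add: permutes_image permutes_inj_on comp_def)
      have dn: "fps_nth (d \<sigma> i) j = (if j = 0 then y (\<sigma> i) else 0)" if "i < n" "j < k" for i j
        using d[OF \<sigma> that(1)] that(2) unfolding fps_X_power_dvd_iff by (auto split: if_splits)
      have "fps_nth (\<Prod>i\<in>L. d \<sigma> i) k = (\<Sum>l\<in>L. fps_nth (d \<sigma> l) k * (\<Prod>j\<in>L - {l}. y (\<sigma> j)))"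
        using fin k by (intro fps_prod_nth_first_order) (use L dn k in auto)
      also have "\<dots> = (\<Sum>l\<in>L. (\<beta> * (- y (\<sigma> l)) ^ (n - k) / (\<Prod>i\<in>?I - {l}. y (\<sigma> i) - y (\<sigma> l)) -
          (\<Sum>M | M \<subseteq> ?I \<and> card M = k \<and> l \<in> M. b M / (\<Prod>j\<in>M - {l}. y (\<sigma> j) - y (\<sigma> l)))) * (\<Prod>j\<in>L - {l}. y (\<sigma> j)))"
      proof (intro sum.cong refl arg_cong2[where f = "(*)"])
        fix l assume "l \<in> L"
        then have l: "l < n" using L by auto
        show "fps_nth (d \<sigma> l) k = \<beta> * (- y (\<sigma> l)) ^ (n - k) / (\<Prod>i\<in>?I - {l}. y (\<sigma> i) - y (\<sigma> l)) -
          (\<Sum>M | M \<subseteq> ?I \<and> card M = k \<and> l \<in> M. b M / (\<Prod>j\<in>M - {l}. y (\<sigma> j) - y (\<sigma> l)))"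
          unfolding \<beta>_def by (rule first_order_term[OF inj k b0 bz d[OF \<sigma>] sol[OF \<sigma> l] l])
      qed
      also have "\<dots> = \<beta> * C L \<sigma> - (\<Sum>l\<in>L. \<Sum>M | M \<in> ?K \<and> l \<in> M.
          b M * ((\<Prod>j\<in>L - {l}. y (\<sigma> j)) / (\<Prod>j\<in>M - {l}. y (\<sigma> j) - y (\<sigma> l))))"
        unfolding C_def left_diff_distrib sum_subtractf sum_distrib_left sum_distrib_right
        by (simp add: conj_assoc mult_ac)
      also have "(\<Sum>l\<in>L. \<Sum>M | M \<in> ?K \<and> l \<in> M.
          b M * ((\<Prod>j\<in>L - {l}. y (\<sigma> j)) / (\<Prod>j\<in>M - {l}. y (\<sigma> j) - y (\<sigma> l)))) =
        (\<Sum>M\<in>?K. \<Sum>l | l \<in> L \<and> l \<in> M. b M * ((\<Prod>j\<in>L - {l}. y (\<sigma> j)) / (\<Prod>j\<in>M - {l}. y (\<sigma> j) - y (\<sigma> l))))"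
        by (rule sum.swap_restrict[OF fin finK])
      finally show ?thesis by (simp only: sum_distrib_left Int_def)
    qed
    then have "(\<Sum>\<sigma> | \<sigma> permutes ?I. fps_nth (\<Prod>i\<in>L. d \<sigma> i) k) = \<beta> * (\<Sum>\<sigma> | \<sigma> permutes ?I. C L \<sigma>) -
        (\<Sum>\<sigma> | \<sigma> permutes ?I. \<Sum>M\<in>?K. b M * (\<Sum>l\<in>L \<inter> M. (\<Prod>j\<in>L - {l}. y (\<sigma> j)) / (\<Prod>j\<in>M - {l}. y (\<sigma> j) - y (\<sigma> l))))"
      by (simp add: sum_subtractf sum_distrib_left)
    also have "(\<Sum>\<sigma> | \<sigma> permutes ?I. \<Sum>M\<in>?K. b M * (\<Sum>l\<in>L \<inter> M. (\<Prod>j\<in>L - {l}. y (\<sigma> j)) / (\<Prod>j\<in>M - {l}. y (\<sigma> j) - y (\<sigma> l)))) =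
        (\<Sum>M\<in>?K. b M * (\<Sum>\<sigma> | \<sigma> permutes ?I. \<Sum>l\<in>L \<inter> M. (\<Prod>j\<in>L - {l}. y (\<sigma> j)) / (\<Prod>j\<in>M - {l}. y (\<sigma> j) - y (\<sigma> l))))"
      unfolding sum_distrib_left by (rule sum.swap)
    also have "\<dots> = (\<Sum>M\<in>?K. b M * (if M = L then of_nat (fact n) else 0))"
    proof (intro sum.cong refl arg_cong2[where f = "(*)"])
      fix M assume M: "M \<in> ?K"
      have "(\<Sum>\<sigma> | \<sigma> permutes ?I. \<Sum>l\<in>L \<inter> M. (\<Prod>j\<in>L - {l}. y (\<sigma> j)) / (\<Prod>j\<in>M - {l}. y (\<sigma> j) - y (\<sigma> l))) =
          (if M = L then of_nat (fact (card ?I)) else 0)"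
        by (rule symmetrised_partial_fractions) (use y nz L M k in auto)
      then show "(\<Sum>\<sigma> | \<sigma> permutes ?I. \<Sum>l\<in>L \<inter> M. (\<Prod>j\<in>L - {l}. y (\<sigma> j)) / (\<Prod>j\<in>M - {l}. y (\<sigma> j) - y (\<sigma> l))) =
          (if M = L then of_nat (fact n) else 0)" by simp
    qed
    also have "\<dots> = (\<Sum>M\<in>?K. if M = L then of_nat (fact n) * b L else 0)"
      by (intro sum.cong refl) (auto simp: mult.commute)
    also have "\<dots> = of_nat (fact n) * b L" using finK L by simp
    finally show ?thesis .
  qed
  \<comment> \<open>\<open>C\<close> carries no marks, so relabelling by a permutation that takes
    \<open>L\<close> to \<open>L'\<close> shows that its total depends on the size alone.\<close>
  have "(\<Sum>\<sigma> | \<sigma> permutes ?I. C L \<sigma>) = (\<Sum>\<sigma> | \<sigma> permutes ?I. C L' \<sigma>)"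
  proof -
    obtain \<pi> where \<pi>: "\<pi> permutes ?I" "\<pi> ` L = L'" using permutes_mapping_subset[of ?I L L'] L by auto
    have inj: "inj_on \<pi> A" for A using \<pi> by (simp add: permutes_inj_on)
    have "C L (\<sigma> \<circ> \<pi>) = C L' \<sigma>" for \<sigma>
    proof -
      have im: "(\<Prod>j\<in>A - {l}. f (\<pi> j)) = (\<Prod>j\<in>\<pi> ` A - {\<pi> l}. f j)" if "l \<in> A" for A l and f :: "nat \<Rightarrow> 'a"
      proof -
        have "\<pi> ` A - {\<pi> l} = \<pi> ` (A - {l})" using that inj[of A] by (auto simp: inj_on_def)
        then show ?thesis using prod.reindex[OF inj, of f "A - {l}"] by simp
      qed
      have "C L' \<sigma> = (\<Sum>l\<in>L. (- y (\<sigma> (\<pi> l))) ^ (n - k) / (\<Prod>i\<in>?I - {\<pi> l}. y (\<sigma> i) - y (\<sigma> (\<pi> l))) * (\<Prod>j\<in>L' - {\<pi> l}. y (\<sigma> j)))"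
        unfolding C_def \<pi>(2)[symmetric] by (simp add: sum.reindex[OF inj])
      also have "\<dots> = C L (\<sigma> \<circ> \<pi>)"
        unfolding C_def comp_def
      proof (intro sum.cong refl)
        fix l assume l: "l \<in> L"
        then have "l \<in> ?I" using L by auto
        then show "(- y (\<sigma> (\<pi> l))) ^ (n - k) / (\<Prod>i\<in>?I - {\<pi> l}. y (\<sigma> i) - y (\<sigma> (\<pi> l))) * (\<Prod>j\<in>L' - {\<pi> l}. y (\<sigma> j)) =
          (- y (\<sigma> (\<pi> l))) ^ (n - k) / (\<Prod>i\<in>?I - {l}. y (\<sigma> (\<pi> i)) - y (\<sigma> (\<pi> l))) * (\<Prod>j\<in>L - {l}. y (\<sigma> (\<pi> j)))"
          using im[of l ?I "\<lambda>i. y (\<sigma> i) - y (\<sigma> (\<pi> l))"] im[OF l, of "\<lambda>i. y (\<sigma> i)"] \<pi>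
          by (simp add: permutes_image)
      qed
      finally show ?thesis by simp
    qed
    then show ?thesis using sum_permutations_compose_right[OF \<pi>(1), of "C L"] by simp
  qed
  then have "of_nat (fact n) * b L = of_nat (fact n) * b L'"
    using eq trace[OF L(1,2)] trace[OF L(3,4)] by simp
  moreover have "of_nat (fact n) \<noteq> (0::'a)"
    unfolding fact_prod of_nat_prod using nz by auto
  ultimately show ?thesis by simp
qed

section \<open>Existence of a nonzero solution\<close>

lemma (in comm_ring_hom) map_poly_marked_poly:
  "map_poly hom (marked_poly n c x) = marked_poly n (\<lambda>M. hom (c M)) (\<lambda>i. hom (x i))"
proof (rule poly_eqI)
  fix m
  have esym: "hom (esym J r x) = esym J r (\<lambda>i. hom (x i))" for J r
    by (simp add: esym_def hom_sum hom_prod)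
  show "coeff (map_poly hom (marked_poly n c x)) m = coeff (marked_poly n (\<lambda>M. hom (c M)) (\<lambda>i. hom (x i))) m"
    unfolding coeff_marked_poly
    by (simp add: coeff_map_poly coeff_marked_poly hom_sum hom_mult esym if_distrib[of hom] cong: if_cong)
qed

text \<open>Weighted homogeneity: with \<open>x i\<close> of degree 1 and the mark at
  \<open>M\<close> of degree \<open>card M\<close>, the coefficient at exponent \<open>m\<close> has
  degree \<open>n - m\<close>.\<close>

lemma coeff_marked_poly_scale:
  "coeff (marked_poly n (\<lambda>M. u ^ card M * b M) (\<lambda>i. u * x i)) m = u ^ (n - m) * coeff (marked_poly n b x) m"
proof -
  have esym: "esym J r (\<lambda>i. u * x i) = u ^ r * esym J r x" for J r
    unfolding esym_def sum_distrib_left by (intro sum.cong refl) (auto simp: prod.distrib)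
  show ?thesis
    unfolding coeff_marked_poly sum_distrib_left
  proof (intro sum.cong refl)
    fix M
    show "u ^ card M * b M * (if m + card M \<le> n then esym ({..<n} - M) (n - card M - m) (\<lambda>i. u * x i) else 0) =
        u ^ (n - m) * (b M * (if m + card M \<le> n then esym ({..<n} - M) (n - card M - m) x else 0))"
    proof (cases "m + card M \<le> n")
      case True
      then have "n - m = card M + (n - card M - m)" by simp
      then have "u ^ (n - m) = u ^ card M * u ^ (n - card M - m)" by (metis power_add)
      then show ?thesis using True by (simp add: esym mult_ac)
    qed simp
  qed
qed

definition empty_mark :: "nat set \<Rightarrow> 'a::comm_ring_1" where
  "empty_mark M = (if M = {} then 1 else 0)"

lemma marked_poly_empty_mark: "marked_poly n empty_mark x = (\<Prod>i<n. [:x i, 1:])"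
proof -
  have "marked_poly n empty_mark x = (\<Sum>M\<in>Pow {..<n}. if M = {} then (\<Prod>i\<in>{..<n} - M. [:x i, 1:]) else 0)"
    unfolding marked_poly_def by (intro sum.cong refl) (auto simp: empty_mark_def)
  then show ?thesis by simp
qed

lemma marked_poly_empty_mark_0: "marked_poly n empty_mark (\<lambda>_. 0) = monom 1 n"
  unfolding marked_poly_empty_mark by (simp add: monom_altdef)

text \<open>Substitution of \<open>1/X\<close> for the deformation parameter. The image has only
  nonpositive exponents, and its coefficient at 0 is the value of the polynomial at 0.\<close>

definition inv_X_poly :: "'a::field poly \<Rightarrow> 'a fls" where
  "inv_X_poly p = poly (map_poly fls_const p) fls_X_inv"

lemma comm_ring_hom_fls_const: "comm_ring_hom (fls_const :: 'a::field \<Rightarrow> 'a fls)"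
  by unfold_locales (simp_all add: fls_plus_const)

lemma comm_ring_hom_inv_X_poly: "comm_ring_hom (inv_X_poly :: 'a::field poly \<Rightarrow> 'a fls)"
proof -
  interpret F: comm_ring_hom "fls_const :: 'a \<Rightarrow> 'a fls" by (rule comm_ring_hom_fls_const)
  interpret FP: map_poly_comm_ring_hom "fls_const :: 'a \<Rightarrow> 'a fls" ..
  show ?thesis
    by unfold_locales (simp_all add: inv_X_poly_def FP.hom_add FP.hom_mult)
qed

lemma fls_nth_inv_X_poly: "fls_nth (inv_X_poly p) k = (if k \<le> 0 then coeff p (nat (- k)) else 0)"
proof (induction p arbitrary: k)
  case 0
  then show ?case by (simp add: inv_X_poly_def)
next
  case (pCons a p)
  have "inv_X_poly (pCons a p) = fls_const a + fls_X_inv * inv_X_poly p"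
    using pCons.hyps by (simp add: inv_X_poly_def map_poly_pCons)
  then have *: "fls_nth (inv_X_poly (pCons a p)) k = (if k = 0 then a else 0) + fls_nth (inv_X_poly p) (k + 1)"
    by (simp add: fls_X_inv_times_conv_shift)
  consider "k > 0" | "k = 0" | "k < 0" by linarith
  then show ?case
  proof cases
    case 1
    then show ?thesis unfolding * by (simp add: pCons.IH)
  next
    case 2
    then show ?thesis unfolding * by (simp add: pCons.IH)
  next
    case 3
    then have "nat (- k) = Suc (nat (- (k + 1)))" by simp
    then show ?thesis using 3 unfolding * by (simp add: pCons.IH)
  qed
qed

lemma inj_inv_X_poly: "inj inv_X_poly"
proof (rule injI, rule poly_eqI)
  fix p q :: "'a poly" and j
  assume "inv_X_poly p = inv_X_poly q"
  then have "fls_nth (inv_X_poly p) (- int j) = fls_nth (inv_X_poly q) (- int j)" by simp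
  then show "coeff p j = coeff q j" by (simp add: fls_nth_inv_X_poly)
qed

text \<open>Over a finite field the product of all \<open>a + t\<close>, increased by 1, has no
  root. Infinity supplies the distinct scalars \<open>y i\<close>.\<close>

lemma infinite_alg_closed_field: "infinite (UNIV :: 'a::alg_closed_field set)"
proof
  assume fin: "finite (UNIV :: 'a set)"
  let ?p = "(\<Prod>a\<in>UNIV. [:a, 1 :: 'a:]) + 1"
  have "degree (\<Prod>a\<in>UNIV. [:a, 1 :: 'a:]) = card (UNIV :: 'a set)" by (rule degree_prod_linear[OF fin])
  moreover have "card (UNIV :: 'a set) > 0" using fin by (simp add: card_gt_0_iff)
  ultimately have "degree ?p > 0" by (subst degree_add_eq_left) simp_all
  then obtain x where "poly ?p x = 0" using alg_closed_imp_poly_has_root by blast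
  moreover have "(\<Prod>a\<in>UNIV. a + x) = 0" using fin by (intro prod_zero bexI[of _ "- x"]) simp_all
  ultimately show False by (simp add: poly_prod)
qed

text \<open>Solving at the \<open>n\<close> points \<open>- y l\<close> is enough: both sides have
  degree at most \<open>n\<close> and the same coefficient there, and the product of the
  \<open>t + y i\<close> vanishes at these points.\<close>

lemma marked_poly_solution_identity:
  fixes y :: "nat \<Rightarrow> 'a::field"
  assumes y: "inj_on y {..<n}" and c0: "c {} = (1 :: 'a fps)"
    and sol: "\<And>l. l < n \<Longrightarrow> poly (marked_poly n c d) (fps_const (- y l)) =
      poly (marked_poly n c (\<lambda>_. 0)) (fps_const (- y l)) - fps_const (- y l) ^ n"
  shows "marked_poly n c d = marked_poly n empty_mark (\<lambda>i. fps_const (y i)) + marked_poly n c (\<lambda>_. 0) - monom 1 n"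
    (is "?p = ?q")
proof (rule poly_eqI_degree_lead_coeff[where A = "(\<lambda>i. fps_const (- y i)) ` {..<n}" and n = n])
  show "coeff ?p n = coeff ?q n" by (simp add: coeff_marked_poly_top c0 empty_mark_def)
  have "card ((\<lambda>i. fps_const (- y i)) ` {..<n}) = card {..<n}"
    using y by (intro card_image) (auto simp: inj_on_def)
  then show "n \<le> card ((\<lambda>i. fps_const (- y i)) ` {..<n})" by simp
  show "degree ?p \<le> n" by (rule degree_marked_poly_le)
  show "degree ?q \<le> n"
    by (intro degree_diff_le degree_add_le degree_marked_poly_le) (simp add: degree_monom_eq)
next
  fix t assume "t \<in> (\<lambda>i. fps_const (- y i)) ` {..<n}"
  then obtain l where l: "l < n" "t = fps_const (- y l)" by auto
  have "(\<Prod>i<n. fps_const (y i) + fps_const (- y l)) = 0"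
    using l by (intro prod_zero bexI[of _ l]) simp_all
  then have "poly (marked_poly n empty_mark (\<lambda>i. fps_const (y i))) t = 0"
    using l by (simp add: marked_poly_empty_mark poly_prod)
  then show "poly ?p t = poly ?q t" using sol[OF l(1)] l by (simp add: poly_monom)
qed

text \<open>The constants \<open>y i\<close> already solve the system modulo
  \<open>fps_X ^ k\<close>, since every nonempty scaled mark is divisible by
  \<open>fps_X ^ k\<close>.\<close>

lemma perturbed_solution:
  fixes y :: "nat \<Rightarrow> 'a::field"
  assumes y: "inj_on y {..<n}" and k: "k \<ge> 1" and b0: "b {} = 1"
    and bz: "\<And>M. M \<subseteq> {..<n} \<Longrightarrow> M \<noteq> {} \<Longrightarrow> card M < k \<Longrightarrow> b M = 0"
  obtains d where "\<And>i. i < n \<Longrightarrow> fps_X ^ k dvd d i - fps_const (y i)"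
    "\<And>l. l < n \<Longrightarrow> poly (marked_poly n (scaled_marks b) d) (fps_const (- y l)) =
      poly (marked_poly n (scaled_marks b) (\<lambda>_. 0)) (fps_const (- y l)) - fps_const (- y l) ^ n"
proof (rule hensel_solution[OF y, where c = "scaled_marks b" and k = k
    and r = "\<lambda>l. poly (marked_poly n (scaled_marks b) (\<lambda>_. 0)) (fps_const (- y l)) - fps_const (- y l) ^ n"])
  show c0: "scaled_marks b {} = 1" using b0 by (simp add: scaled_marks_def)
  have X: "fps_X ^ k dvd scaled_marks b M" if "M \<subseteq> {..<n}" "M \<noteq> {}" for M
    using bz[OF that] by (cases "card M < k") (auto simp: scaled_marks_def intro!: dvd_mult2 le_imp_power_dvd)
  have "fps_X dvd (fps_X ^ k :: 'a fps)" using k by (simp add: dvd_power)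
  then show "fps_X dvd scaled_marks b M" if "M \<subseteq> {..<n}" "M \<noteq> {}" for M
    using X[OF that] dvd_trans by blast
  fix l assume l: "l < n"
  have "(\<Prod>i<n. fps_const (y i) + fps_const (- y l)) = 0"
    using l by (intro prod_zero bexI[of _ l]) simp_all
  then have "poly (marked_poly n (scaled_marks b) (\<lambda>i. fps_const (y i))) (fps_const (- y l)) -
      (poly (marked_poly n (scaled_marks b) (\<lambda>_. 0)) (fps_const (- y l)) - fps_const (- y l) ^ n) =
    (\<Sum>M\<in>Pow {..<n} - {{}}. scaled_marks b M * (\<Prod>i\<in>{..<n} - M. fps_const (y i) + fps_const (- y l))) -
    (\<Sum>M\<in>Pow {..<n} - {{}}. scaled_marks b M * (\<Prod>i\<in>{..<n} - M. 0 + fps_const (- y l)))"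
    unfolding poly_marked_poly_remove c0 by simp
  moreover have "fps_X ^ k dvd \<dots>"
    using X by (intro dvd_diff dvd_sum dvd_mult2) auto
  ultimately show "fps_X ^ k dvd poly (marked_poly n (scaled_marks b) (\<lambda>i. fps_const (y i))) (fps_const (- y l)) -
      (poly (marked_poly n (scaled_marks b) (\<lambda>_. 0)) (fps_const (- y l)) - fps_const (- y l) ^ n)" by metis
qed (rule k, rule that, blast+)

lemma nonsymmetric_imp_nonzero_solution:
  fixes b :: "nat set \<Rightarrow> 'a::alg_closed_field"
  assumes k: "k \<ge> 1" and b0: "b {} = 1"
    and bz: "\<And>M. M \<subseteq> {..<n} \<Longrightarrow> M \<noteq> {} \<Longrightarrow> card M < k \<Longrightarrow> b M = 0"
    and nz: "\<And>m. 1 \<le> m \<Longrightarrow> m \<le> n \<Longrightarrow> of_nat m \<noteq> (0::'a)"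
    and L: "L \<subseteq> {..<n}" "card L = k" "L' \<subseteq> {..<n}" "card L' = k" and ne: "b L \<noteq> b L'"
  obtains d i where "marked_poly n b d = marked_poly n b (\<lambda>_. 0)" "i < n" "d i \<noteq> 0"
proof -
  let ?I = "{..<n}"
  obtain y :: "nat \<Rightarrow> 'a" where "inj y"
    using infinite_countable_subset[OF infinite_alg_closed_field] by blast
  then have y: "inj_on y ?I" by (rule inj_on_subset) simp
  \<comment> \<open>\<open>specialise_solutions\<close> asks for the relation at every index, so
    functions that are not permutations are assigned the identity.\<close>
  define \<tau> where "\<tau> \<sigma> = (if \<sigma> permutes ?I then \<sigma> else id)" for \<sigma>
  have \<tau>: "\<tau> \<sigma> permutes ?I" for \<sigma> by (simp add: \<tau>_def permutes_id)
  have y\<tau>: "inj_on (\<lambda>i. y (\<tau> \<sigma> i)) ?I" for \<sigma>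
  proof -
    have "inj_on (y \<circ> \<tau> \<sigma>) ?I"
      using y permutes_inj_on[OF \<tau>] permutes_image[OF \<tau>] by (intro comp_inj_on) auto
    then show ?thesis by (simp add: comp_def)
  qed
  let ?c = "scaled_marks b"
  have c0: "?c {} = 1" using b0 by (simp add: scaled_marks_def)
  have "\<exists>d. (\<forall>i<n. fps_X ^ k dvd d i - fps_const (y (\<tau> \<sigma> i))) \<and>
      (\<forall>l<n. poly (marked_poly n ?c d) (fps_const (- y (\<tau> \<sigma> l))) =
        poly (marked_poly n ?c (\<lambda>_. 0)) (fps_const (- y (\<tau> \<sigma> l))) - fps_const (- y (\<tau> \<sigma> l)) ^ n)" for \<sigma>
    using perturbed_solution[where n = n and y = "\<lambda>i. y (\<tau> \<sigma> i)" and b = b and k = k, OF y\<tau> k b0 bz] by metis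
  then obtain d where d: "\<And>\<sigma> i. i < n \<Longrightarrow> fps_X ^ k dvd d \<sigma> i - fps_const (y (\<tau> \<sigma> i))"
    and sol: "\<And>\<sigma> l. l < n \<Longrightarrow> poly (marked_poly n ?c (d \<sigma>)) (fps_const (- y (\<tau> \<sigma> l))) =
        poly (marked_poly n ?c (\<lambda>_. 0)) (fps_const (- y (\<tau> \<sigma> l))) - fps_const (- y (\<tau> \<sigma> l)) ^ n"
    by metis
  \<comment> \<open>The right-hand side does not depend on \<sigma>: all the power series solutions
    belong to one system.\<close>
  have ident: "marked_poly n ?c (d \<sigma>) =
      marked_poly n empty_mark (\<lambda>i. fps_const (y i)) + marked_poly n ?c (\<lambda>_. 0) - monom 1 n" for \<sigma>
  proof -
    have "(\<Prod>i<n. [:fps_const (y (\<tau> \<sigma> i)), 1:]) = (\<Prod>i<n. [:fps_const (y i), 1:])"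
      using prod.permute[OF \<tau>[of \<sigma>], of "\<lambda>i. [:fps_const (y i), 1:]"] by (simp add: comp_def)
    then show ?thesis
      using marked_poly_solution_identity[OF y\<tau> c0 sol] by (simp add: marked_poly_empty_mark)
  qed
  define x where "x \<sigma> i = fls_X_inv * fps_to_fls (d \<sigma> i)" for \<sigma> i
  \<comment> \<open>The deformed right-hand side, with the parameter as the inner polynomial
    variable; \<open>x\<close> above undoes the rescaling of the unknowns.\<close>
  define Q where "Q = marked_poly n empty_mark (\<lambda>i. [:0, y i:]) + marked_poly n (\<lambda>M. [:b M:]) (\<lambda>_. 0) - monom 1 n"
  interpret P: comm_ring_hom "fps_to_fls :: 'a fps \<Rightarrow> 'a fls"
    by unfold_locales (simp_all add: fls_times_fps_to_fls)
  interpret PP: map_poly_comm_ring_hom "fps_to_fls :: 'a fps \<Rightarrow> 'a fls" ..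
  interpret J: comm_ring_hom "inv_X_poly :: 'a poly \<Rightarrow> 'a fls" by (rule comm_ring_hom_inv_X_poly)
  interpret JP: map_poly_comm_ring_hom "inv_X_poly :: 'a poly \<Rightarrow> 'a fls" ..
  have V: "comm_ring_hom (\<lambda>p. poly p 0 :: 'a)" by unfold_locales simp_all
  have Jc: "inv_X_poly [:a:] = fls_const a" "inv_X_poly [:0, a:] = fls_X_inv * fls_const a" for a :: 'a
    by (cases "a = 0"; simp add: inv_X_poly_def map_poly_pCons)+
  have XX: "fls_X * (fls_X_inv * a) = a" for a :: "'a fls"
    by (metis fls_inverse_X fls_X_nonzero mult.assoc mult_1_left right_inverse)
  \<comment> \<open>This is \<open>ident\<close> without the scaling: by weighted homogeneity each
    coefficient carries the common factor \<open>fls_X ^ (n - m)\<close>, which cancels.\<close>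
  have rel: "marked_poly n (\<lambda>M. inv_X_poly [:b M:]) (x \<sigma>) = map_poly inv_X_poly Q" for \<sigma>
  proof (rule poly_eqI)
    fix m
    let ?m = "\<lambda>c z. marked_poly n (\<lambda>M. fls_X ^ card M * c M) (\<lambda>i. fls_X * z i) :: 'a fls poly"
    let ?b = "\<lambda>M. fls_const (b M)"
    have "map_poly fps_to_fls (marked_poly n ?c (d \<sigma>)) = map_poly fps_to_fls
      (marked_poly n empty_mark (\<lambda>i. fps_const (y i)) + marked_poly n ?c (\<lambda>_. 0) - monom 1 n)"
      by (simp only: ident)
    then have "marked_poly n (\<lambda>M. fps_to_fls (?c M)) (\<lambda>i. fps_to_fls (d \<sigma> i)) =
        marked_poly n (\<lambda>M. fps_to_fls (empty_mark M)) (\<lambda>i. fps_to_fls (fps_const (y i))) +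
        marked_poly n (\<lambda>M. fps_to_fls (?c M)) (\<lambda>i. fps_to_fls 0) - monom 1 n"
      by (simp only: PP.hom_add PP.hom_minus P.map_poly_marked_poly map_poly_monom P.hom_zero P.hom_one)
    moreover have "(\<lambda>M. fps_to_fls (?c M)) = (\<lambda>M. fls_X ^ card M * ?b M)"
      by (simp add: scaled_marks_def fls_times_fps_to_fls fps_to_fls_power)
    moreover have "(\<lambda>M. fps_to_fls (empty_mark M)) = (\<lambda>M. fls_X ^ card M * empty_mark M :: 'a fls)"
      by (auto simp: empty_mark_def)
    moreover have "(\<lambda>i. fps_to_fls (d \<sigma> i)) = (\<lambda>i. fls_X * x \<sigma> i)"
      by (simp add: x_def XX)
    moreover have "(\<lambda>i. fps_to_fls (fps_const (y i))) = (\<lambda>i. fls_X * (fls_X_inv * fls_const (y i)))"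
      by (simp add: XX)
    moreover have "(\<lambda>i::nat. fps_to_fls (0 :: 'a fps)) = (\<lambda>i. fls_X * 0)" by simp
    ultimately have "?m ?b (x \<sigma>) = ?m empty_mark (\<lambda>i. fls_X_inv * fls_const (y i)) + ?m ?b (\<lambda>_. 0) - monom 1 n"
      by (simp only:)
    then have "coeff (?m ?b (x \<sigma>)) m =
        coeff (?m empty_mark (\<lambda>i. fls_X_inv * fls_const (y i))) m + coeff (?m ?b (\<lambda>_. 0)) m - coeff (monom 1 n) m"
      by (simp only: coeff_add coeff_diff)
    moreover have "coeff (monom 1 n) m = fls_X ^ (n - m) * coeff (monom (1 :: 'a fls) n) m" by simp
    ultimately have "fls_X ^ (n - m) * coeff (marked_poly n ?b (x \<sigma>)) m =
        fls_X ^ (n - m) * (coeff (marked_poly n empty_mark (\<lambda>i. fls_X_inv * fls_const (y i))) m +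
          coeff (marked_poly n ?b (\<lambda>_. 0)) m - coeff (monom 1 n) m)"
      unfolding coeff_marked_poly_scale by (simp only: distrib_left right_diff_distrib)
    then have "coeff (marked_poly n ?b (x \<sigma>)) m = coeff (marked_poly n empty_mark (\<lambda>i. fls_X_inv * fls_const (y i))) m +
          coeff (marked_poly n ?b (\<lambda>_. 0)) m - coeff (monom 1 n) m"
      by simp
    moreover have "map_poly inv_X_poly Q = marked_poly n empty_mark (\<lambda>i. fls_X_inv * fls_const (y i)) +
        marked_poly n ?b (\<lambda>_. 0) - monom 1 n"
    proof -
      have "(\<lambda>M. inv_X_poly (empty_mark M) :: 'a fls) = empty_mark" by (auto simp: empty_mark_def)
      then show ?thesis
        unfolding Q_def by (simp only: JP.hom_add JP.hom_minus J.map_poly_marked_poly map_poly_monom J.hom_zero J.hom_one Jc)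
    qed
    ultimately show "coeff (marked_poly n (\<lambda>M. inv_X_poly [:b M:]) (x \<sigma>)) m = coeff (map_poly inv_X_poly Q) m"
      by (simp only: Jc coeff_add coeff_diff)
  qed
  have Q0: "map_poly (\<lambda>p. poly p 0) Q = marked_poly n b (\<lambda>_. 0)"
  proof -
    have "(\<lambda>M. poly (empty_mark M) 0 :: 'a) = empty_mark" by (auto simp: empty_mark_def)
    moreover have "poly (coeff (marked_poly n c z) m) 0 =
        coeff (marked_poly n (\<lambda>M. poly (c M) 0) (\<lambda>i. poly (z i) 0)) m" for c :: "nat set \<Rightarrow> 'a poly" and z m
      using arg_cong[OF comm_ring_hom.map_poly_marked_poly[OF V], of "\<lambda>p. coeff p m" n c z]
      by (simp add: coeff_map_poly)
    ultimately show ?thesis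
      unfolding Q_def by (intro poly_eqI) (simp add: coeff_map_poly marked_poly_empty_mark_0)
  qed
  let ?S = "{\<sigma>. \<sigma> permutes ?I}"
  have S: "finite ?S" "card ?S = fact n" by (simp_all add: finite_permutations card_permutations)
  have d0: "fps_nth (d \<sigma> i) 0 = y (\<tau> \<sigma> i)" if "i < n" for \<sigma> i
    using d[OF that, of \<sigma>] k unfolding fps_X_power_dvd_iff by auto
  have sep: "\<exists>i<n. x \<sigma> i \<noteq> x \<rho> i" if "\<sigma> \<in> ?S" "\<rho> \<in> ?S" "\<sigma> \<noteq> \<rho>" for \<sigma> \<rho>
  proof (rule ccontr)
    assume "\<not> ?thesis"
    then have "d \<sigma> i = d \<rho> i" if "i < n" for i using that by (auto simp: x_def)
    then have "y (\<sigma> i) = y (\<rho> i)" if "i < n" for i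
      using that d0[of i \<sigma>] d0[of i \<rho>] \<open>\<sigma> \<in> ?S\<close> \<open>\<rho> \<in> ?S\<close> by (simp add: \<tau>_def)
    then have "\<sigma> i = \<rho> i" if "i < n" for i using that \<open>inj y\<close> by (auto dest: injD)
    moreover have "\<sigma> i = \<rho> i" if "\<not> i < n" for i
      using that \<open>\<sigma> \<in> ?S\<close> \<open>\<rho> \<in> ?S\<close> by (simp add: permutes_def)
    ultimately show False using \<open>\<sigma> \<noteq> \<rho>\<close> by blast
  qed
  have "(\<Sum>\<sigma>\<in>?S. fps_nth (\<Prod>i\<in>L. d \<sigma> i) k) \<noteq> (\<Sum>\<sigma>\<in>?S. fps_nth (\<Prod>i\<in>L'. d \<sigma> i) k)"
  proof
    assume eq: "(\<Sum>\<sigma>\<in>?S. fps_nth (\<Prod>i\<in>L. d \<sigma> i) k) = (\<Sum>\<sigma>\<in>?S. fps_nth (\<Prod>i\<in>L'. d \<sigma> i) k)"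
    have "b L = b L'"
    proof (rule trace_of_product_injective[where b = b and d = d and y = y and L = L and L' = L', OF y k b0 bz nz _ _ L eq])
      fix \<sigma> i assume \<sigma>: "\<sigma> permutes ?I" and i: "i < n"
      then have "\<tau> \<sigma> = \<sigma>" by (simp add: \<tau>_def)
      then show "fps_X ^ k dvd d \<sigma> i - fps_const (y (\<sigma> i))"
        "poly (marked_poly n ?c (d \<sigma>)) (fps_const (- y (\<sigma> i))) =
          poly (marked_poly n ?c (\<lambda>_. 0)) (fps_const (- y (\<sigma> i))) - fps_const (- y (\<sigma> i)) ^ n"
        using d[OF i, of \<sigma>] sol[OF i, of \<sigma>] by simp_all
    qed
    then show False using ne by simp
  qed
  \<comment> \<open>Two different sums are not both 0, so \<open>L\<close> or \<open>L'\<close>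
    serves as \<open>K\<close>.\<close>
  then obtain K where K: "K \<subseteq> ?I" "card K = k" "(\<Sum>\<sigma>\<in>?S. fps_nth (\<Prod>i\<in>K. d \<sigma> i) k) \<noteq> 0"
    using L by metis
  have cb: "[:b {}:] = 1" using b0 by (simp add: one_pCons)
  obtain T where T: "inv_X_poly T = (\<Sum>\<sigma>\<in>?S. \<Prod>i\<in>K. x \<sigma> i)"
    "poly T 0 \<noteq> 0 \<Longrightarrow> \<exists>e. marked_poly n (\<lambda>M. poly [:b M:] 0) e = map_poly (\<lambda>p. poly p 0) Q \<and> (\<Prod>i\<in>K. e i) \<noteq> 0"
  proof (rule specialise_solutions[where c = "\<lambda>M. [:b M:]" and x = x and L = K and Q = Q, OF comm_ring_hom_inv_X_poly inj_inv_X_poly V S])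
    show "\<exists>i<n. x \<sigma> i \<noteq> x \<rho> i" if "\<sigma> \<in> ?S" "\<rho> \<in> ?S" "\<sigma> \<noteq> \<rho>" for \<sigma> \<rho>
      using that by (rule sep)
  qed (rule cb, rule rel, rule K(1), rule that, blast+)
  \<comment> \<open>The \<open>k\<close> factors \<open>1/X\<close> shift exponents by
    \<open>k\<close>, so the first-order coefficients computed above become constant terms, and
    these add up to \<open>poly T 0\<close>.\<close>
  have "fls_nth (\<Prod>i\<in>K. x \<sigma> i) 0 = fps_nth (\<Prod>i\<in>K. d \<sigma> i) k" for \<sigma>
  proof -
    have "(\<Prod>i\<in>K. x \<sigma> i) = fls_X_inv ^ k * fps_to_fls (\<Prod>i\<in>K. d \<sigma> i)"
      by (simp add: x_def prod.distrib K(2) P.hom_prod)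
    then show ?thesis by (simp add: fls_X_inv_power_times_conv_shift)
  qed
  then have "fls_nth (inv_X_poly T) 0 = (\<Sum>\<sigma>\<in>?S. fps_nth (\<Prod>i\<in>K. d \<sigma> i) k)"
    unfolding T(1) by (simp add: fls_nth_sum)
  then have "poly T 0 \<noteq> 0" using K(3) by (simp add: fls_nth_inv_X_poly poly_0_coeff_0)
  then obtain e where e: "marked_poly n b e = marked_poly n b (\<lambda>_. 0)" "(\<Prod>i\<in>K. e i) \<noteq> 0"
    using T(2) Q0 by auto
  obtain i where "i \<in> K" using K(2) k by fastforce
  moreover have "finite K" using K finite_subset by blast
  ultimately have "i < n" "e i \<noteq> 0" using e(2) K(1) by auto
  then show ?thesis using that e(1) by blast
qed

section \<open>The spectrum theorem\<close>

lemma order_prod_linear_factors: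
  "order x (\<Prod>y\<in>#R. [:- y, 1:]) = count R x" for x :: "'a::field"
proof (induction R)
  case (add y R)
  have nz: "(\<Prod>y\<in>#R. [:- y, 1 :: 'a:]) \<noteq> 0" by (auto simp: prod_mset_zero_iff)
  then have "[:- y, 1:] * (\<Prod>y\<in>#R. [:- y, 1:]) \<noteq> 0" by (simp only: mult_eq_0_iff) simp
  then have "order x ([:- y, 1:] * (\<Prod>y\<in>#R. [:- y, 1:])) = order x [:- y, 1:] + count R x"
    by (subst order_mult) (simp_all only: add.IH not_False_eq_True)
  moreover have "order x [:- y, 1:] = (if x = y then 1 else 0)"
    using order_power_n_n[of y 1] by (auto intro!: order_0I)
  ultimately show ?case by simp
qed (auto intro!: order_0I)

text \<open>A characteristic polynomial is monic and splits, hence is determined by its root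
  multiplicities.\<close>

lemma same_spectrum_iff_char_poly_eq:
  fixes A B :: "'a::alg_closed_field mat"
  assumes A: "A \<in> carrier_mat n n" and B: "B \<in> carrier_mat n n"
  shows "same_spectrum A B \<longleftrightarrow> char_poly A = char_poly B"
proof
  assume eq: "same_spectrum A B"
  have split: "\<exists>R. char_poly C = (\<Prod>x\<in>#R. [:- x, 1:])" if C: "C \<in> carrier_mat n n" for C :: "'a mat"
  proof -
    have "monic (char_poly C)" using degree_monic_char_poly[OF C] by simp
    moreover from this have "char_poly C \<noteq> 0" by auto
    ultimately show ?thesis using alg_closed_imp_factorization[of "char_poly C"] by auto
  qed
  obtain R S where RS: "char_poly A = (\<Prod>x\<in>#R. [:- x, 1:])" "char_poly B = (\<Prod>x\<in>#S. [:- x, 1:])"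
    using split A B by meson
  have "count R x = count S x" for x
    using eq unfolding same_spectrum_def alg_mult_def RS order_prod_linear_factors by simp
  then have "R = S" by (rule multiset_eqI)
  then show "char_poly A = char_poly B" unfolding RS by simp
qed (simp add: same_spectrum_def alg_mult_def)

theorem theoremA:
  fixes A :: "'a :: alg_closed_field mat" and n :: nat
  assumes char: "CHAR('a) = 0 \<or> CHAR('a) > n"
    and A: "A \<in> carrier_mat n n"
  shows "(\<exists>D \<in> carrier_mat n n. diagonal_mat D \<and> D \<noteq> 0\<^sub>m n n \<and> same_spectrum A (A + D))
     \<longleftrightarrow> (\<exists>k \<in> {1..n}. \<exists>N1 N2. N1 \<subseteq> {..<n} \<and> N2 \<subseteq> {..<n} \<and> card N1 = k \<and> card N2 = k
            \<and> principal_minor A N1 \<noteq> principal_minor A N2)"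
    (is "?L \<longleftrightarrow> ?R")
proof -
  let ?I = "{..<n}"
  let ?diag = "\<lambda>d. mat n n (\<lambda>(i, j). if i = j then d i else 0) :: 'a mat"
  define b where "b = principal_minor (- A)"
  have b0: "b {} = 1" by (simp add: b_def principal_minor_empty)
  have bM: "b M = (-1) ^ card M * principal_minor A M" if "M \<subseteq> ?I" for M
    using principal_minor_uminus[OF A that] by (simp add: b_def)
  have nz: "of_nat m \<noteq> (0 :: 'a)" if "1 \<le> m" "m \<le> n" for m
    using char that by (auto simp: of_nat_eq_0_iff_char_dvd dest: dvd_imp_le)
  have nzf: "of_nat (fact m) \<noteq> (0 :: 'a)" if "m \<le> n" for m
    using nz that by (auto simp: fact_prod)
  have spectrum: "same_spectrum A (A + ?diag d) \<longleftrightarrow> marked_poly n b (\<lambda>i. - d i) = marked_poly n b (\<lambda>_. 0)" for d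
  proof -
    have "A + ?diag d \<in> carrier_mat n n" using A by simp
    note same_spectrum_iff_char_poly_eq[OF A this]
    then show ?thesis
      unfolding char_poly_add_diag[OF A] char_poly_eq_marked_poly[OF A] b_def by auto
  qed
  show ?thesis
  proof
    assume ?L
    then obtain D where D: "D \<in> carrier_mat n n" "diagonal_mat D" "D \<noteq> 0\<^sub>m n n" "same_spectrum A (A + D)" by blast
    define d where "d i = D $$ (i, i)" for i
    have Dd: "D = ?diag d"
      using D by (intro eq_matI) (auto simp: d_def diagonal_mat_def)
    have eq: "marked_poly n b (\<lambda>i. - d i) = marked_poly n b (\<lambda>_. 0)"
      using D(4) spectrum[of d] by (simp only: Dd[symmetric])
    show ?R
    proof (rule ccontr)
      assume nR: "\<not> ?R"
      have const: "b M = b N" if MN: "M \<subseteq> ?I" "N \<subseteq> ?I" "card M = card N" for M N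
      proof (cases "card M = 0")
        case True
        then have "M = {}" "N = {}" using MN finite_subset[of _ ?I] by auto
        then show ?thesis by simp
      next
        case False
        then have kn: "card M \<in> {1..n}" using card_mono[OF _ MN(1)] by simp
        have "principal_minor A M = principal_minor A N"
        proof (rule ccontr)
          assume "principal_minor A M \<noteq> principal_minor A N"
          then have ?R using MN by (intro bexI[OF _ kn] exI[of _ M] exI[of _ N]) simp
          then show False using nR by contradiction
        qed
        then show ?thesis using bM MN by simp
      qed
      \<comment> \<open>With \<open>k = Suc n\<close> every nonempty mark is cleared, so the
        equation reduces to the product of the \<open>t - d i\<close> being
        \<open>t^n\<close>.\<close>
      obtain b' where b': "b' {} = 1" "\<And>M. M \<subseteq> ?I \<Longrightarrow> M \<noteq> {} \<Longrightarrow> card M < Suc n \<Longrightarrow> b' M = 0"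
        "\<And>d e. marked_poly n b' d = marked_poly n b' e \<longleftrightarrow> marked_poly n b d = marked_poly n b e"
      proof (rule marked_poly_normalise[where b = b and n = n and k = "Suc n"])
        show "b M = b N" if "M \<subseteq> ?I" "N \<subseteq> ?I" "card M = card N" for M N
          using that by (rule const)
        show "of_nat (fact m) \<noteq> (0 :: 'a)" if "m \<le> n" for m using that by (rule nzf)
      qed (rule b0, rule that, assumption, blast+)
      have "b' M = empty_mark M" if M: "M \<subseteq> ?I" for M
        using b'(1,2) card_mono[OF _ M] M by (auto simp: empty_mark_def)
      then have "marked_poly n b' x = marked_poly n empty_mark x" for x
        unfolding marked_poly_def by (intro sum.cong) auto
      then have "(\<Prod>i<n. [:- d i, 1:]) = monom 1 n"
        using b'(3) eq marked_poly_empty_mark marked_poly_empty_mark_0 by metis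
      then have prod: "(\<Prod>i<n. t - d i) = t ^ n" for t
        by (auto simp: poly_prod poly_monom dest!: arg_cong[of _ _ "\<lambda>p. poly p t"])
      have "d i = 0" if "i < n" for i
      proof -
        have "(\<Prod>j<n. d i - d j) = 0" using that by (intro prod_zero bexI[of _ i]) simp_all
        then show ?thesis using prod[of "d i"] by simp
      qed
      then have "D = 0\<^sub>m n n" unfolding Dd by (intro eq_matI) auto
      then show False using D(3) by simp
    qed
  next
    assume R: ?R
    define differ where "differ k \<longleftrightarrow> (\<exists>N1 N2. N1 \<subseteq> ?I \<and> N2 \<subseteq> ?I \<and> card N1 = k \<and> card N2 = k \<and> b N1 \<noteq> b N2)" for k
    have "\<exists>k. differ k"
    proof -
      obtain k N1 N2 where N: "N1 \<subseteq> ?I" "N2 \<subseteq> ?I" "card N1 = k" "card N2 = k"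
        "principal_minor A N1 \<noteq> principal_minor A N2" using R by blast
      then have "b N1 \<noteq> b N2" using bM by simp
      then show ?thesis using N unfolding differ_def by blast
    qed
    define k where "k = (LEAST k. differ k)"
    have "differ k" unfolding k_def using \<open>\<exists>k. differ k\<close> by (rule LeastI_ex)
    then obtain N1 N2 where N: "N1 \<subseteq> ?I" "card N1 = k" "N2 \<subseteq> ?I" "card N2 = k" and ne: "b N1 \<noteq> b N2"
      unfolding differ_def by blast
    have const: "b M = b N" if "M \<subseteq> ?I" "N \<subseteq> ?I" "card M = card N" "card M < k" for M N
      using not_less_Least[of "card M" differ] that unfolding k_def differ_def by metis
    have k1: "k \<ge> 1"
    proof (rule ccontr)
      assume "\<not> k \<ge> 1"
      then have "card N1 = 0" "card N2 = 0" using N by simp_all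
      moreover have "finite N1" "finite N2" using N finite_subset[of _ ?I] by blast+
      ultimately have "N1 = {}" "N2 = {}" by simp_all
      then show False using ne by simp
    qed
    obtain b' where b': "b' {} = 1" "\<And>M. M \<subseteq> ?I \<Longrightarrow> M \<noteq> {} \<Longrightarrow> card M < k \<Longrightarrow> b' M = 0"
      "\<And>M N. M \<subseteq> ?I \<Longrightarrow> N \<subseteq> ?I \<Longrightarrow> card M = k \<Longrightarrow> card N = k \<Longrightarrow> b' M - b' N = b M - b N"
      "\<And>d e. marked_poly n b' d = marked_poly n b' e \<longleftrightarrow> marked_poly n b d = marked_poly n b e"
    proof (rule marked_poly_normalise[where b = b and n = n and k = k])
      show "b M = b N" if "M \<subseteq> ?I" "N \<subseteq> ?I" "card M = card N" "card M < k" for M N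
        using that by (rule const)
      show "of_nat (fact m) \<noteq> (0 :: 'a)" if "m \<le> n" for m using that by (rule nzf)
    qed (rule b0, rule that, assumption, blast+)
    have ne': "b' N1 \<noteq> b' N2" using b'(3)[OF N(1,3,2,4)] ne by auto
    obtain d i where d: "marked_poly n b' d = marked_poly n b' (\<lambda>_. 0)" "i < n" "d i \<noteq> 0"
    proof (rule nonsymmetric_imp_nonzero_solution[where b = b' and L = N1 and L' = N2, OF k1 b'(1)])
      show "b' M = 0" if "M \<subseteq> ?I" "M \<noteq> {}" "card M < k" for M using that by (rule b'(2))
      show "of_nat m \<noteq> (0 :: 'a)" if "1 \<le> m" "m \<le> n" for m using that by (rule nz)
    qed (rule N ne', rule N ne', rule N ne', rule N ne', rule N ne', rule that)
    \<comment> \<open>\<open>spectrum\<close> shifts the polynomial by the negated diagonal, hence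
      the sign.\<close>
    define D where "D = ?diag (\<lambda>i. - d i)"
    have "same_spectrum A (A + D)" unfolding D_def spectrum using d(1) b'(4) by simp
    moreover have "D $$ (i, i) \<noteq> 0" using d by (simp add: D_def)
    then have "D \<noteq> 0\<^sub>m n n" using d(2) by auto
    moreover have "diagonal_mat D" "D \<in> carrier_mat n n" by (auto simp: D_def diagonal_mat_def)
    ultimately show ?L by blast
  qed
qed

end
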